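(* Let $n$ be a positive integer, let $a_1,\dots,a_{n-1},b_1,\dots,b_{n-1}\ge 2$ be integers with $\gcd(a_i,b_j)=1$ whenever $i>j$, and let $$G=\left\langle x_1,\dots,x_n \;\middle|\; x_1^{a_1}=x_2^{b_1},\ x_2^{a_2}=x_3^{b_2},\ \dots,\ x_{n-1}^{a_{n-1}}=x_n^{b_{n-1}}\right\rangle .$$ Then $G$ is $RR0$-stable.
   Context: A $C^*$-algebra has real rank zero if each self-adjoint element can be approximated in norm by self-adjoint elements with finite spectra. Tracial ultraproducts: an ultrafilter $\alpha$ on $\mathbb N$ is nontrivial if it contains a sequence of sets $E_n$ with $\bigcap_n E_n=\varnothing$. For unital $C^*$-algebras $\mathcal A_i$ with tracial states $\rho_i$ ($i\in\mathbb N$), let $\|b\|_{2,\rho_i}=\rho_i(b^*b)^{1/2}$ and let $\prod_i\mathcal A_i$ be the $C^*$-algebra of norm-bounded sequences $(a_i)$, $a_i\in\mathcal A_i$, with the supremum norm. The tracial ultraproduct $\prod_{i\in\mathbb N}^{\alpha}(\mathcal A_i,\rho_i)$ is the quotient of $\prod_i\mathcal A_i$ by the ideal of all $(a_i)$ with $\lim_{i\to\alpha}\|a_i\|_{2,\rho_i}=0$; the coset of $(a_i)$ is written $\{a_i\}_\alpha$. $\mathcal U(\mathcal A)$ denotes the unitary group of $\mathcal A$. Stability: a discrete group $G$ is $RR0$-stable if for every nontrivial ultrafilter $\alpha$ on $\mathbb N$ and all unital $C^*$-algebras $\mathcal A_i$ of real rank zero with tracial states $\rho_i$, each group homomorphism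 $f:G\to\mathcal U(\prod_{i\in\mathbb N}^{\alpha}(\mathcal A_i,\rho_i))$ is liftable, i.e. there are homomorphisms $f_i:G\to\mathcal U(\mathcal A_i)$, $i\in\mathbb N$, with $f(g)=\{f_i(g)\}_\alpha$ for all $g\in G$. *)

theory Defs
  imports Complex_Main "HOL-Library.Nonpos_Ints" "HOL-Algebra.Module" "HOL-Algebra.QuotRing"
begin

section \<open>Unital C*-algebras\<close>

text \<open>
  The algebras are carrier-based, so that a sequence of different C*-algebras can be written as a
  function into a single record type. The operations are only constrained on the carrier.
\<close>

record 'a cstar = "(complex, 'a) module" +
  star :: "'a \<Rightarrow> 'a"
  cnorm :: "'a \<Rightarrow> real"

locale unital_cstar_algebra = ring A for A :: "('a, 'b) cstar_scheme" (structure) +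
  assumes scale_closed: "x \<in> carrier A \<Longrightarrow> c \<odot> x \<in> carrier A"
    and scale_add_left: "x \<in> carrier A \<Longrightarrow> (c + d) \<odot> x = c \<odot> x \<oplus> d \<odot> x"
    and scale_add_right:
      "\<lbrakk>x \<in> carrier A; y \<in> carrier A\<rbrakk> \<Longrightarrow> c \<odot> (x \<oplus> y) = c \<odot> x \<oplus> c \<odot> y"
    and scale_scale: "x \<in> carrier A \<Longrightarrow> (c * d) \<odot> x = c \<odot> (d \<odot> x)"
    and scale_one: "x \<in> carrier A \<Longrightarrow> 1 \<odot> x = x"
    and scale_mult_left:
      "\<lbrakk>x \<in> carrier A; y \<in> carrier A\<rbrakk> \<Longrightarrow> (c \<odot> x) \<otimes> y = c \<odot> (x \<otimes> y)"
    and scale_mult_right: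
      "\<lbrakk>x \<in> carrier A; y \<in> carrier A\<rbrakk> \<Longrightarrow> x \<otimes> (c \<odot> y) = c \<odot> (x \<otimes> y)"
    and star_closed: "x \<in> carrier A \<Longrightarrow> star A x \<in> carrier A"
    and star_star: "x \<in> carrier A \<Longrightarrow> star A (star A x) = x"
    and star_add:
      "\<lbrakk>x \<in> carrier A; y \<in> carrier A\<rbrakk> \<Longrightarrow> star A (x \<oplus> y) = star A x \<oplus> star A y"
    and star_scale: "x \<in> carrier A \<Longrightarrow> star A (c \<odot> x) = cnj c \<odot> star A x"
    and star_mult:
      "\<lbrakk>x \<in> carrier A; y \<in> carrier A\<rbrakk> \<Longrightarrow> star A (x \<otimes> y) = star A y \<otimes> star A x"
    and cnorm_nonneg: "x \<in> carrier A \<Longrightarrow> 0 \<le> cnorm A x"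
    and cnorm_eq_0: "x \<in> carrier A \<Longrightarrow> cnorm A x = 0 \<longleftrightarrow> x = \<zero>"
    and cnorm_triangle:
      "\<lbrakk>x \<in> carrier A; y \<in> carrier A\<rbrakk> \<Longrightarrow> cnorm A (x \<oplus> y) \<le> cnorm A x + cnorm A y"
    and cnorm_scale: "x \<in> carrier A \<Longrightarrow> cnorm A (c \<odot> x) = cmod c * cnorm A x"
    and cnorm_mult:
      "\<lbrakk>x \<in> carrier A; y \<in> carrier A\<rbrakk> \<Longrightarrow> cnorm A (x \<otimes> y) \<le> cnorm A x * cnorm A y"
    and cstar_identity: "x \<in> carrier A \<Longrightarrow> cnorm A (star A x \<otimes> x) = (cnorm A x)\<^sup>2"
    and complete:
      "\<lbrakk>\<And>k::nat. s k \<in> carrier A;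
        \<And>e. e > 0 \<Longrightarrow> \<exists>N. \<forall>j\<ge>N. \<forall>k\<ge>N. cnorm A (s j \<ominus> s k) < e\<rbrakk>
       \<Longrightarrow> \<exists>l\<in>carrier A. (\<lambda>k. cnorm A (s k \<ominus> l)) \<longlonglongrightarrow> 0"

definition self_adjoint :: "('a, 'b) cstar_scheme \<Rightarrow> 'a \<Rightarrow> bool" where
  "self_adjoint A x \<longleftrightarrow> x \<in> carrier A \<and> star A x = x"

definition spectrum :: "('a, 'b) cstar_scheme \<Rightarrow> 'a \<Rightarrow> complex set" where
  "spectrum A x = {c. c \<odot>\<^bsub>A\<^esub> \<one>\<^bsub>A\<^esub> \<ominus>\<^bsub>A\<^esub> x \<notin> Units A}"

definition real_rank_zero :: "('a, 'b) cstar_scheme \<Rightarrow> bool" where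
  "real_rank_zero A \<longleftrightarrow>
     (\<forall>x e. self_adjoint A x \<and> e > 0 \<longrightarrow>
        (\<exists>y. self_adjoint A y \<and> finite (spectrum A y) \<and> cnorm A (x \<ominus>\<^bsub>A\<^esub> y) < e))"

definition unitary_group :: "('a, 'b) cstar_scheme \<Rightarrow> 'a monoid" where
  "unitary_group A =
     \<lparr>carrier = {u \<in> carrier A. star A u \<otimes>\<^bsub>A\<^esub> u = \<one>\<^bsub>A\<^esub> \<and> u \<otimes>\<^bsub>A\<^esub> star A u = \<one>\<^bsub>A\<^esub>},
      mult = mult A, one = one A\<rparr>"

definition tracial_state :: "('a, 'b) cstar_scheme \<Rightarrow> ('a \<Rightarrow> complex) \<Rightarrow> bool" where
  "tracial_state A \<rho> \<longleftrightarrow>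
     (\<forall>x\<in>carrier A. \<forall>y\<in>carrier A. \<rho> (x \<oplus>\<^bsub>A\<^esub> y) = \<rho> x + \<rho> y) \<and>
     (\<forall>c. \<forall>x\<in>carrier A. \<rho> (c \<odot>\<^bsub>A\<^esub> x) = c * \<rho> x) \<and>
     (\<forall>x\<in>carrier A. \<rho> (star A x \<otimes>\<^bsub>A\<^esub> x) \<in> \<real>\<^sub>\<ge>\<^sub>0) \<and>
     \<rho> \<one>\<^bsub>A\<^esub> = 1 \<and>
     (\<forall>x\<in>carrier A. \<forall>y\<in>carrier A. \<rho> (x \<otimes>\<^bsub>A\<^esub> y) = \<rho> (y \<otimes>\<^bsub>A\<^esub> x))"

definition norm2 :: "('a, 'b) cstar_scheme \<Rightarrow> ('a \<Rightarrow> complex) \<Rightarrow> 'a \<Rightarrow> real" where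
  "norm2 A \<rho> x = sqrt (Re (\<rho> (star A x \<otimes>\<^bsub>A\<^esub> x)))"


section \<open>Tracial ultraproducts\<close>

text \<open>Ultrafilters are represented as filters whose eventually-true sets form the ultrafilter.\<close>

definition ultrafilter :: "'i filter \<Rightarrow> bool" where
  "ultrafilter F \<longleftrightarrow> F \<noteq> bot \<and> (\<forall>P. eventually P F \<or> eventually (\<lambda>i. \<not> P i) F)"

definition nontrivial_ultrafilter :: "nat filter \<Rightarrow> bool" where
  "nontrivial_ultrafilter \<alpha> \<longleftrightarrow> ultrafilter \<alpha> \<and>
     (\<exists>E :: nat \<Rightarrow> nat set. (\<forall>n. eventually (\<lambda>i. i \<in> E n) \<alpha>) \<and> (\<Inter>n. E n) = {})"

definition bounded_product :: "(nat \<Rightarrow> ('a, 'b) cstar_scheme) \<Rightarrow> (nat \<Rightarrow> 'a) cstar" where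
  "bounded_product A =
     \<lparr>carrier = {a. (\<forall>i. a i \<in> carrier (A i)) \<and> bdd_above (range (\<lambda>i. cnorm (A i) (a i)))},
      mult = (\<lambda>a b i. a i \<otimes>\<^bsub>A i\<^esub> b i), one = (\<lambda>i. \<one>\<^bsub>A i\<^esub>),
      zero = (\<lambda>i. \<zero>\<^bsub>A i\<^esub>), add = (\<lambda>a b i. a i \<oplus>\<^bsub>A i\<^esub> b i),
      smult = (\<lambda>c a i. c \<odot>\<^bsub>A i\<^esub> a i), star = (\<lambda>a i. star (A i) (a i)),
      cnorm = (\<lambda>a. SUP i. cnorm (A i) (a i))\<rparr>"

definition null_ideal ::
    "nat filter \<Rightarrow> (nat \<Rightarrow> ('a, 'b) cstar_scheme) \<Rightarrow> (nat \<Rightarrow> 'a \<Rightarrow> complex) \<Rightarrow> (nat \<Rightarrow> 'a) set" where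
  "null_ideal \<alpha> A \<rho> =
     {a \<in> carrier (bounded_product A). ((\<lambda>i. norm2 (A i) (\<rho> i) (a i)) \<longlongrightarrow> 0) \<alpha>}"

text \<open>
  The ring structure of the quotient by a (self-adjoint, closed, two-sided) ideal is that of
  \<^const>\<open>FactRing\<close>; scalar multiplication and involution are given by representatives in the style
  of \<^const>\<open>rcoset_mult\<close>, and the norm is the quotient norm.
\<close>

definition cstar_quotient :: "('a, 'b) cstar_scheme \<Rightarrow> 'a set \<Rightarrow> 'a set cstar" where
  "cstar_quotient A I =
     \<lparr>carrier = carrier (A Quot I), mult = mult (A Quot I), one = one (A Quot I),
      zero = zero (A Quot I), add = add (A Quot I),
      smult = (\<lambda>c X. \<Union>x\<in>X. I +>\<^bsub>A\<^esub> (c \<odot>\<^bsub>A\<^esub> x)),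
      star = (\<lambda>X. \<Union>x\<in>X. I +>\<^bsub>A\<^esub> star A x),
      cnorm = (\<lambda>X. INF x\<in>X. cnorm A x)\<rparr>"

definition tracial_ultraproduct ::
    "nat filter \<Rightarrow> (nat \<Rightarrow> ('a, 'b) cstar_scheme) \<Rightarrow> (nat \<Rightarrow> 'a \<Rightarrow> complex)
      \<Rightarrow> (nat \<Rightarrow> 'a) set cstar" where
  "tracial_ultraproduct \<alpha> A \<rho> = cstar_quotient (bounded_product A) (null_ideal \<alpha> A \<rho>)"

definition ultraproduct_class ::
    "nat filter \<Rightarrow> (nat \<Rightarrow> ('a, 'b) cstar_scheme) \<Rightarrow> (nat \<Rightarrow> 'a \<Rightarrow> complex)
      \<Rightarrow> (nat \<Rightarrow> 'a) \<Rightarrow> (nat \<Rightarrow> 'a) set" where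
  "ultraproduct_class \<alpha> A \<rho> a = null_ideal \<alpha> A \<rho> +>\<^bsub>bounded_product A\<^esub> a"


section \<open>RR0-stability\<close>

definition liftable ::
    "nat filter \<Rightarrow> (nat \<Rightarrow> ('a, 'b) cstar_scheme) \<Rightarrow> (nat \<Rightarrow> 'a \<Rightarrow> complex)
      \<Rightarrow> ('g, 'm) monoid_scheme \<Rightarrow> ('g \<Rightarrow> (nat \<Rightarrow> 'a) set) \<Rightarrow> bool" where
  "liftable \<alpha> A \<rho> G f \<longleftrightarrow>
     (\<exists>\<phi> :: nat \<Rightarrow> 'g \<Rightarrow> 'a.
        (\<forall>i. \<phi> i \<in> hom G (unitary_group (A i))) \<and>
        (\<forall>g\<in>carrier G. f g = ultraproduct_class \<alpha> A \<rho> (\<lambda>i. \<phi> i g)))"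

text \<open>
  The type argument is the type in which the carriers of the algebras live. A definition cannot
  quantify over types, so stability in the full sense is the statement for an arbitrary type
  \<^typ>\<open>'a\<close>.
\<close>

definition RR0_stable :: "'a itself \<Rightarrow> ('g, 'm) monoid_scheme \<Rightarrow> bool" where
  "RR0_stable _ G \<longleftrightarrow> group G \<and>
     (\<forall>(\<alpha> :: nat filter) (A :: nat \<Rightarrow> 'a cstar) (\<rho> :: nat \<Rightarrow> 'a \<Rightarrow> complex).
        nontrivial_ultrafilter \<alpha> \<and>
        (\<forall>i. unital_cstar_algebra (A i) \<and> real_rank_zero (A i) \<and> tracial_state (A i) (\<rho> i)) \<longrightarrow>
        (\<forall>f \<in> hom G (unitary_group (tracial_ultraproduct \<alpha> A \<rho>)). liftable \<alpha> A \<rho> G f))"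


section \<open>Groups given by generators and relations\<close>

text \<open>
  The letter \<open>(x, True)\<close> stands for the generator \<open>x\<close> and \<open>(x, False)\<close> for its inverse; a pair
  \<open>(u, v)\<close> in \<open>R\<close> stands for the relation \<open>u = v\<close>. The group consists of the words modulo
  the least congruence that contains free cancellation and the relations.
\<close>

type_synonym 'x word = "('x \<times> bool) list"

definition words :: "'x set \<Rightarrow> 'x word set" where
  "words S = lists (S \<times> UNIV)"

inductive word_eq :: "'x set \<Rightarrow> ('x word \<times> 'x word) set \<Rightarrow> 'x word \<Rightarrow> 'x word \<Rightarrow> bool"
  for S R where
  refl: "w \<in> words S \<Longrightarrow> word_eq S R w w"
| sym: "word_eq S R u v \<Longrightarrow> word_eq S R v u"
| trans: "word_eq S R u v \<Longrightarrow> word_eq S R v w \<Longrightarrow> word_eq S R u w"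
| append: "word_eq S R u u' \<Longrightarrow> word_eq S R v v' \<Longrightarrow> word_eq S R (u @ v) (u' @ v')"
| cancel: "x \<in> S \<Longrightarrow> word_eq S R [(x, e), (x, \<not> e)] []"
| relation: "(u, v) \<in> R \<Longrightarrow> u \<in> words S \<Longrightarrow> v \<in> words S \<Longrightarrow> word_eq S R u v"

definition presented_group :: "'x set \<Rightarrow> ('x word \<times> 'x word) set \<Rightarrow> 'x word set monoid" where
  "presented_group S R =
     \<lparr>carrier = words S // {(u, v). word_eq S R u v},
      mult = (\<lambda>X Y. \<Union>u\<in>X. \<Union>v\<in>Y. {w. word_eq S R (u @ v) w}),
      one = {w. word_eq S R [] w}\<rparr>"

definition gen_power :: "'x \<Rightarrow> nat \<Rightarrow> 'x word" where
  "gen_power x k = replicate k (x, True)"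

definition chain_group :: "nat \<Rightarrow> (nat \<Rightarrow> nat) \<Rightarrow> (nat \<Rightarrow> nat) \<Rightarrow> nat word set monoid" where
  "chain_group n a b =
     presented_group {1..n} {(gen_power i (a i), gen_power (i + 1) (b i)) | i. i \<in> {1..<n}}"

end

theory Submission
  imports Defs "HOL-Library.Function_Algebras" "HOL-Computational_Algebra.Fundamental_Theorem_Algebra"
begin

text \<open>
  Put \<open>N\<^sub>j = b\<^sub>1 \<cdots> b\<^sub>j\<^sub>-\<^sub>1 a\<^sub>j \<cdots> a\<^sub>n\<^sub>-\<^sub>1\<close>. All the elements \<open>x\<^sub>j\<close> to the power
  \<open>N\<^sub>j\<close> agree, hence their common value \<open>z\<close> is central. Represent the images of the generators
  by bounded sequences that satisfy the relations up to 2-norm null sequences. Real rank zero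
  approximates a self-adjoint element by one with finite spectrum; cutting the spectrum into slowly
  shrinking bins at a well-chosen offset gives projections that almost commute, in 2-norm, with
  everything that almost commutes with the element. Pinching by these projections makes \<open>z\<close> an
  exactly central unitary with finite spectrum in a commutant which again has real rank zero. Dividing
  by central roots of \<open>z\<close> leaves unitaries of finite order. These are lifted one after the
  other: the spectral projections of \<open>x\<^sub>j\<close> to the power \<open>a\<^sub>j\<close> are finitely many, so
  \<open>x\<^sub>j\<^sub>+\<^sub>1\<close> can be pinched by them and its root of unity part lifted in their commutant.
\<close>

section \<open>Star algebras as a type class\<close>

text \<open>Real rank zero speaks only about self-adjoint elements: a unitary need not be a norm
  limit of unitaries with finite spectrum, and no Borel functional calculus is at hand. So every
  spectral cut is made on a self-adjoint approximant, and what survives a cut is controlled only in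
  the 2-norm. The bins balance two errors. For commutators of 2-norm \<theta>, bins of D steps of
  width \<theta> cost about D \<theta> in norm for the element that is cut and about D^(-1/2) in
  2-norm for the elements that are pinched; D of order \<theta>^(-1/2) sends both to zero. A unitary
  with finite spectrum has exact roots of every order. The numbers N_j make them compatible: a_j /
  N_j = b_j / N_(j+1), so the roots w_j of z of order N_j satisfy w_j^(a_j) = w_(j+1)^(b_j) exactly,
  provided that one branch of the argument is used for all of them. Commutants are used in place of
  corners because they keep the unit, the norm and the trace. Hence every argument can be repeated
  inside them, and being a null sequence means the same there.\<close>

class star_algebra = ring_1 +
  fixes csc :: "complex \<Rightarrow> 'a \<Rightarrow> 'a"  (infixr "*\<^sub>c" 75)
    and adj :: "'a \<Rightarrow> 'a"
  assumes csc_add_left: "(c + d) *\<^sub>c x = c *\<^sub>c x + d *\<^sub>c x"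
    and csc_add_right: "c *\<^sub>c (x + y) = c *\<^sub>c x + c *\<^sub>c y"
    and csc_csc [simp]: "c *\<^sub>c (d *\<^sub>c x) = (c * d) *\<^sub>c x"
    and csc_one [simp]: "1 *\<^sub>c x = x"
    and csc_mult_left [simp]: "(c *\<^sub>c x) * y = c *\<^sub>c (x * y)"
    and csc_mult_right [simp]: "x * (c *\<^sub>c y) = c *\<^sub>c (x * y)"
    and adj_adj [simp]: "adj (adj x) = x"
    and adj_add: "adj (x + y) = adj x + adj y"
    and adj_csc [simp]: "adj (c *\<^sub>c x) = cnj c *\<^sub>c adj x"
    and adj_mult: "adj (x * y) = adj y * adj x"


interpretation csc: Modules.module csc
  by unfold_locales (simp_all add: csc_add_left csc_add_right)

context star_algebra
begin

lemma adj_zero [simp]: "adj 0 = 0"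
  using adj_add[of 0 0] by simp

lemma adj_one [simp]: "adj 1 = 1"
  by (metis adj_adj adj_mult mult_1_left mult_1_right)

lemma adj_minus: "adj (- x) = - adj x"
  using adj_add[of x "- x"] by (simp add: eq_neg_iff_add_eq_0 add.commute)

lemma adj_diff: "adj (x - y) = adj x - adj y"
  using adj_add[of x "- y"] by (simp add: adj_minus)

lemma adj_sum: "adj (sum f I) = (\<Sum>i\<in>I. adj (f i))"
  by (induction I rule: infinite_finite_induct) (simp_all add: adj_add)

lemma adj_power: "adj (x ^ n) = adj x ^ n"
  by (induction n) (simp_all add: adj_mult power_commutes)

lemma csc_power: "(c *\<^sub>c x) ^ n = c ^ n *\<^sub>c x ^ n"
  by (induction n) (simp_all add: ac_simps)

lemma csc_half: "(1/2) *\<^sub>c x + (1/2) *\<^sub>c x = x"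
  using csc_add_left[of "1/2" "1/2" x] by simp

end

lemma csc_one_minus: "c \<noteq> 0 \<Longrightarrow> c *\<^sub>c (1 - inverse c *\<^sub>c x) = c *\<^sub>c 1 - (x :: 'a :: star_algebra)"
  by (simp add: csc.scale_right_diff_distrib)

lemmas adj_simps = adj_add adj_mult adj_minus adj_diff adj_sum adj_power

lemma (in monoid_mult) power_mult_commuting:
  assumes "x * y = y * x"
  shows "(x * y) ^ n = x ^ n * y ^ n"
proof (induction n)
  case (Suc n)
  have "y * x ^ n = x ^ n * y"
    using assms by (metis power_commuting_commutes)
  then show ?case
    using Suc by (metis mult.assoc power_Suc)
qed simp

lemma (in semiring_0) commute_sum:
  "(\<And>i. i \<in> I \<Longrightarrow> x * f i = f i * x) \<Longrightarrow> x * sum f I = sum f I * x"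
  by (simp add: sum_distrib_left sum_distrib_right)

text \<open>Sequences of elements become a star algebra with pointwise operations, so identities
  that hold in all fibres are handled by ring calculations on whole sequences.\<close>

instantiation "fun" :: (type, star_algebra) star_algebra
begin

definition csc_fun_def: "c *\<^sub>c f = (\<lambda>i. c *\<^sub>c f i)"
definition adj_fun_def: "adj f = (\<lambda>i. adj (f i))"

instance
  by standard (simp_all add: csc_fun_def adj_fun_def fun_eq_iff csc_add_left csc_add_right adj_add adj_mult)

end

lemma csc_fun_apply [simp]: "(c *\<^sub>c f) i = c *\<^sub>c f i"
  by (simp add: csc_fun_def)

lemma adj_fun_apply [simp]: "adj f i = adj (f i)"
  by (simp add: adj_fun_def)

lemma minus_fun_apply' [simp]: "(f - g) i = f i - g i"
  by (rule fun_diff_def[THEN fun_cong])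

lemma power_fun_apply [simp]: "(f ^ n) i = f i ^ (n::nat)"
  by (induction n) simp_all

lemma sum_fun_apply [simp]: "(\<Sum>k\<in>I. f k) i = (\<Sum>k\<in>I. f k i)"
  by (induction I rule: infinite_finite_induct) simp_all

section \<open>C*-algebras inside a star algebra\<close>

text \<open>\<open>nrm\<close> is a C*-seminorm on the whole type, so the norm laws carry no
  membership conditions; only definiteness and completeness are restricted to \<open>K\<close>.
  Passing to a subalgebra shrinks \<open>K\<close> and changes nothing else.\<close>

locale cstar =
  fixes K :: "'r::star_algebra set" and nrm :: "'r \<Rightarrow> real"
  assumes one_mem [simp, intro]: "1 \<in> K"
    and add_mem [simp, intro]: "x \<in> K \<Longrightarrow> y \<in> K \<Longrightarrow> x + y \<in> K"
    and mult_mem [simp, intro]: "x \<in> K \<Longrightarrow> y \<in> K \<Longrightarrow> x * y \<in> K"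
    and csc_mem [simp, intro]: "x \<in> K \<Longrightarrow> c *\<^sub>c x \<in> K"
    and adj_mem [simp, intro]: "x \<in> K \<Longrightarrow> adj x \<in> K"
    and nrm_triangle: "nrm (x + y) \<le> nrm x + nrm y"
    and nrm_csc [simp]: "nrm (c *\<^sub>c x) = cmod c * nrm x"
    and nrm_mult: "nrm (x * y) \<le> nrm x * nrm y"
    and nrm_adj_mult: "nrm (adj x * x) = (nrm x)\<^sup>2"
    and nrm_one [simp]: "nrm 1 = 1"
    and nrm_eq_0: "x \<in> K \<Longrightarrow> nrm x = 0 \<Longrightarrow> x = 0"
    and complete: "(\<And>k::nat. s k \<in> K) \<Longrightarrow>
      (\<And>e. e > 0 \<Longrightarrow> \<exists>N. \<forall>j\<ge>N. \<forall>k\<ge>N. nrm (s j - s k) < e) \<Longrightarrow>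
      \<exists>l\<in>K. (\<lambda>k. nrm (s k - l)) \<longlonglongrightarrow> 0"
begin

section \<open>Elementary norm estimates and limits\<close>

lemma zero_mem [simp, intro]: "0 \<in> K"
  using csc_mem[of 1 0] by simp

lemma minus_mem [simp, intro]: "x \<in> K \<Longrightarrow> - x \<in> K"
  using csc_mem[of x "-1"] by (simp add: csc.scale_minus_left)

lemma diff_mem [simp, intro]: "x \<in> K \<Longrightarrow> y \<in> K \<Longrightarrow> x - y \<in> K"
  using add_mem[of x "- y"] by simp

lemma power_mem [simp, intro]: "x \<in> K \<Longrightarrow> x ^ n \<in> K"
  by (induction n) simp_all

lemma sum_mem [simp, intro]: "(\<And>i. i \<in> I \<Longrightarrow> f i \<in> K) \<Longrightarrow> sum f I \<in> K"
  by (induction I rule: infinite_finite_induct) simp_all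

lemma nrm_zero [simp]: "nrm 0 = 0"
  using nrm_csc[of 0 0] by simp

lemma nrm_minus [simp]: "nrm (- x) = nrm x"
  using nrm_csc[of "-1" x] by (simp add: csc.scale_minus_left)

lemma nrm_nonneg [simp]: "0 \<le> nrm x"
  using nrm_triangle[of x "- x"] by simp

lemma nrm_diff: "nrm (x - y) \<le> nrm x + nrm y"
  using nrm_triangle[of x "- y"] by simp

lemma nrm_diff_commute: "nrm (x - y) = nrm (y - x)"
  using nrm_minus[of "x - y"] by simp

lemma nrm_sum: "nrm (sum f I) \<le> (\<Sum>i\<in>I. nrm (f i))"
proof (induction I rule: infinite_finite_induct)
  case (insert i I)
  then show ?case
    using nrm_triangle[of "f i" "sum f I"] by simp
qed simp_all

lemma nrm_power: "nrm (x ^ n) \<le> nrm x ^ n"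
proof (induction n)
  case (Suc n)
  then show ?case
    using nrm_mult[of x "x ^ n"] mult_left_mono[OF Suc, of "nrm x"] by simp
qed simp

lemma nrm_adj [simp]: "nrm (adj x) = nrm x"
proof -
  have "nrm x \<le> nrm (adj x)" for x
  proof (cases "nrm x = 0")
    case False
    have "nrm x * nrm x \<le> nrm (adj x) * nrm x"
      using nrm_adj_mult[of x] nrm_mult[of "adj x" x] by (simp add: power2_eq_square)
    then show ?thesis
      using False nrm_nonneg[of x] by (metis less_eq_real_def mult_right_le_imp_le)
  qed simp
  from this[of x] this[of "adj x"] show ?thesis by simp
qed

lemma nrm_mult_le: "nrm x \<le> a \<Longrightarrow> nrm y \<le> b \<Longrightarrow> nrm (x * y) \<le> a * b"
  by (meson mult_mono nrm_mult nrm_nonneg order_trans)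

lemma nrm_unitary: "adj x * x = 1 \<Longrightarrow> nrm x = 1"
  using nrm_adj_mult[of x] nrm_nonneg[of x] by (simp add: power2_eq_1_iff)

lemma lim_unique:
  assumes "x \<in> K" "y \<in> K" "(\<lambda>k. nrm (s k - x)) \<longlonglongrightarrow> 0" "(\<lambda>k. nrm (s k - y)) \<longlonglongrightarrow> 0"
  shows "x = y"
proof -
  have "nrm (x - y) \<le> nrm (s k - x) + nrm (s k - y)" for k
    using nrm_triangle[of "x - s k" "s k - y"] nrm_diff_commute[of x "s k"] by simp
  moreover have "(\<lambda>k. nrm (s k - x) + nrm (s k - y)) \<longlonglongrightarrow> 0"
    using tendsto_add[OF assms(3,4)] by simp
  ultimately have "nrm (x - y) \<le> 0"
    by (intro LIMSEQ_le_const) auto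
  then have "nrm (x - y) = 0"
    using nrm_nonneg[of "x - y"] by linarith
  then show ?thesis
    using nrm_eq_0[of "x - y"] assms by simp
qed

lemma lim_mult_left:
  assumes "(\<lambda>k. nrm (s k - l)) \<longlonglongrightarrow> 0"
  shows "(\<lambda>k. nrm (x * s k - x * l)) \<longlonglongrightarrow> 0"
proof (rule tendsto_sandwich[OF _ _ tendsto_const])
  show "(\<lambda>k. nrm x * nrm (s k - l)) \<longlonglongrightarrow> 0"
    using tendsto_mult[OF tendsto_const assms, of "nrm x"] by simp
qed (auto simp: right_diff_distrib[symmetric] intro!: always_eventually nrm_mult)

lemma lim_mult_right:
  assumes "(\<lambda>k. nrm (s k - l)) \<longlonglongrightarrow> 0"
  shows "(\<lambda>k. nrm (s k * x - l * x)) \<longlonglongrightarrow> 0"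
proof (rule tendsto_sandwich[OF _ _ tendsto_const])
  show "(\<lambda>k. nrm (s k - l) * nrm x) \<longlonglongrightarrow> 0"
    using tendsto_mult[OF assms tendsto_const, of "nrm x"] by simp
qed (auto simp: left_diff_distrib[symmetric] intro!: always_eventually nrm_mult)

text \<open>Feeds \<open>complete\<close> for the two limits constructed later: the Neumann series
  and the square root iteration.\<close>

lemma geometric_Cauchy:
  fixes s :: "nat \<Rightarrow> 'r"
  assumes r: "0 \<le> r" "r < 1" and step: "\<And>k. nrm (s (Suc k) - s k) \<le> C * r ^ k"
    and e: "e > 0"
  shows "\<exists>N. \<forall>j\<ge>N. \<forall>k\<ge>N. nrm (s j - s k) < e"
proof -
  have C: "C \<ge> 0"
    using order_trans[OF nrm_nonneg step[of 0]] by simp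
  have *: "nrm (s (N + m) - s N) \<le> C * r ^ N / (1 - r)" for N m
  proof -
    have "nrm (s (N + m) - s N) \<le> (\<Sum>i<m. C * r ^ (N + i))"
    proof (induction m)
      case (Suc m)
      then show ?case
        using nrm_triangle[of "s (Suc (N + m)) - s (N + m)" "s (N + m) - s N"] step[of "N + m"] by simp
    qed simp
    also have "\<dots> = C * r ^ N * (\<Sum>i<m. r ^ i)"
      by (simp add: sum_distrib_left power_add mult.assoc)
    also have "(\<Sum>i<m. r ^ i) \<le> 1 / (1 - r)"
      using r by (simp add: sum_gp_strict divide_right_mono)
    finally show ?thesis
      using C r by (simp add: mult_left_mono)
  qed
  have "(\<lambda>N. 2 * (C * r ^ N / (1 - r))) \<longlonglongrightarrow> 2 * (C * 0 / (1 - r))"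
    using r by (intro tendsto_intros LIMSEQ_power_zero) auto
  then have "eventually (\<lambda>N. 2 * (C * r ^ N / (1 - r)) < e) sequentially"
    using e by (intro order_tendstoD(2)[of _ 0]) auto
  then obtain N where N: "2 * (C * r ^ N / (1 - r)) < e"
    by (auto simp: eventually_sequentially)
  have "nrm (s j - s k) < e" if "j \<ge> N" "k \<ge> N" for j k
  proof -
    obtain m m' where m: "j = N + m" "k = N + m'"
      using le_Suc_ex[OF \<open>j \<ge> N\<close>] le_Suc_ex[OF \<open>k \<ge> N\<close>] by blast
    have "nrm (s j - s k) \<le> nrm (s j - s N) + nrm (s k - s N)"
      using nrm_triangle[of "s j - s N" "s N - s k"] nrm_diff_commute[of "s N" "s k"] by simp
    then show ?thesis
      using *[of N m] *[of N m'] N m by simp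
  qed
  then show ?thesis by blast
qed

section \<open>Invertibility, the Neumann series and reality of the spectrum\<close>

definition invertible where
  "invertible x \<longleftrightarrow> (\<exists>y\<in>K. x * y = 1 \<and> y * x = 1)"

definition inverse_of :: "'r \<Rightarrow> 'r" where
  "inverse_of x = (SOME y. y \<in> K \<and> x * y = 1 \<and> y * x = 1)"

lemma inverse_of:
  assumes "invertible x"
  shows "inverse_of x \<in> K" "x * inverse_of x = 1" "inverse_of x * x = 1"
proof -
  have "\<exists>y. y \<in> K \<and> x * y = 1 \<and> y * x = 1"
    using assms by (auto simp: invertible_def)
  from someI_ex[OF this] show "inverse_of x \<in> K" "x * inverse_of x = 1" "inverse_of x * x = 1"
    by (auto simp: inverse_of_def)
qed

lemma inverse_of_unique: "x * y = 1 \<Longrightarrow> y * x = 1 \<Longrightarrow> invertible x \<Longrightarrow> inverse_of x = y"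
  using mult.assoc[of y x "inverse_of x"] inverse_of(2)[of x] by simp

lemma invertible_mult: "invertible x \<Longrightarrow> invertible y \<Longrightarrow> invertible (x * y)"
proof -
  assume "invertible x" "invertible y"
  then obtain x' y' where *: "x' \<in> K" "x * x' = 1" "x' * x = 1" "y' \<in> K" "y * y' = 1" "y' * y = 1"
    by (auto simp: invertible_def)
  then have "(x * y) * (y' * x') = 1" "(y' * x') * (x * y) = 1"
    by (metis mult.assoc mult_1_right)+
  then show ?thesis
    unfolding invertible_def using * by (intro bexI[of _ "y' * x'"]) auto
qed

lemma invertible_csc: "c \<noteq> 0 \<Longrightarrow> invertible (c *\<^sub>c x) \<longleftrightarrow> invertible x"
proof -
  have "invertible (c *\<^sub>c x)" if "c \<noteq> 0" and inv: "invertible x" for c x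
  proof -
    obtain y where "y \<in> K" "x * y = 1" "y * x = 1"
      using inv by (auto simp: invertible_def)
    then show ?thesis
      unfolding invertible_def using \<open>c \<noteq> 0\<close>
      by (intro bexI[of _ "inverse c *\<^sub>c y"]) auto
  qed
  from this[of c x] this[of "inverse c" "c *\<^sub>c x"] show "c \<noteq> 0 \<Longrightarrow> ?thesis"
    by auto
qed

text \<open>Neumann series. The bound on the inverse \<open>l\<close> comes from
  \<open>l = 1 + x * l\<close>.\<close>

lemma invertible_one_minus:
  assumes "x \<in> K" and r: "nrm x < 1"
  shows "invertible (1 - x)" and "nrm (inverse_of (1 - x)) \<le> 1 / (1 - nrm x)"
proof -
  let ?s = "\<lambda>n. \<Sum>k<n. x ^ k"
  have "\<exists>l\<in>K. (\<lambda>k. nrm (?s k - l)) \<longlonglongrightarrow> 0"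
    using assms nrm_power[of x]
    by (intro complete geometric_Cauchy[where C = 1 and r = "nrm x"]) auto
  then obtain l where l: "l \<in> K" "(\<lambda>k. nrm (?s k - l)) \<longlonglongrightarrow> 0" ..
  have *: "(1 - x) * ?s n = 1 - x ^ n" for n
    by (induction n) (simp_all add: distrib_left, simp add: algebra_simps)
  have **: "?s n * (1 - x) = 1 - x ^ n" for n
    by (induction n) (simp_all add: distrib_right, simp add: algebra_simps power_commutes)
  have lim: "(\<lambda>n. nrm (1 - x ^ n - 1)) \<longlonglongrightarrow> 0"
    by (rule tendsto_sandwich[OF _ _ tendsto_const LIMSEQ_power_zero[of "nrm x"]])
      (use r in \<open>auto intro!: always_eventually nrm_power\<close>)
  have 1: "(1 - x) * l = 1"
    using lim lim_mult_left[OF l(2), of "1 - x"] assms l(1)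
    by (intro lim_unique[where s = "\<lambda>n. 1 - x ^ n"]) (auto simp: *)
  have 2: "l * (1 - x) = 1"
    using lim lim_mult_right[OF l(2), of "1 - x"] assms l(1)
    by (intro lim_unique[where s = "\<lambda>n. 1 - x ^ n"]) (auto simp: **)
  show inv: "invertible (1 - x)"
    using 1 2 l(1) by (auto simp: invertible_def)
  have "inverse_of (1 - x) = l"
    using 1 2 inv by (intro inverse_of_unique) auto
  moreover have "l = 1 + x * l"
    using 1 by (simp add: algebra_simps)
  then have "nrm l \<le> 1 + nrm x * nrm l"
    using nrm_triangle[of 1 "x * l"] nrm_mult[of x l] by simp
  then have "nrm l * (1 - nrm x) \<le> 1"
    by (simp add: algebra_simps)
  ultimately show "nrm (inverse_of (1 - x)) \<le> 1 / (1 - nrm x)"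
    using r by (simp add: pos_le_divide_eq)
qed

text \<open>Shifting by an imaginary scalar gains room: with \<open>s = (nrm h)^2\<close> the
  element \<open>h + \<i> s\<close> has squared norm at most \<open>s + s^2 < (1 + s)^2\<close> by
  the C*-identity, so the Neumann series inverts
  \<open>\<i> (1 + s) - (h + \<i> s) = \<i> - h\<close>.\<close>

lemma invertible_imaginary:
  assumes h: "h \<in> K" "adj h = h"
  shows "invertible (\<i> *\<^sub>c 1 - h)"
proof -
  define s where "s = (nrm h)\<^sup>2"
  have s0: "0 \<le> s"
    by (simp add: s_def)
  define x where "x = h + (\<i> * s) *\<^sub>c 1"
  have "adj x * x = h * h + (s\<^sup>2 :: complex) *\<^sub>c 1"
    by (simp add: x_def adj_simps h algebra_simps power2_eq_square)
  then have "(nrm x)\<^sup>2 \<le> nrm h * nrm h + s\<^sup>2"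
    using nrm_adj_mult[of x] nrm_triangle[of "h * h" "(s\<^sup>2 :: complex) *\<^sub>c 1"] nrm_mult[of h h]
    by (simp add: norm_power)
  also have "\<dots> < (1 + s)\<^sup>2"
  proof -
    have "nrm h * nrm h + s\<^sup>2 < 1 + 2 * s + s\<^sup>2"
      using s0 s_def[unfolded power2_eq_square] by linarith
    then show ?thesis
      by (simp add: power2_eq_square algebra_simps)
  qed
  finally have lt: "nrm x < 1 + s"
    using power_less_imp_less_base[of "nrm x" 2 "1 + s"] s0 by simp
  have s: "complex_of_real (1 + s) \<noteq> 0" "cmod (1 + complex_of_real s) = 1 + s"
    using s0 norm_of_real[of "1 + s"] by (simp_all only: of_real_eq_0_iff, simp_all)
  have "nrm (inverse (\<i> * (1 + s)) *\<^sub>c x) < 1"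
  proof -
    have "nrm x / (1 + s) < 1"
      using lt s0 by simp
    then show ?thesis
      by (simp only: nrm_csc norm_inverse norm_mult norm_ii) (simp add: s(2) divide_inverse mult.commute)
  qed
  then have "invertible (1 - inverse (\<i> * (1 + s)) *\<^sub>c x)"
    using h by (intro invertible_one_minus) (auto simp: x_def)
  then have "invertible ((\<i> * (1 + s)) *\<^sub>c (1 - inverse (\<i> * (1 + s)) *\<^sub>c x))"
    using s(1) by (subst invertible_csc) (auto simp del: of_real_add)
  moreover have "(\<i> * (1 + s)) *\<^sub>c (1 - inverse (\<i> * (1 + s)) *\<^sub>c x) = (\<i> * (1 + s)) *\<^sub>c 1 - x"
    using s(1) by (intro csc_one_minus) (simp del: of_real_add)
  moreover have "\<dots> = \<i> *\<^sub>c 1 - h"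
    by (simp add: x_def algebra_simps)
  ultimately show ?thesis by simp
qed

lemma invertible_nonreal:
  assumes h: "h \<in> K" "adj h = h" and c: "Im c \<noteq> 0"
  shows "invertible (c *\<^sub>c 1 - h)"
proof -
  define u where "u = complex_of_real (inverse (Im c))"
  have c_eq: "\<i> * Im c + Re c = c"
    by (simp add: complex_eq_iff)
  have u: "complex_of_real (Im c) * u = 1"
    using c by (simp add: u_def flip: of_real_mult)
  have "c *\<^sub>c 1 - h = (\<i> * Im c + Re c) *\<^sub>c 1 - 1 *\<^sub>c h"
    by (simp add: c_eq)
  also have "\<dots> = complex_of_real (Im c) *\<^sub>c (\<i> *\<^sub>c 1 - u *\<^sub>c (h - complex_of_real (Re c) *\<^sub>c 1))"
    by (simp only: csc.scale_right_diff_distrib csc_csc csc.scale_left_distrib mult.assoc[symmetric] u)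
       (simp add: mult.commute)
  also have "invertible \<dots>"
    using h c by (subst invertible_csc) (auto intro!: invertible_imaginary simp: adj_simps u_def)
  finally show ?thesis .
qed

section \<open>The spectral radius of a self-adjoint element\<close>

lemma nrm_power_two_power:
  assumes "adj t = t"
  shows "nrm (t ^ (2 ^ m)) = nrm t ^ (2 ^ m)"
proof (induction m)
  case (Suc m)
  have "nrm (t ^ (2 ^ Suc m)) = nrm (adj (t ^ (2 ^ m)) * t ^ (2 ^ m))"
    by (simp add: adj_power assms power_add[symmetric] mult_2)
  also have "\<dots> = nrm t ^ (2 ^ Suc m)"
    by (simp only: nrm_adj_mult Suc power_mult[symmetric]) (simp add: mult.commute)
  finally show ?case .
qed simp

text \<open>The parameter is the reciprocal of the usual spectral one, so an element without nonzero
  spectrum has a resolvent on the whole plane, including \<open>c = 0\<close>.\<close>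

definition resolvent :: "'r \<Rightarrow> complex \<Rightarrow> 'r" where
  "resolvent t c = inverse_of (1 - c *\<^sub>c t)"

lemma resolvent_diff:
  assumes "invertible (1 - c *\<^sub>c t)" "invertible (1 - d *\<^sub>c t)"
  shows "resolvent t c - resolvent t d = (c - d) *\<^sub>c (resolvent t d * t * resolvent t c)"
proof -
  let ?C = "resolvent t c" and ?D = "resolvent t d"
  have "?D * ((1 - d *\<^sub>c t) - (1 - c *\<^sub>c t)) * ?C
      = (?D * (1 - d *\<^sub>c t)) * ?C - ?D * ((1 - c *\<^sub>c t) * ?C)"
    by (simp only: right_diff_distrib left_diff_distrib mult.assoc)
  also have "\<dots> = ?C - ?D"
    using inverse_of(2,3)[OF assms(1)] inverse_of(2,3)[OF assms(2)] by (simp add: resolvent_def)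
  finally have "?C - ?D = ?D * ((1 - d *\<^sub>c t) - (1 - c *\<^sub>c t)) * ?C" by simp
  also have "(1 - d *\<^sub>c t) - (1 - c *\<^sub>c t) = (c - d) *\<^sub>c t"
    by (simp add: algebra_simps)
  finally show ?thesis by (simp add: mult.assoc)
qed

text \<open>Compactness of the disc: points where the norm blows up would cluster at some
  \<open>z\<close>, but the resolvent identity bounds the norm near \<open>z\<close> by twice its
  value at \<open>z\<close>.\<close>

lemma resolvent_bounded_on_disc:
  assumes inv: "\<And>c. invertible (1 - c *\<^sub>c t)"
  shows "\<exists>B. \<forall>c. cmod c \<le> r \<longrightarrow> nrm (resolvent t c) \<le> B"
proof (rule ccontr)
  assume "\<not> ?thesis"
  then have "\<forall>n::nat. \<exists>c. cmod c \<le> r \<and> nrm (resolvent t c) > real n"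
    by (meson not_le)
  then obtain c where c: "\<And>n. cmod (c n) \<le> r" "\<And>n::nat. nrm (resolvent t (c n)) > real n"
    by metis
  have "\<exists>f z. strict_mono (f :: nat \<Rightarrow> nat) \<and> (\<forall>e>0. \<exists>N. \<forall>n\<ge>N. cmod (c (f n) - z) < e)"
    using c(1) by (intro Bolzano_Weierstrass_complex_disc[where r = r]) simp
  then obtain f z where f: "strict_mono (f :: nat \<Rightarrow> nat)"
      and z: "\<forall>e>0. \<exists>N. \<forall>n\<ge>N. cmod (c (f n) - z) < e"
    by blast
  define b where "b = nrm (resolvent t z)"
  \<comment> \<open>At this distance from \<open>z\<close> the resolvent identity reads
    \<open>?R \<le> b + ?R / 2\<close>; the summand 1 keeps the denominator positive.\<close>
  have "1 / (2 * (b * nrm t + 1)) > 0"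
    by (simp add: b_def add_nonneg_pos)
  then obtain N where N: "\<And>n. n \<ge> N \<Longrightarrow> cmod (c (f n) - z) < 1 / (2 * (b * nrm t + 1))"
    using z by blast
  have bound: "nrm (resolvent t (c (f n))) \<le> 2 * b" if "n \<ge> N" for n
  proof -
    let ?R = "nrm (resolvent t (c (f n)))"
    have "?R \<le> b + cmod (c (f n) - z) * nrm (resolvent t z * t * resolvent t (c (f n)))"
      using nrm_triangle[of "resolvent t z" "resolvent t (c (f n)) - resolvent t z"]
      by (simp add: b_def resolvent_diff[OF inv inv, of "c (f n)" z, symmetric])
         (simp add: resolvent_diff[OF inv inv, of "c (f n)" z])
    also have "nrm (resolvent t z * t * resolvent t (c (f n))) \<le> (b * nrm t + 1) * ?R"
      by (intro nrm_mult_le order_trans[OF nrm_mult]) (simp_all add: b_def)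
    also have "cmod (c (f n) - z) * ((b * nrm t + 1) * ?R)
        \<le> 1 / (2 * (b * nrm t + 1)) * ((b * nrm t + 1) * ?R)"
      using N[OF that] by (intro mult_right_mono) (auto simp: b_def)
    also have "\<dots> = ?R / 2"
    proof -
      have "b * nrm t + 1 > 0"
        by (simp add: b_def add_nonneg_pos)
      then show ?thesis by (simp add: field_simps)
    qed
    finally show ?thesis by (simp add: mult_left_mono)
  qed
  obtain n0 :: nat where "real n0 > 2 * b"
    using reals_Archimedean2 by blast
  then have "real (f (max N n0)) > 2 * b"
    using seq_suble[OF f, of "max N n0"] by (smt (verit) max.cobounded2 of_nat_le_iff order_trans)
  then show False
    using bound[of "max N n0"] c(2)[of "f (max N n0)"] by simp
qed

text \<open>
  Rickart's proof that the spectral radius is the norm: the inverse of \<open>1 - (c t)\<^sup>2\<^sup>N\<close> is the average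
  of the inverses of \<open>1 - (c t)\<^sup>N\<close> and \<open>1 - (\<omega> c t)\<^sup>N\<close> with \<open>\<omega>\<^sup>N = -1\<close>, so all these
  functions of \<open>c\<close> share the Lipschitz constant of the resolvent.
\<close>

lemma resolvent_two_power:
  assumes t: "t \<in> K" and inv: "\<And>c. invertible (1 - c *\<^sub>c t)"
    and lip: "\<And>c d. cmod c \<le> r \<Longrightarrow> cmod d \<le> r \<Longrightarrow>
        nrm (resolvent t c - resolvent t d) \<le> L * cmod (c - d)"
  shows "(\<forall>c. invertible (1 - c ^ (2 ^ m) *\<^sub>c t ^ (2 ^ m))) \<and>
    (\<forall>c d. cmod c \<le> r \<longrightarrow> cmod d \<le> r \<longrightarrow>
      nrm (inverse_of (1 - c ^ (2 ^ m) *\<^sub>c t ^ (2 ^ m)) - inverse_of (1 - d ^ (2 ^ m) *\<^sub>c t ^ (2 ^ m)))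
        \<le> L * cmod (c - d))"
proof (induction m)
  case 0
  then show ?case
    using inv lip by (simp add: resolvent_def)
next
  case (Suc m)
  define N :: nat where "N = 2 ^ m"
  have NN: "2 ^ Suc m = 2 * N"
    by (simp add: N_def)
  define w where "w = cis (pi / real N)"
  have w: "w ^ N = -1" "cmod w = 1"
    by (simp_all add: w_def DeMoivre N_def)
  define F where "F c = inverse_of (1 - c ^ N *\<^sub>c t ^ N)" for c
  have inv': "invertible (1 - c ^ N *\<^sub>c t ^ N)" for c
    using Suc by (simp add: N_def)
  have sq: "(1 - c ^ N *\<^sub>c t ^ N) * (1 - (w * c) ^ N *\<^sub>c t ^ N) = 1 - c ^ (2 ^ Suc m) *\<^sub>c t ^ (2 ^ Suc m)" for c
    unfolding NN by (simp add: power_mult_distrib w algebra_simps power_add[symmetric] mult_2[symmetric])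
  have sq': "(1 - (w * c) ^ N *\<^sub>c t ^ N) * (1 - c ^ N *\<^sub>c t ^ N) = 1 - c ^ (2 ^ Suc m) *\<^sub>c t ^ (2 ^ Suc m)" for c
    unfolding NN by (simp add: power_mult_distrib w algebra_simps power_add[symmetric] mult_2[symmetric])
  have inv2: "invertible (1 - c ^ (2 ^ Suc m) *\<^sub>c t ^ (2 ^ Suc m))" for c
    using invertible_mult[OF inv' inv', of c "w * c"] by (simp only: sq)
  have avg: "inverse_of (1 - c ^ (2 ^ Suc m) *\<^sub>c t ^ (2 ^ Suc m)) = (1/2) *\<^sub>c (F c + F (w * c))" for c
  proof -
    let ?A = "1 - c ^ N *\<^sub>c t ^ N" and ?B = "1 - (w * c) ^ N *\<^sub>c t ^ N"
    have A: "?A * F c = 1" "F c * ?A = 1" "?B * F (w * c) = 1" "F (w * c) * ?B = 1"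
      using inverse_of[OF inv', of c] inverse_of[OF inv', of "w * c"] by (auto simp: F_def)
    have AB: "?A + ?B = 2"
      by (simp add: power_mult_distrib w csc.scale_minus_left)
    have comm: "?A * ?B = ?B * ?A"
      by (simp only: sq sq')
    have "(?A * ?B) * (F c + F (w * c)) = ?B * (?A * F c) + ?A * (?B * F (w * c))"
    proof -
      have "(?A * ?B) * F c = ?B * (?A * F c)"
        by (simp only: comm mult.assoc)
      then show ?thesis
        by (simp only: distrib_left mult.assoc)
    qed
    then have 1: "(?A * ?B) * (F c + F (w * c)) = 2"
      using A AB by (simp add: add.commute)
    have "(F c + F (w * c)) * (?A * ?B) = (F c * ?A) * ?B + (F (w * c) * ?B) * ?A"
    proof -
      have "F (w * c) * (?A * ?B) = (F (w * c) * ?B) * ?A"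
        by (simp only: comm mult.assoc)
      then show ?thesis
        by (simp only: distrib_right mult.assoc)
    qed
    then have 2: "(F c + F (w * c)) * (?A * ?B) = 2"
      using A AB by (simp add: add.commute)
    have half: "(1/2) *\<^sub>c (2 :: 'r) = 1"
      using csc_half[of "1 :: 'r"] by (simp add: csc.scale_right_distrib[symmetric])
    show ?thesis
      using 1[unfolded sq] 2[unfolded sq]
      by (intro inverse_of_unique inv2) (simp_all only: csc_mult_left csc_mult_right half)
  qed
  have "nrm (inverse_of (1 - c ^ (2 ^ Suc m) *\<^sub>c t ^ (2 ^ Suc m))
      - inverse_of (1 - d ^ (2 ^ Suc m) *\<^sub>c t ^ (2 ^ Suc m))) \<le> L * cmod (c - d)"
    if "cmod c \<le> r" "cmod d \<le> r" for c d
  proof -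
    have "nrm (F c - F d) \<le> L * cmod (c - d)"
      using Suc that by (simp add: F_def N_def)
    moreover have "nrm (F (w * c) - F (w * d)) \<le> L * cmod (w * c - w * d)"
      using Suc that w(2) by (simp add: F_def N_def norm_mult)
    moreover have "cmod (w * c - w * d) = cmod (c - d)"
      by (simp add: right_diff_distrib[symmetric] norm_mult w(2))
    ultimately have "nrm ((F c - F d) + (F (w * c) - F (w * d))) \<le> 2 * (L * cmod (c - d))"
      using nrm_triangle[of "F c - F d" "F (w * c) - F (w * d)"] by simp
    moreover have "inverse_of (1 - c ^ (2 ^ Suc m) *\<^sub>c t ^ (2 ^ Suc m))
      - inverse_of (1 - d ^ (2 ^ Suc m) *\<^sub>c t ^ (2 ^ Suc m))
      = (1/2) *\<^sub>c ((F c - F d) + (F (w * c) - F (w * d)))"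
      by (simp only: avg) (simp add: algebra_simps)
    ultimately show ?thesis by simp
  qed
  then show ?case using inv2 by blast
qed

text \<open>Normalise to \<open>nrm u = 1\<close>. For \<open>N\<close> a power of two,
  \<open>nrm (u ^ N) = 1\<close>, and the inverses \<open>F c\<close> of
  \<open>1 - c ^ N *\<^sub>c u ^ N\<close> have a Lipschitz constant independent of
  \<open>N\<close>. For large \<open>N\<close> the value at \<open>1 - d\<close> is close to 1,
  hence so is the value at \<open>1 + d\<close>; this forces \<open>(1 + d) ^ N \<le> 1\<close>, a
  contradiction.\<close>

lemma spectral_radius_zero:
  assumes t: "t \<in> K" "adj t = t" and inv: "\<And>c. invertible (1 - c *\<^sub>c t)"
  shows "t = 0"
proof (rule ccontr)
  assume "t \<noteq> 0"
  then have nt: "nrm t > 0"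
    using nrm_eq_0[OF t(1)] nrm_nonneg[of t] by linarith
  define u where "u = complex_of_real (inverse (nrm t)) *\<^sub>c t"
  have u: "u \<in> K" "adj u = u" "nrm u = 1"
    using t nt by (auto simp: u_def norm_inverse)
  have inv_u: "invertible (1 - c *\<^sub>c u)" for c
    using inv[of "c * complex_of_real (inverse (nrm t))"] by (simp add: u_def)
  obtain B where B: "\<And>c. cmod c \<le> 2 \<Longrightarrow> nrm (resolvent u c) \<le> B"
    using resolvent_bounded_on_disc[of u 2] inv_u by blast
  have B0: "B \<ge> 0"
    using order_trans[OF nrm_nonneg B[of 0]] by simp
  have lip: "nrm (resolvent u c - resolvent u d) \<le> (B * B) * cmod (c - d)"
    if "cmod c \<le> 2" "cmod d \<le> 2" for c d
  proof -
    have "nrm (resolvent u d * u * resolvent u c) \<le> (B * 1) * B"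
      using B that u by (intro nrm_mult_le) auto
    then have "cmod (c - d) * nrm (resolvent u d * u * resolvent u c) \<le> cmod (c - d) * (B * B)"
      by (intro mult_left_mono) auto
    then show ?thesis
      using resolvent_diff[OF inv_u inv_u, of c d] by (simp add: mult.commute)
  qed
  \<comment> \<open>The points \<open>1 - d\<close> and \<open>1 + d\<close> have distance
    \<open>2 * d\<close>; the choice makes the Lipschitz bound \<open>B * B * (2 * d)\<close> at
    most 1/4 and keeps both points in the disc of radius 2.\<close>
  define d where "d = min (1/2) (1 / (8 * (B * B + 1)))"
  have d: "d > 0" "d \<le> 1/2"
    using B0 by (auto simp: d_def add_nonneg_pos)
  have "B * B * (2 * d) \<le> (B * B + 1) * (2 * (1 / (8 * (B * B + 1))))"
    using B0 d by (intro mult_mono) (auto simp: d_def)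
  also have "\<dots> = 1/4"
    using B0 by (simp add: field_simps add_nonneg_eq_0_iff)
  finally have Ld: "B * B * (2 * d) \<le> 1/4" .
  have "(\<lambda>m. (1 - d) ^ m) \<longlonglongrightarrow> 0"
    using d by (intro LIMSEQ_power_zero) auto
  then have "eventually (\<lambda>m. (1 - d) ^ m < 1/5) sequentially"
    by (intro order_tendstoD) auto
  then obtain m0 where m0: "(1 - d) ^ m0 < 1/5"
    by (auto simp: eventually_sequentially)
  define N :: nat where "N = 2 ^ m0"
  have "(1 - d) ^ N \<le> (1 - d) ^ m0"
    using d by (intro power_decreasing) (auto simp: N_def less_imp_le)
  then have r: "(1 - d) ^ N < 1/5"
    using m0 by simp
  define F where "F c = inverse_of (1 - c ^ N *\<^sub>c u ^ N)" for c
  have inv': "invertible (1 - c ^ N *\<^sub>c u ^ N)" for c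
    using resolvent_two_power[OF u(1) inv_u lip] by (simp add: N_def)
  have nN: "nrm (u ^ N) = 1"
    using nrm_power_two_power[OF u(2), of m0] u(3) by (simp add: N_def)
  define c d' where "c = complex_of_real (1 - d)" and "d' = complex_of_real (1 + d)"
  have cd: "cmod c = 1 - d" "cmod d' = 1 + d" "cmod (d' - c) = 2 * d"
    using d by (simp_all add: c_def d'_def flip: of_real_diff of_real_add) (simp add: norm_mult)?
  have "nrm (F d' - F c) \<le> B * B * cmod (d' - c)"
    unfolding F_def N_def using cd d
    by (intro resolvent_two_power[OF u(1) inv_u lip, THEN conjunct2, rule_format]) auto
  then have diff: "nrm (F d' - F c) \<le> 1/4"
    using Ld cd by simp
  have nc: "nrm (c ^ N *\<^sub>c u ^ N) = (1 - d) ^ N"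
    by (simp add: norm_power cd nN)
  have "nrm (F c) \<le> 1 / (1 - (1 - d) ^ N)"
    using invertible_one_minus(2)[of "c ^ N *\<^sub>c u ^ N"] u(1) r nc by (simp add: F_def)
  also have "\<dots> \<le> 1 / (4/5)"
    using r by (intro divide_left_mono) auto
  finally have Fc: "nrm (F c) \<le> 5/4" by simp
  have "F c - 1 = (c ^ N *\<^sub>c u ^ N) * F c"
    using inverse_of(2)[OF inv', of c] by (simp add: F_def left_diff_distrib algebra_simps)
  then have "nrm (F c - 1) \<le> 1/5 * (5/4)"
    using nrm_mult_le[of "c ^ N *\<^sub>c u ^ N" "1/5" "F c" "5/4"] r nc Fc by simp
  then have G: "nrm (F d' - 1) \<le> 1/2"
    using nrm_triangle[of "F d' - F c" "F c - 1"] diff by simp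
  let ?v = "d' ^ N *\<^sub>c u ^ N"
  have nv: "nrm ?v = (1 + d) ^ N"
    by (simp add: norm_power cd nN)
  have vG: "?v * F d' = F d' - 1"
    using inverse_of(2)[OF inv', of d'] by (simp add: F_def left_diff_distrib algebra_simps)
  \<comment> \<open>Since \<open>?v * F d'\<close> equals \<open>F d' - 1\<close>, this gives
    \<open>nrm ?v \<le> 1/2 + nrm ?v / 2\<close>.\<close>
  have "?v = ?v * F d' - ?v * (F d' - 1)"
    by (simp add: right_diff_distrib)
  then have "nrm ?v \<le> nrm (F d' - 1) + nrm (?v * (F d' - 1))"
    using nrm_diff[of "?v * F d'" "?v * (F d' - 1)"] by (simp only: vG)
  also have "nrm (?v * (F d' - 1)) \<le> nrm ?v * (1/2)"
    using G by (intro nrm_mult_le) auto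
  finally have "(1 + d) ^ N \<le> 1"
    using G nv by simp
  moreover have "(1 + d) ^ N > 1"
    using d by (intro one_less_power) (auto simp: N_def)
  ultimately show False by simp
qed

section \<open>Partitions of unity\<close>

definition pou :: "'k set \<Rightarrow> ('k \<Rightarrow> 'r) \<Rightarrow> bool" where
  "pou I P \<longleftrightarrow> finite I \<and> (\<forall>k\<in>I. P k \<in> K \<and> adj (P k) = P k) \<and>
     (\<forall>k\<in>I. \<forall>l\<in>I. P k * P l = (if k = l then P k else 0)) \<and> sum P I = 1"

lemma pouD:
  assumes "pou I P"
  shows "finite I" "sum P I = 1" "k \<in> I \<Longrightarrow> P k \<in> K" "k \<in> I \<Longrightarrow> adj (P k) = P k"
    "k \<in> I \<Longrightarrow> P k * P k = P k" "k \<in> I \<Longrightarrow> l \<in> I \<Longrightarrow> k \<noteq> l \<Longrightarrow> P k * P l = 0"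
    "k \<in> I \<Longrightarrow> l \<in> I \<Longrightarrow> P k * P l = (if k = l then P k else 0)"
  using assms unfolding pou_def by auto

lemma pou_mult_sum_left:
  assumes P: "pou I P" and "k \<in> I" "\<And>l. l \<in> I \<Longrightarrow> P l * f l = f l"
  shows "P k * sum f I = f k"
proof -
  have "P k * sum f I = (\<Sum>l\<in>I. P k * f l)"
    by (simp add: sum_distrib_left)
  also have "\<dots> = (\<Sum>l\<in>I. if l = k then f l else 0)"
  proof (rule sum.cong)
    fix l assume "l \<in> I"
    then have "P k * f l = (P k * P l) * f l"
      using assms(3) by (simp add: mult.assoc)
    then show "P k * f l = (if l = k then f l else 0)"
      using pouD(7)[OF P \<open>k \<in> I\<close> \<open>l \<in> I\<close>] assms(3)[OF \<open>l \<in> I\<close>] by auto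
  qed simp
  also have "\<dots> = f k"
    using assms(2) pouD(1)[OF P] by (simp add: sum.delta)
  finally show ?thesis .
qed

lemma block_mult:
  assumes P: "pou I P"
    and f: "\<And>k. k \<in> I \<Longrightarrow> f k * P k = f k" and g: "\<And>k. k \<in> I \<Longrightarrow> P k * g k = g k"
  shows "sum f I * sum g I = (\<Sum>k\<in>I. f k * g k)"
proof -
  have "f k * sum g I = f k * g k" if "k \<in> I" for k
    using pou_mult_sum_left[OF P that g] f[OF that] by (metis mult.assoc)
  then show ?thesis
    by (simp add: sum_distrib_right)
qed

text \<open>Power trick: the triangle inequality loses a factor \<open>card I\<close>, but
  \<open>adj x * x\<close> is block diagonal again, so the C*-identity applied \<open>r\<close>
  times reduces the loss to its root of order \<open>2 ^ r\<close>, which tends to 1.\<close>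

lemma nrm_block_sum:
  assumes P: "pou I P"
    and f: "\<And>k. k \<in> I \<Longrightarrow> P k * f k = f k" "\<And>k. k \<in> I \<Longrightarrow> f k * P k = f k"
    and c: "\<And>k. k \<in> I \<Longrightarrow> nrm (f k) \<le> c"
  shows "nrm (sum f I) \<le> c"
proof (rule ccontr)
  assume "\<not> ?thesis"
  then have lt: "nrm (sum f I) > c" by simp
  have "nrm (sum f I) ^ (2 ^ r) \<le> real (card I) * c ^ (2 ^ r)" for r
    using f c
  proof (induction r arbitrary: f c)
    case 0
    have "nrm (sum f I) \<le> (\<Sum>k\<in>I. c)"
      by (rule order_trans[OF nrm_sum sum_mono[OF 0(3)]])
    then show ?case by simp
  next
    case (Suc r)
    have adj_f: "adj (f k) * P k = adj (f k)" "P k * adj (f k) = adj (f k)" if "k \<in> I" for k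
      using arg_cong[where f = adj, OF Suc.prems(1)[OF that]] arg_cong[where f = adj, OF Suc.prems(2)[OF that]]
        pouD(4)[OF P that]
      by (simp_all add: adj_mult)
    have "nrm (sum f I) ^ (2 ^ Suc r) = (nrm (adj (sum f I) * sum f I)) ^ (2 ^ r)"
      by (simp add: nrm_adj_mult power_mult)
    also have "adj (sum f I) * sum f I = (\<Sum>k\<in>I. adj (f k) * f k)"
      unfolding adj_sum using adj_f Suc.prems by (intro block_mult[OF P]) auto
    also have "nrm \<dots> ^ (2 ^ r) \<le> real (card I) * (c * c) ^ (2 ^ r)"
      using adj_f Suc.prems by (intro Suc.IH nrm_mult_le) (auto simp: mult.assoc, simp flip: mult.assoc)
    also have "(c * c) ^ (2 ^ r) = c ^ (2 ^ Suc r)"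
      by (simp add: power2_eq_square[symmetric] power_mult)
    finally show ?case .
  qed
  note bound = this
  have "I \<noteq> {}"
    using pouD(2)[OF P] by auto
  then have "c \<ge> 0"
    using c nrm_nonneg by (meson all_not_in_conv order_trans)
  show False
  proof (cases "c = 0")
    case True
    then show ?thesis
      using bound[of 0] lt by simp
  next
    case False
    with \<open>c \<ge> 0\<close> have "c > 0" by simp
    then have "nrm (sum f I) / c > 1"
      using lt by simp
    then obtain n where n: "(nrm (sum f I) / c) ^ n > real (card I)"
      using real_arch_pow by blast
    also have "(nrm (sum f I) / c) ^ n \<le> (nrm (sum f I) / c) ^ (2 ^ n)"
      using \<open>nrm (sum f I) / c > 1\<close> by (intro power_increasing) (auto simp: less_imp_le less_exp)
    also have "\<dots> \<le> real (card I)"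
      using bound[of n] \<open>c > 0\<close> by (simp add: power_divide pos_divide_le_eq)
    finally show ?thesis by simp
  qed
qed

text \<open>The normal element with value \<open>f k\<close> on the range of \<open>P k\<close>.
  Functional calculus on such elements is composition with \<open>f\<close>.\<close>

definition comb :: "'k set \<Rightarrow> ('k \<Rightarrow> 'r) \<Rightarrow> ('k \<Rightarrow> complex) \<Rightarrow> 'r" where
  "comb I P f = (\<Sum>k\<in>I. f k *\<^sub>c P k)"

lemma comb_mem [simp, intro]: "pou I P \<Longrightarrow> comb I P f \<in> K"
  by (auto simp: comb_def pouD)

lemma adj_comb: "pou I P \<Longrightarrow> adj (comb I P f) = comb I P (\<lambda>k. cnj (f k))"
  by (simp add: comb_def adj_sum pouD(4))

lemma comb_mult:
  assumes "pou I P"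
  shows "comb I P f * comb I P g = comb I P (\<lambda>k. f k * g k)"
  unfolding comb_def
  by (subst block_mult[OF assms]) (simp_all add: pouD[OF assms] mult.commute)

lemma comb_add: "comb I P f + comb I P g = comb I P (\<lambda>k. f k + g k)"
  by (simp add: comb_def sum.distrib csc_add_left)

lemma comb_diff: "comb I P f - comb I P g = comb I P (\<lambda>k. f k - g k)"
  by (simp add: comb_def sum_subtractf csc.scale_left_diff_distrib)

lemma comb_csc: "c *\<^sub>c comb I P f = comb I P (\<lambda>k. c * f k)"
  by (simp add: comb_def csc.scale_sum_right)

lemma comb_one: "pou I P \<Longrightarrow> comb I P (\<lambda>k. 1) = 1"
  by (simp add: comb_def pouD)

lemma comb_power: "pou I P \<Longrightarrow> comb I P f ^ n = comb I P (\<lambda>k. f k ^ n)"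
  by (induction n) (simp_all add: comb_one comb_mult)

lemma comb_mult_proj: "pou I P \<Longrightarrow> k \<in> I \<Longrightarrow> P k * comb I P f = f k *\<^sub>c P k"
  unfolding comb_def by (rule pou_mult_sum_left) (auto simp: pouD)

lemma comb_cong: "(\<And>k. k \<in> I \<Longrightarrow> f k = g k) \<Longrightarrow> comb I P f = comb I P g"
  unfolding comb_def by (rule sum.cong) auto

lemma comb_commute: "(\<And>k. k \<in> I \<Longrightarrow> x * P k = P k * x) \<Longrightarrow> x * comb I P f = comb I P f * x"
  unfolding comb_def by (rule commute_sum) simp

lemma nrm_proj: "pou I P \<Longrightarrow> k \<in> I \<Longrightarrow> nrm (P k) \<le> 1"
proof -
  assume "pou I P" "k \<in> I"
  then have "nrm (P k) = nrm (P k) * nrm (P k)"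
    using nrm_adj_mult[of "P k"] by (simp add: pouD power2_eq_square)
  then show ?thesis by auto
qed

lemma nrm_comb:
  assumes P: "pou I P" and c: "\<And>k. k \<in> I \<Longrightarrow> cmod (f k) \<le> c"
  shows "nrm (comb I P f) \<le> c"
proof -
  have "nrm (f k *\<^sub>c P k) \<le> c" if "k \<in> I" for k
    using mult_mono[OF c[OF that] nrm_proj[OF P that]] order_trans[OF norm_ge_zero c[OF that]] by simp
  then show ?thesis
    unfolding comb_def by (intro nrm_block_sum[OF P]) (auto simp: pouD[OF P])
qed

text \<open>Merges the projections that carry the same label; this is how spectral values are
  collected into bins.\<close>

lemma pou_image:
  assumes P: "pou I P"
  shows "pou (g ` I) (\<lambda>j. \<Sum>k | k \<in> I \<and> g k = j. P k)"
    and "comb (g ` I) (\<lambda>j. \<Sum>k | k \<in> I \<and> g k = j. P k) f = comb I P (\<lambda>k. f (g k))"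
proof -
  let ?Q = "\<lambda>j. \<Sum>k | k \<in> I \<and> g k = j. P k"
  have Q: "?Q j = comb I P (\<lambda>k. if g k = j then 1 else 0)" for j
    unfolding comb_def using pouD(1)[OF P]
    by (intro sum.mono_neutral_cong_left) auto
  have sum: "comb (g ` I) ?Q f = comb I P (\<lambda>k. f (g k))" for f
    unfolding comb_def using pouD(1)[OF P]
    by (subst sum.image_gen[of I _ g]) (auto simp: csc.scale_sum_right intro!: sum.cong)
  show "comb (g ` I) ?Q f = comb I P (\<lambda>k. f (g k))"
    by (rule sum)
  have "sum ?Q (g ` I) = 1"
    using sum[of "\<lambda>_. 1"] comb_one[OF P] by (simp add: comb_def)
  moreover have "?Q i * ?Q j = (if i = j then ?Q i else 0)" for i j
    unfolding Q comb_mult[OF P]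
    by (cases "i = j") (auto simp: comb_def intro!: sum.cong sum.neutral)
  ultimately show "pou (g ` I) ?Q"
    using pouD[OF P] by (auto simp: pou_def adj_sum intro!: sum.cong)
qed

definition conj_pou where "conj_pou w P = (\<lambda>k. w * P k * adj w)"

lemma pou_conj:
  assumes P: "pou I P" and w: "w \<in> K" "adj w * w = 1" "w * adj w = 1"
  shows "pou I (conj_pou w P)" "comb I (conj_pou w P) f = w * comb I P f * adj w"
proof -
  have *: "(w * x * adj w) * (w * y * adj w) = w * (x * y) * adj w" for x y
    using w(2) by (simp add: mult.assoc) (simp add: mult.assoc[of "adj w" w, symmetric])
  show sum: "comb I (conj_pou w P) f = w * comb I P f * adj w" for f
    by (simp add: comb_def conj_pou_def sum_distrib_left sum_distrib_right)
  have "sum (conj_pou w P) I = 1"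
    using sum[of "\<lambda>_. 1"] comb_one[OF P] w by (simp add: comb_def)
  then show "pou I (conj_pou w P)"
    using pouD[OF P] w unfolding pou_def
    by (auto simp: conj_pou_def *) (auto simp: adj_mult mult.assoc)
qed

section \<open>Polynomial functional calculus\<close>

definition peval :: "'r \<Rightarrow> complex poly \<Rightarrow> 'r" where
  "peval x p = fold_coeffs (\<lambda>a y. a *\<^sub>c 1 + x * y) p 0"

lemma peval_0 [simp]: "peval x 0 = 0"
  by (simp add: peval_def)

lemma peval_pCons [simp]: "peval x (pCons a p) = a *\<^sub>c 1 + x * peval x p"
  by (cases "p = 0 \<and> a = 0") (auto simp: peval_def)

lemma peval_1 [simp]: "peval x 1 = 1"
  by (simp add: one_pCons)

lemma peval_add: "peval x (p + q) = peval x p + peval x q"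
  by (induction p q rule: poly_induct2) (simp_all add: algebra_simps)

lemma peval_smult: "peval x (smult c p) = c *\<^sub>c peval x p"
  by (induction p) (simp_all add: algebra_simps)

lemma peval_diff: "peval x (p - q) = peval x p - peval x q"
  using peval_add[of x "p - q" q] by simp

lemma peval_mult: "peval x (p * q) = peval x p * peval x q"
  by (induction p) (simp_all add: peval_add peval_smult algebra_simps)

lemma peval_sum: "peval x (sum f I) = (\<Sum>i\<in>I. peval x (f i))"
  by (induction I rule: infinite_finite_induct) (simp_all add: peval_add)

lemma peval_mem [simp, intro]: "x \<in> K \<Longrightarrow> peval x p \<in> K"
  by (induction p) simp_all

lemma peval_commute: "x * y = y * x \<Longrightarrow> y * peval x p = peval x p * y"
  by (induction p) (simp_all add: distrib_left distrib_right, metis mult.assoc)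

lemma adj_peval_prod:
  assumes "adj y = y" "\<And>l. l \<in> S \<Longrightarrow> Im l = 0"
  shows "adj (peval y (\<Prod>l\<in>S. [:-l, 1:])) = peval y (\<Prod>l\<in>S. [:-l, 1:])"
  using assms(2)
proof (induction S rule: infinite_finite_induct)
  case (insert l S)
  have "cnj l = l"
    using insert by (simp add: complex_eq_iff)
  then show ?case
    using insert peval_commute[of y y "\<Prod>l\<in>S. [:-l, 1:]"] assms(1)
    by (simp add: peval_mult adj_simps algebra_simps del: mult_pCons_left)
qed (use assms in simp_all)

lemma invertible_peval_prod_mset:
  assumes "\<And>m. m \<in># M \<Longrightarrow> invertible (m *\<^sub>c 1 - y)"
  shows "invertible (peval y (\<Prod>m\<in>#M. [:-m, 1:]))"
  using assms
proof (induction M)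
  case empty
  show ?case by (auto simp: invertible_def intro!: bexI[of _ 1])
next
  case (add m M)
  have "invertible ((-1) *\<^sub>c (m *\<^sub>c 1 - y))"
    using add.prems by (subst invertible_csc) auto
  then have "invertible (peval y [:-m, 1:])"
    by (simp add: csc.scale_minus_left)
  then show ?case
    using add by (simp add: peval_mult invertible_mult del: peval_pCons mult_pCons_left)
qed

text \<open>Let \<open>q S\<close> be the product of the linear factors at the spectral points. The
  polynomial \<open>1 - c * q S\<close> takes the value 1 on \<open>S\<close>, so its roots avoid
  the spectrum and it is invertible at \<open>y\<close> for every \<open>c\<close>; as
  \<open>q S\<close> at \<open>y\<close> is self-adjoint, it vanishes. The projections are then the
  Lagrange polynomials of \<open>S\<close> evaluated at \<open>y\<close>.\<close>

lemma spectral_decomposition: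
  assumes y: "y \<in> K" "adj y = y" and fin: "finite {c. \<not> invertible (c *\<^sub>c 1 - y)}"
  obtains S :: "complex set" and P where "pou S P" "y = comb S P (\<lambda>l. complex_of_real (Re l))"
proof -
  \<comment> \<open>Inserting 0 makes \<open>S\<close> nonempty and provides a point where
    \<open>1 - c * q S\<close> is 1, hence a nonzero polynomial.\<close>
  define S where "S = insert 0 {c. \<not> invertible (c *\<^sub>c 1 - y)}"
  have S: "finite S" "0 \<in> S"
    using fin by (auto simp: S_def)
  have S_real: "Im l = 0" if "l \<in> S" for l
    using that invertible_nonreal[OF y] by (auto simp: S_def)
  have inv: "invertible (c *\<^sub>c 1 - y)" if "c \<notin> S" for c
    using that by (auto simp: S_def)
  define q where "q A = (\<Prod>l\<in>A. [:-l, 1:])" for A :: "complex set"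
  have poly_q: "poly (q A) l = 0 \<longleftrightarrow> l \<in> A" if "finite A" for A l
    using that by (auto simp: q_def poly_prod)
  have "peval y (q S) = 0"
  proof (rule spectral_radius_zero)
    show "peval y (q S) \<in> K" "adj (peval y (q S)) = peval y (q S)"
      using y S_real by (auto simp: q_def intro!: adj_peval_prod)
    fix c
    define r where "r = 1 - smult c (q S)"
    have "poly r 0 = 1"
      using poly_q[of S 0] S by (simp add: r_def)
    then have "r \<noteq> 0" by auto
    then obtain M where M: "r = smult (lead_coeff r) (\<Prod>x\<in>#M. [:-x, 1:])"
      using alg_closed_imp_factorization by blast
    have "m \<notin> S" if "m \<in># M" for m
    proof
      assume "m \<in> S"
      then have "poly r m = 1"
        using poly_q[of S m] S by (simp add: r_def)
      moreover have "poly r m = 0"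
        by (subst M) (use that in \<open>auto simp: poly_prod_mset\<close>)
      ultimately show False by simp
    qed
    then have "invertible (peval y (\<Prod>x\<in>#M. [:-x, 1:]))"
      using inv by (intro invertible_peval_prod_mset) auto
    then have "invertible (peval y (smult (lead_coeff r) (\<Prod>x\<in>#M. [:-x, 1:])))"
      using \<open>r \<noteq> 0\<close> by (simp add: peval_smult invertible_csc)
    then have "invertible (peval y r)"
      using M by simp
    then show "invertible (1 - c *\<^sub>c peval y (q S))"
      by (simp add: r_def peval_diff peval_smult)
  qed
  \<comment> \<open>Normalising factor of the Lagrange polynomial \<open>L l\<close>; it is real
    because \<open>S\<close> is, which makes the projections self-adjoint.\<close>
  define d where "d l = poly (q (S - {l})) l" for l
  have d: "d l \<noteq> 0" if "l \<in> S" for l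
    using poly_q[of "S - {l}" l] S by (auto simp: d_def)
  have d_real: "cnj (d l) = d l" if "l \<in> S" for l
  proof -
    have "cnj (d l) = (\<Prod>m\<in>S - {l}. cnj (l - m))"
      by (simp add: d_def q_def poly_prod)
    also have "\<dots> = (\<Prod>m\<in>S - {l}. l - m)"
      using S_real that by (intro prod.cong) (auto simp: complex_eq_iff)
    finally show ?thesis by (simp add: d_def q_def poly_prod)
  qed
  define L where "L l = smult (inverse (d l)) (q (S - {l}))" for l
  define P where "P l = peval y (L l)" for l
  have poly_L: "poly (L l) m = (if l = m then 1 else 0)" if "l \<in> S" "m \<in> S" for l m
    using that S d[OF that(1)] poly_q[of "S - {l}" m] by (auto simp: L_def d_def)
  have yP: "y * P l = l *\<^sub>c P l" if "l \<in> S" for l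
  proof -
    have "[:-l, 1:] * q (S - {l}) = q S"
      unfolding q_def using S that by (simp add: prod.remove[of S l] del: mult_pCons_left)
    then have "peval y [:-l, 1:] * peval y (q (S - {l})) = 0"
      using \<open>peval y (q S) = 0\<close> by (simp only: peval_mult[symmetric])
    then have "peval y [:-l, 1:] * P l = 0"
      by (simp add: P_def L_def peval_smult del: peval_pCons)
    then show ?thesis
      by (simp add: algebra_simps csc.scale_minus_left)
  qed
  have peval_P: "peval y p * P l = poly p l *\<^sub>c P l" if "l \<in> S" for p l
    by (induction p) (use yP[OF that] in \<open>simp_all add: algebra_simps mult.assoc\<close>)
  \<comment> \<open>Both sides have degree below \<open>card S\<close> and agree at the
    \<open>card S\<close> points of \<open>S\<close>.\<close>
  have sum_L: "(\<Sum>l\<in>S. L l) = 1"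
  proof (rule poly_eqI_degree[of S])
    show "poly (\<Sum>l\<in>S. L l) m = poly 1 m" if "m \<in> S" for m
      using that S by (simp add: poly_sum poly_L sum.delta)
    have "degree (L l) \<le> card S - 1" if "l \<in> S" for l
    proof -
      have "degree (q (S - {l})) \<le> sum (degree \<circ> (\<lambda>m. [:-m, 1:])) (S - {l})"
        unfolding q_def by (rule degree_prod_sum_le) (use S in auto)
      also have "\<dots> = card S - 1"
        using S that by simp
      finally show ?thesis
        by (simp add: L_def)
    qed
    then have "degree (\<Sum>l\<in>S. L l) \<le> card S - 1"
      using S by (intro degree_sum_le) auto
    moreover have "card S > 0"
      using S card_gt_0_iff by blast
    ultimately show "degree (\<Sum>l\<in>S. L l) < card S" "degree (1 :: complex poly) < card S"
      by simp_all
  qed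
  have "pou S P"
    unfolding pou_def
  proof (intro conjI ballI)
    fix l m assume lm: "l \<in> S" "m \<in> S"
    show "P l \<in> K"
      using y by (simp add: P_def)
    show "adj (P l) = P l"
      using y S_real d_real lm adj_peval_prod[of y "S - {l}"] by (simp add: P_def L_def peval_smult q_def)
    show "P l * P m = (if l = m then P l else 0)"
      using peval_P[OF lm(2), of "L l"] poly_L[OF lm] by (auto simp: P_def)
  next
    show "sum P S = 1"
      using sum_L by (simp add: P_def peval_sum[symmetric])
  qed (use S in simp)
  moreover have "y = comb S P (\<lambda>l. complex_of_real (Re l))"
  proof -
    have "y = y * sum P S"
      using pouD(2)[OF \<open>pou S P\<close>] by simp
    also have "\<dots> = (\<Sum>l\<in>S. complex_of_real (Re l) *\<^sub>c P l)"
      using S_real by (simp add: sum_distrib_left yP complex_is_Real_iff)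
    finally show ?thesis by (simp add: comb_def)
  qed
  ultimately show thesis by (rule that)
qed

section \<open>Square roots and real rank zero of commutants\<close>

text \<open>The root of \<open>1 - b\<close> is \<open>1 - s\<close>, where \<open>s\<close> is the fixed point of \<open>s \<mapsto> (b + s\<^sup>2) / 2\<close>.\<close>

lemma sqrt_one_minus:
  assumes b: "b \<in> K" "adj b = b" "nrm b < 1"
  obtains s where "s \<in> K" "adj s = s" "(1 - s) * (1 - s) = 1 - b" "nrm s \<le> nrm b"
    "\<And>x. x \<in> K \<Longrightarrow> x * b = b * x \<Longrightarrow> x * s = s * x"
proof -
  define s where "s = rec_nat 0 (\<lambda>_ s. (1/2) *\<^sub>c (b + s * s))"
  have s0: "s 0 = 0" and s_Suc: "s (Suc k) = (1/2) *\<^sub>c (b + s k * s k)" for k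
    by (simp_all add: s_def)
  have s_mem: "s k \<in> K" for k
    by (induction k) (use b in \<open>auto simp: s0 s_Suc\<close>)
  have s_adj: "adj (s k) = s k" for k
    by (induction k) (use b in \<open>auto simp: s0 s_Suc adj_simps\<close>)
  have s_nrm: "nrm (s k) \<le> nrm b" for k
  proof (induction k)
    case (Suc k)
    have "nrm (s k * s k) \<le> 1 * nrm b"
      using Suc b by (intro nrm_mult_le) auto
    then show ?case
      using nrm_triangle[of b "s k * s k"] by (simp add: s_Suc)
  qed (simp add: s0)
  have step: "nrm (s (Suc k) - s k) \<le> 1 * nrm b ^ k" for k
  proof (induction k)
    case 0
    then show ?case using b by (simp add: s0 s_Suc)
  next
    case (Suc k)
    let ?d = "s (Suc k) - s k"
    \<comment> \<open>Difference of two squares in a form that needs no commutation of the iterates;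
      each factor has norm at most \<open>nrm b\<close>, so the steps contract by
      \<open>nrm b\<close>.\<close>
    have "s (Suc (Suc k)) - s (Suc k) = (1/2) *\<^sub>c (s (Suc k) * ?d + ?d * s k)"
      by (subst (1 2) s_Suc) (simp add: algebra_simps)
    moreover have "nrm (s (Suc k) * ?d) \<le> nrm b * nrm ?d"
      using s_nrm by (auto intro!: nrm_mult_le)
    moreover have "nrm (?d * s k) \<le> nrm b * nrm ?d"
      using nrm_mult_le[OF order_refl s_nrm, of ?d k] by (simp only: mult.commute)
    ultimately have "nrm (s (Suc (Suc k)) - s (Suc k)) \<le> nrm b * nrm ?d"
      using nrm_triangle[of "s (Suc k) * ?d" "?d * s k"] by simp
    also have "\<dots> \<le> nrm b * (1 * nrm b ^ k)"
      by (intro mult_left_mono Suc) simp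
    finally show ?case by simp
  qed
  have "\<exists>l\<in>K. (\<lambda>k. nrm (s k - l)) \<longlonglongrightarrow> 0"
    using b by (intro complete s_mem geometric_Cauchy[OF _ _ step]) auto
  then obtain l where l: "l \<in> K" "(\<lambda>k. nrm (s k - l)) \<longlonglongrightarrow> 0" ..
  have half: "cmod (1/2) = 1/2" by simp
  have sq: "(\<lambda>k. nrm (s (Suc k) - (1/2) *\<^sub>c (b + l * l))) \<longlonglongrightarrow> 0"
  proof (rule tendsto_sandwich[OF _ _ tendsto_const])
    show "(\<lambda>k. (nrm b + nrm l) * nrm (s k - l)) \<longlonglongrightarrow> 0"
      using tendsto_mult[OF tendsto_const l(2), of "nrm b + nrm l"] by simp
    have "nrm (s (Suc k) - (1/2) *\<^sub>c (b + l * l)) \<le> (nrm b + nrm l) * nrm (s k - l)" for k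
    proof -
      have "s (Suc k) - (1/2) *\<^sub>c (b + l * l) = (1/2) *\<^sub>c (s k * (s k - l) + (s k - l) * l)"
        by (simp add: s_Suc algebra_simps)
      moreover have "nrm (s k * (s k - l)) \<le> nrm b * nrm (s k - l)"
        using s_nrm by (auto intro!: nrm_mult_le)
      moreover have "nrm ((s k - l) * l) \<le> nrm l * nrm (s k - l)"
        using nrm_mult[of "s k - l" l] by (simp only: mult.commute)
      moreover have "nrm ((1/2) *\<^sub>c (s k * (s k - l) + (s k - l) * l))
          \<le> nrm (s k * (s k - l)) + nrm ((s k - l) * l)"
        using nrm_triangle[of "s k * (s k - l)" "(s k - l) * l"]
          nrm_nonneg[of "s k * (s k - l)"] nrm_nonneg[of "(s k - l) * l"] 
        unfolding nrm_csc half by linarith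
      ultimately show ?thesis
        by (simp only: distrib_right)
    qed
    then show "eventually (\<lambda>k. nrm (s (Suc k) - (1/2) *\<^sub>c (b + l * l)) \<le> (nrm b + nrm l) * nrm (s k - l)) sequentially"
      by simp
  qed simp
  have "l = (1/2) *\<^sub>c (b + l * l)"
    by (rule lim_unique[OF _ _ LIMSEQ_Suc[OF l(2)] sq]) (use b l in auto)
  then have "l + l = b + l * l"
    using csc_half[of "b + l * l"] by simp
  then have root: "(1 - l) * (1 - l) = 1 - b"
    by (simp add: algebra_simps)
  have "(\<lambda>k. nrm (s k - adj l)) \<longlonglongrightarrow> 0"
    using l(2) by (subst nrm_adj[symmetric]) (simp add: adj_diff s_adj)
  then have l_adj: "adj l = l"
    by (intro lim_unique[OF _ _ _ l(2)]) (use l in auto)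
  have "nrm l \<le> nrm b + nrm (s k - l)" for k
    using nrm_triangle[of "s k" "l - s k"] nrm_diff_commute[of l "s k"] s_nrm[of k] by simp
  moreover have "(\<lambda>k. nrm b + nrm (s k - l)) \<longlonglongrightarrow> nrm b"
    using tendsto_add[OF tendsto_const l(2), of "nrm b"] by simp
  ultimately have l_nrm: "nrm l \<le> nrm b"
    by (intro LIMSEQ_le_const) auto
  have l_comm: "x * l = l * x" if "x \<in> K" "x * b = b * x" for x
  proof -
    have "x * s k = s k * x" for k
    proof (induction k)
      case (Suc k)
      have "x * (s k * s k) = s k * s k * x"
        by (metis Suc mult.assoc)
      then show ?case by (simp add: s_Suc distrib_left distrib_right that(2))
    qed (simp add: s0)
    then show ?thesis
      using lim_mult_left[OF l(2), of x] lim_mult_right[OF l(2), of x] that l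
      by (intro lim_unique[where s = "\<lambda>k. x * s k"]) auto
  qed
  show thesis
    by (rule that[OF l(1) l_adj root l_nrm l_comm])
qed

text \<open>\<open>g = p * q + (1 - p) * (1 - q)\<close> intertwines \<open>q\<close> and
  \<open>p\<close>, and \<open>adj g * g = g * adj g = 1 - b\<close> with
  \<open>b = (p - q) * (p - q)\<close>, which commutes with both projections. So \<open>w\<close> is
  the unitary part of the polar decomposition: \<open>g\<close> times the inverse square root of
  \<open>1 - b\<close>.\<close>

lemma conjugate_projections:
  assumes p: "p \<in> K" "adj p = p" "p * p = p" and q: "q \<in> K" "adj q = q" "q * q = q"
    and d: "nrm (p - q) \<le> d" "d \<le> 1/2"
  obtains w where "w \<in> K" "adj w * w = 1" "w * adj w = 1" "w * q = p * w" "nrm (w - 1) \<le> 6 * d"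
proof -
  define b where "b = (p - q) * (p - q)"
  have d0: "0 \<le> d"
    using d(1) nrm_nonneg order_trans by blast
  have b_nrm: "nrm b \<le> d * d"
    unfolding b_def using d by (intro nrm_mult_le) auto
  have "d * d \<le> (1/2) * d"
    using d d0 by (intro mult_right_mono) auto
  then have b_half: "nrm b \<le> d / 2" "nrm b < 1"
    using b_nrm d by auto
  have b: "b \<in> K" "adj b = b"
    using p q by (auto simp: b_def adj_simps)
  have pb: "p * b = b * p" and qb: "q * b = b * q"
    using p(3) q(3) by (simp_all add: b_def algebra_simps) (simp_all add: mult.assoc[symmetric])
  obtain s where s: "s \<in> K" "adj s = s" "(1 - s) * (1 - s) = 1 - b" "nrm s \<le> nrm b"
    "\<And>x. x \<in> K \<Longrightarrow> x * b = b * x \<Longrightarrow> x * s = s * x"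
    using sqrt_one_minus[OF b b_half(2)] by blast
  have "nrm s < 1"
    using s(4) b_half by simp
  from invertible_one_minus[OF s(1) this]
  have inv: "invertible (1 - s)" and "nrm (inverse_of (1 - s)) \<le> 1 / (1 - nrm s)" .
  moreover have "1 / (1 - nrm s) \<le> 1 / (1/2)"
    using s(4) b_half d by (intro divide_left_mono) auto
  ultimately have r_nrm: "nrm (inverse_of (1 - s)) \<le> 2" by simp
  define r where "r = inverse_of (1 - s)"
  have r: "r \<in> K" "(1 - s) * r = 1" "r * (1 - s) = 1"
    using inverse_of[OF inv] by (simp_all add: r_def)
  have r_comm: "x * r = r * x" if "x * s = s * x" for x
  proof -
    have "r * (x * (1 - s)) * r = r * ((1 - s) * x) * r"
      using that by (simp add: algebra_simps)
    then have "r * x * ((1 - s) * r) = (r * (1 - s)) * x * r"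
      by (simp only: mult.assoc)
    then show ?thesis using r by simp
  qed
  have pr: "p * r = r * p" and qr: "q * r = r * q" and sr: "s * r = r * s"
    using r_comm s(5) p q pb qb by auto
  have sr': "s * (r * x) = r * (s * x)" for x
    by (simp add: sr flip: mult.assoc)
  have r_adj: "adj r = r"
  proof -
    have "adj r * (1 - s) = 1"
      using arg_cong[OF r(2), of adj] s(2) by (simp add: adj_mult adj_diff)
    then have "adj r * ((1 - s) * r) = r"
      by (simp add: mult.assoc[symmetric])
    then show ?thesis using r by simp
  qed
  have rr: "r * r * (1 - b) = 1"
  proof -
    have "r * r * ((1 - s) * (1 - s)) = r * (r * (1 - s)) * (1 - s)"
      by (simp only: mult.assoc)
    then show ?thesis using r s(3) by simp
  qed
  define g where "g = p * q + (1 - p) * (1 - q)"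
  have g_adj: "adj g = q * p + (1 - q) * (1 - p)"
    using p q by (simp add: g_def adj_simps)
  have pp: "p * (p * x) = p * x" and qq: "q * (q * x) = q * x" for x
    by (simp_all add: p q flip: mult.assoc)
  have gg: "adj g * g = 1 - b" "g * adj g = 1 - b"
    unfolding g_adj by (simp_all add: g_def b_def algebra_simps p q pp qq)
  have gq: "g * q = p * g"
    by (simp add: g_def algebra_simps p q pp qq)
  have pr': "p * (r * x) = r * (p * x)" and qr': "q * (r * x) = r * (q * x)" for x
    by (simp_all add: pr qr flip: mult.assoc)
  have commr: "g * r = r * g" "adj g * r = r * adj g"
    unfolding g_adj by (simp_all add: g_def algebra_simps pr qr pr' qr')
  define w where "w = g * r"
  have w_adj: "adj w = r * adj g"
    by (simp add: w_def adj_mult r_adj)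
  show thesis
  proof (rule that)
    show "w \<in> K"
      using p q r by (simp add: w_def g_def)
    have "adj w * w = r * (adj g * g) * r"
      unfolding w_adj by (simp only: w_def mult.assoc)
    also have "\<dots> = r * r * ((1 - s) * (1 - s))"
      unfolding gg s(3)[symmetric] by (simp add: algebra_simps sr sr')
    also have "\<dots> = r * r * (1 - b)"
      by (simp only: s(3))
    finally show "adj w * w = 1" by (simp add: rr)
    have gr: "g * (r * x) = r * (g * x)" for x
      using commr(1) by (simp flip: mult.assoc)
    have "w * adj w = g * r * (r * adj g)"
      unfolding w_adj by (simp only: w_def)
    also have "\<dots> = r * r * (g * adj g)"
      by (simp only: mult.assoc gr)
    finally have "w * adj w = r * r * (g * adj g)" .
    then show "w * adj w = 1" by (simp add: gg rr)
    show "w * q = p * w"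
      by (metis gq mult.assoc qr w_def)
    \<comment> \<open>The constant 6: \<open>g - 1\<close> has norm at most \<open>2 * d\<close>,
      \<open>s\<close> at most \<open>d\<close>, and \<open>r\<close> at most 2.\<close>
    have "g - 1 = p * (q - p) + (p - q) * q"
      by (simp add: g_def algebra_simps p q)
    then have "nrm (g - 1) \<le> nrm p * d + d * nrm q"
      using nrm_triangle[of "p * (q - p)" "(p - q) * q"] d(1) nrm_diff_commute[of p q]
        nrm_mult_le[of p "nrm p" "q - p" d] nrm_mult_le[of "p - q" d q "nrm q"] by simp
    moreover have "nrm p \<le> 1" "nrm q \<le> 1"
      using nrm_adj_mult[of p] nrm_adj_mult[of q] p q by (auto simp: power2_eq_square)
    then have "nrm p * d \<le> 1 * d" "d * nrm q \<le> d * 1"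
      using mult_right_mono[OF _ d0, of "nrm p" 1] mult_left_mono[OF _ d0, of "nrm q" 1] by simp_all
    ultimately have "nrm (g - 1) \<le> 2 * d" by simp
    then have "nrm (g - 1 + s) \<le> 3 * d"
      using nrm_triangle[of "g - 1" s] s(4) b_half d0 by simp
    moreover have "w - 1 = (g - 1 + s) * r"
      using r by (simp add: w_def algebra_simps)
    ultimately show "nrm (w - 1) \<le> 6 * d"
      using nrm_mult_le[of "g - 1 + s" "3 * d" r 2] r_nrm by (simp add: r_def)
  qed
qed

text \<open>Phrased with partitions of unity because their transfer to commutants only needs
  membership of the projections and no comparison of spectra. The index type is
  \<open>complex\<close> because the index sets arise as spectra.\<close>

definition real_rank_zero :: bool where
  "real_rank_zero \<longleftrightarrow> (\<forall>x\<in>K. adj x = x \<longrightarrow> (\<forall>e>0. \<exists>(I :: complex set) P f.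
     pou I P \<and> nrm (x - comb I P (\<lambda>k. complex_of_real (f k))) < e))"

lemma real_rank_zeroE:
  assumes "real_rank_zero" "x \<in> K" "adj x = x" "e > 0"
  obtains I :: "complex set" and P f where "pou I P" "nrm (x - comb I P (\<lambda>k. complex_of_real (f k))) < e"
  using assms unfolding real_rank_zero_def by blast

text \<open>For a partition of unity this is the direct sum of the corners, with the unit of
  \<open>K\<close>.\<close>

definition commutant :: "'r set \<Rightarrow> 'r set" where
  "commutant X = {x \<in> K. \<forall>p\<in>X. p * x = x * p}"

lemma commutantD: "x \<in> commutant X \<Longrightarrow> p \<in> X \<Longrightarrow> p * x = x * p" "x \<in> commutant X \<Longrightarrow> x \<in> K"
  by (auto simp: commutant_def)

lemma cstar_commutant:
  assumes X: "X \<subseteq> K" "\<And>p. p \<in> X \<Longrightarrow> adj p = p"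
  shows "cstar (commutant X) nrm"
proof
  show "adj x \<in> commutant X" if "x \<in> commutant X" for x
  proof -
    have "p * adj x = adj x * p" if "p \<in> X" for p
      using arg_cong[where f = adj, OF commutantD(1)[OF \<open>x \<in> commutant X\<close> that]] X(2)[OF that]
      by (simp add: adj_mult)
    then show ?thesis
      using that by (auto simp: commutant_def)
  qed
  show "x * y \<in> commutant X" if "x \<in> commutant X" "y \<in> commutant X" for x y
    using that unfolding commutant_def by (auto simp: mult.assoc) (metis mult.assoc)
  fix s :: "nat \<Rightarrow> 'r"
  assume s: "\<And>k. s k \<in> commutant X"
    and *: "\<And>e. e > 0 \<Longrightarrow> \<exists>N. \<forall>j\<ge>N. \<forall>k\<ge>N. nrm (s j - s k) < e"
  obtain l where l: "l \<in> K" "(\<lambda>k. nrm (s k - l)) \<longlonglongrightarrow> 0"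
    using complete[OF commutantD(2)[OF s] *] by blast
  have "p * l = l * p" if "p \<in> X" for p
    using lim_mult_left[OF l(2), of p] lim_mult_right[OF l(2), of p] X that l commutantD(1)[OF s that]
    by (intro lim_unique[where s = "\<lambda>k. p * s k"]) auto
  then show "\<exists>l\<in>commutant X. (\<lambda>k. nrm (s k - l)) \<longlonglongrightarrow> 0"
    using l by (auto simp: commutant_def)
qed (auto simp: commutant_def algebra_simps nrm_triangle nrm_mult nrm_adj_mult intro: nrm_eq_0)

text \<open>
  With \<open>a = 2 p - 1 + x\<close> and \<open>y\<close> the given combination, the norm bound comes from
  \<open>v = (1 - q) p\<close> satisfying \<open>(1 + y\<^sub>-) v = (1 - q) (a - y) p - v x\<close>, where
  \<open>(1 + y\<^sub>-)\<^sup>-\<^sup>1\<close> is a contraction.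
\<close>

lemma sign_projection_close:
  assumes P: "pou I P" and p: "p \<in> K" "adj p = p" "p * p = p" and x: "p * x = x * p" "nrm x \<le> 1/4"
    and f: "nrm (2 * p - 1 + x - comb I P (\<lambda>k. complex_of_real (f k))) \<le> e"
    and Q: "\<And>k. \<not> Q k \<Longrightarrow> f k \<le> 0"
  defines "q \<equiv> comb I P (\<lambda>k. if Q k then 1 else 0)"
  shows "nrm ((1 - q) * p) \<le> 4/3 * e"
proof -
  define y where "y = comb I P (\<lambda>k. complex_of_real (f k))"
  define d where "d = 2 * p - 1 + x - y"
  \<comment> \<open>Outside \<open>Q\<close> the value \<open>f k\<close> is nonpositive, so
    \<open>h\<close> is at least 1 everywhere and its inverse \<open>G\<close> is a
    contraction.\<close>
  define h where "h k = (if Q k then 1 else 1 - complex_of_real (f k))" for k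
  define G H where "G = comb I P (\<lambda>k. inverse (h k))" and "H = comb I P h"
  define v where "v = (1 - q) * p"
  have h: "h k \<noteq> 0" "cmod (inverse (h k)) \<le> 1" for k
  proof -
    have "h k = complex_of_real (if Q k then 1 else 1 - f k)"
      by (simp add: h_def)
    then show "h k \<noteq> 0" "cmod (inverse (h k)) \<le> 1"
      using Q[of k] by (auto simp only: of_real_eq_0_iff norm_inverse norm_of_real split: if_splits)
        (auto simp: inverse_le_1_iff)
  qed
  have GH: "G * H = 1"
    unfolding G_def H_def comb_mult[OF P] using h(1) comb_one[OF P] by simp
  have q1: "1 - q = comb I P (\<lambda>k. if Q k then 0 else 1)"
    unfolding comb_one[OF P, symmetric] q_def comb_diff by (rule comb_cong) simp
  have Hq: "H * (1 - q) = (1 - q) - (1 - q) * y"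
    unfolding q1 H_def y_def comb_mult[OF P] comb_diff
    by (rule comb_cong) (simp add: h_def)
  have "H * v = (H * (1 - q)) * p"
    by (simp only: v_def mult.assoc)
  also have "\<dots> = v - (1 - q) * (y * p)"
    by (simp only: Hq left_diff_distrib[of "1 - q"] v_def mult.assoc)
  also have "y * p = p + x * p - d * p"
    by (simp add: d_def algebra_simps p(3) mult_2)
  also have "v - (1 - q) * (p + x * p - d * p) = (1 - q) * d * p - v * x"
    by (simp add: v_def algebra_simps x(1))
  finally have Hv: "H * v = (1 - q) * d * p - v * x" .
  have "v = G * (H * v)"
    by (simp add: mult.assoc[symmetric] GH)
  moreover have "nrm G \<le> 1"
    unfolding G_def using h(2) by (intro nrm_comb[OF P])
  ultimately have "nrm v \<le> nrm (H * v)"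
    using nrm_mult_le[of G 1 "H * v" "nrm (H * v)"] by simp
  also have "\<dots> \<le> nrm ((1 - q) * d * p) + nrm (v * x)"
    unfolding Hv by (rule nrm_diff)
  also have "nrm ((1 - q) * d * p) \<le> 1 * e * 1"
  proof (intro nrm_mult_le)
    show "nrm (1 - q) \<le> 1"
      unfolding q1 by (intro nrm_comb[OF P]) auto
    show "nrm p \<le> 1"
      using nrm_adj_mult[of p] p by (auto simp: power2_eq_square)
  qed (use f in \<open>simp add: d_def y_def\<close>)
  \<comment> \<open>This term is absorbed on the left, which turns \<open>e\<close> into
    \<open>e / (1 - 1/4)\<close>.\<close>
  also have "nrm (v * x) \<le> nrm v * (1/4)"
    using x(2) by (intro nrm_mult_le) auto
  finally show ?thesis by (simp add: v_def)
qed

text \<open>Approximants of \<open>x\<close> need not commute with \<open>p\<close>, so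
  \<open>p\<close> is encoded in the element to be approximated:
  \<open>2 * p - 1 + \<kappa> x\<close> has a spectral gap at 0. The positive spectral projection
  \<open>q\<close> of a finite-spectrum approximant is near \<open>p\<close>; a unitary near 1
  carries \<open>q\<close> to \<open>p\<close> and the approximant into the commutant. Removing
  \<open>2 * p - 1\<close> and dividing by \<open>\<kappa>\<close> recovers
  \<open>x\<close>.\<close>

lemma real_rank_zero_commutant_projection:
  assumes rr: "real_rank_zero" and p: "p \<in> K" "adj p = p" "p * p = p"
  shows "cstar.real_rank_zero (commutant {p}) nrm"
proof -
  interpret C: cstar "commutant {p}" nrm
    using p by (intro cstar_commutant) auto
  have "\<exists>(I :: complex set) P f. C.pou I P \<and> nrm (x - comb I P (\<lambda>k. complex_of_real (f k))) < e"
    if x: "x \<in> commutant {p}" "adj x = x" and e: "e > 0" for x e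
  proof -
    define \<kappa> where "\<kappa> = 1 / (4 * (nrm x + 1))"
    have \<kappa>: "\<kappa> > 0" "nrm (complex_of_real \<kappa> *\<^sub>c x) \<le> 1/4"
    proof -
      have "nrm x + 1 > 0"
        using nrm_nonneg[of x] by linarith
      then show pos: "\<kappa> > 0"
        by (simp add: \<kappa>_def)
      have "\<kappa> * nrm x \<le> 1/4"
        using \<open>nrm x + 1 > 0\<close> by (simp add: \<kappa>_def field_simps)
      then show "nrm (complex_of_real \<kappa> *\<^sub>c x) \<le> 1/4"
        using pos by simp
    qed
    \<comment> \<open>\<open>1/8\<close> gives \<open>3 * d \<le> 1/2\<close>, as conjugating
      projections requires. The final error before division by \<open>\<kappa>\<close> is at most
      \<open>d + 2 * (18 * d) * (7/2) = 127 * d\<close>, rounded up to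
      \<open>200 * d\<close>.\<close>
    define d where "d = min (1/8) (\<kappa> * e / 200)"
    have d: "d > 0" "d \<le> 1/8" "200 * d \<le> \<kappa> * e"
      using \<kappa>(1) e by (auto simp: d_def)
    define a where "a = 2 * p - 1 + complex_of_real \<kappa> *\<^sub>c x"
    have px: "p * x = x * p" "x \<in> K"
      using x by (auto simp: commutant_def)
    have "adj (2 :: 'r) = 2"
      by (metis adj_add adj_one one_add_one)
    then have a: "a \<in> K" "adj a = a"
      using p px x(2) by (auto simp: a_def adj_simps mult_2 mult_2_right)
    obtain I :: "complex set" and P f where P: "pou I P"
        and near: "nrm (a - comb I P (\<lambda>k. complex_of_real (f k))) < d"
      using rr a d(1) by (rule real_rank_zeroE)
    define y where "y = comb I P (\<lambda>k. complex_of_real (f k))"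
    define q where "q = comb I P (\<lambda>k. if f k > 0 then 1 else 0)"
    have q: "q \<in> K" "adj q = q" "q * q = q"
      using P by (auto simp: q_def adj_comb comb_mult intro!: comb_cong)
    have 1: "nrm ((1 - q) * p) \<le> 4/3 * d"
      unfolding q_def using near p px \<kappa>(2)
      by (intro sign_projection_close[OF P, where x = "complex_of_real \<kappa> *\<^sub>c x" and f = f]) (auto simp: a_def)
    \<comment> \<open>The mirror image of the previous estimate: all signs are reversed, so
      \<open>1 - p\<close> and \<open>1 - q\<close> take the places of \<open>p\<close> and
      \<open>q\<close>.\<close>
    have "nrm ((1 - comb I P (\<lambda>k. if \<not> f k > 0 then 1 else 0)) * (1 - p)) \<le> 4/3 * d"
    proof (rule sign_projection_close[OF P, where x = "- (complex_of_real \<kappa> *\<^sub>c x)" and f = "\<lambda>k. - f k"])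
      have "comb I P (\<lambda>k. complex_of_real (- f k)) = - y"
        by (simp add: y_def comb_def sum_negf csc.scale_minus_left)
      then have "2 * (1 - p) - 1 + - (complex_of_real \<kappa> *\<^sub>c x) - comb I P (\<lambda>k. complex_of_real (- f k)) = y - a"
        by (simp add: a_def algebra_simps)
      then show "nrm (2 * (1 - p) - 1 + - (complex_of_real \<kappa> *\<^sub>c x)
          - comb I P (\<lambda>k. complex_of_real (- f k))) \<le> d"
        using near nrm_diff_commute[of a y] by (simp add: y_def)
      show "nrm (- (complex_of_real \<kappa> *\<^sub>c x)) \<le> 1/4"
        using \<kappa>(2) by (simp only: nrm_minus)
    qed (use p px in \<open>auto simp: adj_simps algebra_simps\<close>)
    moreover have "1 - comb I P (\<lambda>k. if \<not> f k > 0 then 1 else 0) = q"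
      unfolding q_def by (subst comb_one[OF P, symmetric], subst comb_diff, rule comb_cong) auto
    ultimately have 2: "nrm (q * (1 - p)) \<le> 4/3 * d" by simp
    have "p - q = (1 - q) * p - q * (1 - p)"
      by (simp add: algebra_simps)
    then have pq: "nrm (p - q) \<le> 3 * d"
      using nrm_diff[of "(1 - q) * p" "q * (1 - p)"] 1 2 d(1) by simp
    obtain w where w: "w \<in> K" "adj w * w = 1" "w * adj w = 1" "w * q = p * w" "nrm (w - 1) \<le> 6 * (3 * d)"
      using conjugate_projections[OF p q pq] d(2) by auto
    have qw: "q * adj w = adj w * p"
      using arg_cong[OF w(4), of adj] p q by (simp add: adj_mult)
    have P': "pou I (conj_pou w P)"
      by (rule pou_conj[OF P w(1-3)])
    have "p * conj_pou w P k = conj_pou w P k * p" if "k \<in> I" for k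
    proof -
      have "q * P k = P k * q"
        unfolding q_def using that by (intro comb_commute[symmetric]) (auto simp: pouD(7)[OF P])
      then have "w * q * P k * adj w = w * P k * (q * adj w)"
        by (simp add: mult.assoc)
      then show ?thesis
        by (simp add: conj_pou_def w(4) qw mult.assoc)
    qed
    then have CP: "C.pou I (conj_pou w P)"
      using P' unfolding pou_def C.pou_def by (auto simp: commutant_def)
    \<comment> \<open>On the conjugated projection with index \<open>k\<close> the element
      \<open>2 * p - 1\<close> has the value 1 or -1 according to the sign of \<open>f k\<close>; it
      is subtracted before undoing the factor \<open>\<kappa>\<close>.\<close>
    define f' where "f' k = (f k - (if f k > 0 then 1 else -1)) / \<kappa>" for k
    have sgn_q: "comb I P (\<lambda>k. if f k > 0 then 1 else -1) = q + q - 1"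
      unfolding q_def comb_one[OF P, symmetric] comb_add comb_diff by (rule comb_cong) auto
    have "comb I P (\<lambda>k. complex_of_real (f' k))
        = complex_of_real (inverse \<kappa>) *\<^sub>c (y - comb I P (\<lambda>k. if f k > 0 then 1 else -1))"
      unfolding y_def comb_diff comb_csc by (rule comb_cong) (simp add: f'_def divide_inverse)
    then have "comb I (conj_pou w P) (\<lambda>k. complex_of_real (f' k))
        = complex_of_real (inverse \<kappa>) *\<^sub>c (w * y * adj w - w * (q + q - 1) * adj w)"
      by (simp only: pou_conj(2)[OF P w(1-3)] sgn_q) (simp add: right_diff_distrib left_diff_distrib)
    also have "w * (q + q - 1) * adj w = 2 * p - 1"
      using w(3) by (simp add: algebra_simps mult_2 flip: mult.assoc)
        (simp add: w(4) mult.assoc w(3))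
    finally have comb': "comb I (conj_pou w P) (\<lambda>k. complex_of_real (f' k))
        = complex_of_real (inverse \<kappa>) *\<^sub>c (w * y * adj w - (2 * p - 1))" .
    have "complex_of_real (inverse \<kappa>) *\<^sub>c (a - (2 * p - 1)) = x"
      using \<kappa>(1) by (simp add: a_def flip: of_real_mult)
    then have "x - comb I (conj_pou w P) (\<lambda>k. complex_of_real (f' k))
        = complex_of_real (inverse \<kappa>) *\<^sub>c (a - (2 * p - 1)) - complex_of_real (inverse \<kappa>) *\<^sub>c (w * y * adj w - (2 * p - 1))"
      by (simp add: comb')
    also have "\<dots> = complex_of_real (inverse \<kappa>) *\<^sub>c ((a - y) + ((1 - w) * y + w * y * (1 - adj w)))"
      by (simp only: csc.scale_right_diff_distrib[symmetric]) (simp add: algebra_simps)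
    finally have diff: "x - comb I (conj_pou w P) (\<lambda>k. complex_of_real (f' k))
        = complex_of_real (inverse \<kappa>) *\<^sub>c ((a - y) + ((1 - w) * y + w * y * (1 - adj w)))" .
    have "nrm p \<le> 1"
      using nrm_adj_mult[of p] p by (auto simp: power2_eq_square)
    then have "nrm a \<le> 13/4"
      using nrm_triangle[of "2 * p - 1" "complex_of_real \<kappa> *\<^sub>c x"] nrm_diff[of "2 * p" 1]
        nrm_triangle[of p p] \<kappa>(2) unfolding a_def mult_2 by simp
    then have y_nrm: "nrm y \<le> 7/2"
      using nrm_triangle[of "y - a" a] near nrm_diff_commute[of y a] d(2) by (simp add: y_def)
    have "nrm (1 - w) \<le> 18 * d" "nrm (1 - adj w) \<le> 18 * d"
      using w(5) nrm_diff_commute[of 1 w] nrm_adj[of "1 - w"] by (auto simp: adj_diff)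
    then have "nrm ((1 - w) * y) \<le> 18 * d * (7/2)" "nrm (w * y * (1 - adj w)) \<le> 1 * (7/2) * (18 * d)"
      using y_nrm nrm_unitary[OF w(2)]
        nrm_mult_le[of "1 - w" "18 * d" y "7/2"] nrm_mult_le[OF nrm_mult_le, of w 1 y "7/2" "1 - adj w" "18 * d"]
      by simp_all
    then have "nrm ((a - y) + ((1 - w) * y + w * y * (1 - adj w))) < 200 * d"
      using nrm_triangle[of "a - y" "(1 - w) * y + w * y * (1 - adj w)"]
        nrm_triangle[of "(1 - w) * y" "w * y * (1 - adj w)"] near d(1) by (simp add: y_def)
    then have "nrm ((a - y) + ((1 - w) * y + w * y * (1 - adj w))) < \<kappa> * e"
      using d(3) by simp
    then have "nrm (x - comb I (conj_pou w P) (\<lambda>k. complex_of_real (f' k))) < e"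
      unfolding diff nrm_csc norm_of_real using \<kappa>(1) by (simp add: pos_divide_less_eq mult.commute flip: divide_inverse_commute del: add_diff_eq)
    then show ?thesis
      using CP by blast
  qed
  then show ?thesis
    unfolding C.real_rank_zero_def by (simp add: comb_def C.comb_def)
qed

lemma commutant_empty [simp]: "commutant {} = K"
  by (auto simp: commutant_def)

text \<open>One projection at a time: by commutation each further projection lies in the commutant
  already formed, and the commutant taken inside it is the commutant of the larger set.\<close>

lemma real_rank_zero_commutant:
  assumes rr: "real_rank_zero" and X: "finite X" "X \<subseteq> K" "\<And>p. p \<in> X \<Longrightarrow> adj p = p \<and> p * p = p"
    and comm: "\<And>p q. p \<in> X \<Longrightarrow> q \<in> X \<Longrightarrow> p * q = q * p"
  shows "cstar.real_rank_zero (commutant X) nrm"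
  using X comm
proof (induction X rule: finite_induct)
  case empty
  then show ?case using rr by simp
next
  case (insert p X)
  interpret C: cstar "commutant X" nrm
    using insert by (intro cstar_commutant) auto
  have "C.commutant {p} = commutant (insert p X)"
    unfolding C.commutant_def unfolding commutant_def by auto
  moreover have "cstar.real_rank_zero (C.commutant {p}) nrm"
    using insert by (intro C.real_rank_zero_commutant_projection) (auto simp: commutant_def)
  ultimately show ?case by simp
qed

end

section \<open>Tracial states and the 2-norm\<close>

locale tracial_cstar = cstar K nrm for K :: "'r::star_algebra set" and nrm +
  fixes \<tau> :: "'r \<Rightarrow> complex"
  assumes \<tau>_add: "\<tau> (x + y) = \<tau> x + \<tau> y"
    and \<tau>_csc [simp]: "\<tau> (c *\<^sub>c x) = c * \<tau> x"
    and \<tau>_pos: "\<tau> (adj x * x) \<in> \<real>\<^sub>\<ge>\<^sub>0"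
    and \<tau>_one: "\<tau> 1 = 1"
    and \<tau>_commute: "\<tau> (x * y) = \<tau> (y * x)"
begin

text \<open>Involves only \<open>\<tau>\<close>, neither \<open>K\<close> nor \<open>nrm\<close>, so
  it is the same function for every commutant.\<close>

definition n2 :: "'r \<Rightarrow> real" where
  "n2 x = sqrt (Re (\<tau> (adj x * x)))"

lemma \<tau>_nonneg: "Re (\<tau> (adj x * x)) \<ge> 0" "Im (\<tau> (adj x * x)) = 0"
  using \<tau>_pos[of x] by (auto simp: complex_nonneg_Reals_iff)

lemma \<tau>_zero [simp]: "\<tau> 0 = 0"
  using \<tau>_csc[of 0 0] by simp

lemma \<tau>_sum: "\<tau> (sum f I) = (\<Sum>i\<in>I. \<tau> (f i))"
  by (induction I rule: infinite_finite_induct) (simp_all add: \<tau>_add)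

lemma \<tau>_minus: "\<tau> (- x) = - \<tau> x"
  using \<tau>_csc[of "-1" x] by (simp add: csc.scale_minus_left)

lemma \<tau>_diff: "\<tau> (x - y) = \<tau> x - \<tau> y"
  using \<tau>_add[of x "- y"] by (simp add: \<tau>_minus)

text \<open>Polarisation: \<open>\<tau>\<close> is real on \<open>adj (x + c) * (x + c)\<close>, and
  \<open>c = 1\<close> and \<open>c = \<i>\<close> give the imaginary and the real part.\<close>

lemma \<tau>_adj: "\<tau> (adj x) = cnj (\<tau> x)"
proof -
  have *: "Im (cnj c * \<tau> x + c * \<tau> (adj x)) = 0" for c
  proof -
    have "adj (x + c *\<^sub>c 1) * (x + c *\<^sub>c 1) = adj x * x + c *\<^sub>c adj x + cnj c *\<^sub>c x + (cnj c * c) *\<^sub>c 1"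
      by (simp add: adj_simps algebra_simps)
    then have "Im (\<tau> (adj x * x) + c * \<tau> (adj x) + cnj c * \<tau> x + cnj c * c) = 0"
      using \<tau>_nonneg(2)[of "x + c *\<^sub>c 1"] by (simp add: \<tau>_add \<tau>_one)
    then show ?thesis
      using \<tau>_nonneg(2)[of x] by simp
  qed
  from *[of 1] *[of \<i>] show ?thesis
    by (simp add: complex_eq_iff)
qed

lemma n2_square: "(n2 x)\<^sup>2 = Re (\<tau> (adj x * x))"
  using \<tau>_nonneg(1)[of x] by (simp add: n2_def)

lemma n2_nonneg [simp]: "0 \<le> n2 x"
  using \<tau>_nonneg(1)[of x] by (simp add: n2_def)

lemma n2_square_add: "(n2 (x + y))\<^sup>2 = (n2 x)\<^sup>2 + 2 * Re (\<tau> (adj x * y)) + (n2 y)\<^sup>2"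
proof -
  have "Re (\<tau> (adj y * x)) = Re (\<tau> (adj x * y))"
    using \<tau>_adj[of "adj x * y"] by (simp add: adj_mult)
  then show ?thesis
    by (simp add: n2_square adj_add distrib_left distrib_right \<tau>_add)
qed

lemma n2_csc [simp]: "n2 (c *\<^sub>c x) = cmod c * n2 x"
proof -
  have cc: "cnj c * c = complex_of_real ((cmod c)\<^sup>2)"
    by (metis complex_norm_square mult.commute)
  have "n2 (c *\<^sub>c x) = sqrt (Re (cnj c * c * \<tau> (adj x * x)))"
    by (simp add: n2_def mult.assoc mult.left_commute)
  also have "\<dots> = sqrt ((cmod c)\<^sup>2 * Re (\<tau> (adj x * x)))"
    unfolding cc by (simp del: of_real_power)
  finally show ?thesis
    by (simp add: real_sqrt_mult n2_def)
qed

lemma n2_minus [simp]: "n2 (- x) = n2 x"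
  using n2_csc[of "-1" x] by (simp add: csc.scale_minus_left)

lemma Cauchy_Schwarz: "Re (\<tau> (adj x * y)) \<le> n2 x * n2 y"
proof -
  define r where "r = Re (\<tau> (adj x * y))"
  have q: "0 \<le> (n2 x)\<^sup>2 + 2 * (t * r) + t\<^sup>2 * (n2 y)\<^sup>2" for t
    using n2_square_add[of x "complex_of_real t *\<^sub>c y"] zero_le_power2[of "n2 (x + complex_of_real t *\<^sub>c y)"]
    by (simp add: r_def power_mult_distrib)
  show ?thesis
  proof (cases "n2 y = 0")
    case True
    have "r \<le> 0"
    proof (rule ccontr)
      assume "\<not> r \<le> 0"
      then show False
        using q[of "- ((n2 x)\<^sup>2 + 1) / r"] zero_le_power2[of "n2 x"] True by simp
    qed
    then show ?thesis using True by (simp add: r_def)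
  next
    case False
    then have y: "(n2 y)\<^sup>2 > 0" by simp
    have "0 \<le> ((n2 x)\<^sup>2 + 2 * (- r / (n2 y)\<^sup>2 * r) + (- r / (n2 y)\<^sup>2)\<^sup>2 * (n2 y)\<^sup>2) * (n2 y)\<^sup>2"
      using q[of "- r / (n2 y)\<^sup>2"] y by simp
    also have "\<dots> = (n2 x * n2 y)\<^sup>2 - r\<^sup>2"
      using False by (simp add: power2_eq_square field_simps)
    finally have "r\<^sup>2 \<le> (n2 x * n2 y)\<^sup>2" by simp
    then have "r \<le> n2 x * n2 y"
      by (intro power2_le_imp_le[of r]) auto
    then show ?thesis by (simp add: r_def)
  qed
qed

lemma n2_triangle: "n2 (x + y) \<le> n2 x + n2 y"
proof (rule power2_le_imp_le)
  show "(n2 (x + y))\<^sup>2 \<le> (n2 x + n2 y)\<^sup>2"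
    using Cauchy_Schwarz[of x y] by (simp add: n2_square_add power2_sum)
qed simp

lemma n2_diff: "n2 (x - y) \<le> n2 x + n2 y"
  using n2_triangle[of x "- y"] by simp

lemma n2_zero [simp]: "n2 0 = 0"
  using n2_csc[of 0 0] by simp

lemma n2_adj [simp]: "n2 (adj x) = n2 x"
  using \<tau>_commute[of "adj x" x] by (simp add: n2_def)

text \<open>For \<open>M > nrm x\<close> the element \<open>1 - adj x * x / M^2\<close> has a
  self-adjoint square root \<open>1 - s\<close>, so \<open>(n2 y)^2 - (n2 (x * y))^2 / M^2\<close>
  is the square of \<open>n2 ((1 - s) * y)\<close>. The root needs the strict inequality; afterwards
  \<open>M\<close> decreases to \<open>nrm x\<close>.\<close>

lemma n2_mult_left:
  assumes "x \<in> K"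
  shows "n2 (x * y) \<le> nrm x * n2 y"
proof -
  have *: "n2 (x * y) \<le> M * n2 y" if M: "M > nrm x" for M
  proof -
    have M0: "M > 0"
      using M nrm_nonneg le_less_trans by blast
    define b where "b = complex_of_real (inverse (M\<^sup>2)) *\<^sub>c (adj x * x)"
    have "(nrm x)\<^sup>2 < M\<^sup>2"
      using M by (intro power_strict_mono) auto
    then have "nrm b < 1"
      using M0 by (simp add: b_def nrm_adj_mult norm_of_real pos_divide_less_eq
          flip: divide_inverse_commute del: of_real_inverse of_real_power)
    then obtain s where s: "adj s = s" "(1 - s) * (1 - s) = 1 - b"
      using sqrt_one_minus[of b] assms by (auto simp: b_def adj_simps)
    have "adj ((1 - s) * y) * ((1 - s) * y) = adj y * (((1 - s) * (1 - s)) * y)"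
      by (simp add: adj_simps s(1) mult.assoc)
    also have "\<dots> = adj y * y - complex_of_real (inverse (M\<^sup>2)) *\<^sub>c (adj (x * y) * (x * y))"
      unfolding s(2) by (simp add: b_def adj_mult left_diff_distrib right_diff_distrib mult.assoc)
    finally have "(n2 ((1 - s) * y))\<^sup>2 = (n2 y)\<^sup>2 - inverse (M\<^sup>2) * (n2 (x * y))\<^sup>2"
      by (simp add: n2_square \<tau>_diff del: of_real_inverse of_real_power)
    then have "inverse (M\<^sup>2) * (n2 (x * y))\<^sup>2 \<le> (n2 y)\<^sup>2"
      using zero_le_power2[of "n2 ((1 - s) * y)"] by linarith
    then have "(n2 (x * y))\<^sup>2 \<le> (M * n2 y)\<^sup>2"
      using M0 by (simp add: field_simps power_mult_distrib)
    then show ?thesis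
      using M0 by (intro power2_le_imp_le[of "n2 (x * y)"]) auto
  qed
  show ?thesis
  proof (cases "n2 y = 0")
    case True
    then show ?thesis using *[of "nrm x + 1"] by simp
  next
    case False
    then have y: "n2 y > 0"
      using n2_nonneg[of y] by linarith
    have "n2 (x * y) / n2 y \<le> nrm x"
    proof (rule dense_ge)
      fix M assume "nrm x < M"
      then show "n2 (x * y) / n2 y \<le> M"
        using *[of M] y by (simp only: pos_divide_le_eq)
    qed
    then show ?thesis
      using y by (simp add: pos_divide_le_eq)
  qed
qed

lemma n2_le_nrm: "x \<in> K \<Longrightarrow> n2 x \<le> nrm x"
  using n2_mult_left[of x 1] by (simp add: n2_def \<tau>_one)

lemma n2_sum_orthogonal:
  assumes "finite S" "\<And>i j. i \<in> S \<Longrightarrow> j \<in> S \<Longrightarrow> i \<noteq> j \<Longrightarrow> \<tau> (adj (u i) * u j) = 0"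
  shows "(n2 (sum u S))\<^sup>2 = (\<Sum>i\<in>S. (n2 (u i))\<^sup>2)"
proof -
  have "\<tau> (adj (sum u S) * sum u S) = (\<Sum>i\<in>S. \<Sum>j\<in>S. \<tau> (adj (u i) * u j))"
    by (simp add: adj_sum sum_product \<tau>_sum)
  also have "\<dots> = (\<Sum>i\<in>S. \<Sum>j\<in>S. if j = i then \<tau> (adj (u i) * u i) else 0)"
    using assms(2) by (intro sum.cong HOL.refl) auto
  also have "\<dots> = (\<Sum>i\<in>S. \<tau> (adj (u i) * u i))"
    using assms(1) by (simp add: sum.delta)
  finally show ?thesis by (simp add: n2_square Re_sum)
qed

text \<open>Distinct corners are orthogonal for the trace: cyclic invariance brings
  \<open>P l'\<close> next to \<open>P l\<close>, while \<open>P k\<close> already meets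
  \<open>P k'\<close>.\<close>

lemma n2_sum_corners:
  assumes P: "pou I P" and S: "S \<subseteq> I \<times> I"
  shows "(n2 (\<Sum>(k, l)\<in>S. P k * x * P l))\<^sup>2 = (\<Sum>(k, l)\<in>S. (n2 (P k * x * P l))\<^sup>2)"
proof -
  have "\<tau> (adj (P k * x * P l) * (P k' * x * P l')) = 0"
    if "k \<in> I" "l \<in> I" "k' \<in> I" "l' \<in> I" "k \<noteq> k' \<or> l \<noteq> l'" for k l k' l'
  proof -
    have "adj (P k * x * P l) * (P k' * x * P l') = (P l * adj x * (P k * P k') * x) * P l'"
      using that by (simp add: adj_mult pouD(4)[OF P] mult.assoc)
    also have "\<tau> \<dots> = \<tau> ((P l' * P l) * adj x * (P k * P k') * x)"
      by (subst \<tau>_commute) (simp only: mult.assoc)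
    also have "\<dots> = 0"
      using that by (auto simp: pouD(7)[OF P])
    finally show ?thesis .
  qed
  note key = this
  have "(n2 (\<Sum>i\<in>S. P (fst i) * x * P (snd i)))\<^sup>2 = (\<Sum>i\<in>S. (n2 (P (fst i) * x * P (snd i)))\<^sup>2)"
  proof (rule n2_sum_orthogonal)
    show "finite S"
      using S pouD(1)[OF P] by (auto intro: finite_subset)
    fix i j assume "i \<in> S" "j \<in> S" "i \<noteq> j"
    then show "\<tau> (adj (P (fst i) * x * P (snd i)) * (P (fst j) * x * P (snd j))) = 0"
      using subsetD[OF S, of i] subsetD[OF S, of j]
      by (intro key) (auto simp: mem_Times_iff prod_eq_iff)
  qed
  then show ?thesis
    by (simp add: case_prod_beta)
qed

lemma sum_corners:
  assumes P: "pou I P"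
  shows "(\<Sum>(k, l)\<in>I \<times> I. P k * x * P l) = x"
proof -
  have "(\<Sum>(k, l)\<in>I \<times> I. P k * x * P l) = sum P I * x * sum P I"
    by (simp add: sum.cartesian_product[symmetric] sum_distrib_left sum_distrib_right) (rule sum.swap)
  then show ?thesis
    using pouD(2)[OF P] by simp
qed

end

text \<open>Going from \<open>x\<close> to \<open>x + 1\<close> crosses a bin boundary for at most
  one residue of the offset modulo \<open>D\<close>; unit steps from one integer to the other add
  up.\<close>

lemma card_bin_boundaries:
  fixes m l :: int and D :: nat
  assumes D: "D > 0"
  shows "card {t \<in> {..<D}. (m + int t) div int D \<noteq> (l + int t) div int D} \<le> nat \<bar>m - l\<bar>"
proof -
  have step: "card {t \<in> {..<D}. (x + int t) div int D \<noteq> (x + 1 + int t) div int D} \<le> 1" for x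
  proof -
    have "(x + 1 + int t) mod int D = 0" if "(x + int t) div int D \<noteq> (x + 1 + int t) div int D" for t
    proof (rule ccontr)
      assume nz: "(x + 1 + int t) mod int D \<noteq> 0"
      define y where "y = x + 1 + int t"
      have "0 \<le> y mod int D" "y mod int D < int D" "y mod int D \<noteq> 0"
        using D nz by (simp_all add: y_def)
      then have "(y - 1) div int D = y div int D"
        by (intro int_div_pos_eq[of _ _ _ "y mod int D - 1"]) (simp_all add: algebra_simps)
      then show False
        using that by (simp add: y_def algebra_simps)
    qed
    then have "{t \<in> {..<D}. (x + int t) div int D \<noteq> (x + 1 + int t) div int D}
        \<subseteq> {t \<in> {..<D}. (x + 1 + int t) mod int D = 0}"
      by auto
    moreover have "card {t \<in> {..<D}. (x + 1 + int t) mod int D = 0} \<le> Suc 0"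
    proof (subst card_le_Suc0_iff_eq, simp, intro ballI)
      fix t t' assume t: "t \<in> {t \<in> {..<D}. (x + 1 + int t) mod int D = 0}" "t' \<in> {t \<in> {..<D}. (x + 1 + int t) mod int D = 0}"
      then have "int D dvd (x + 1 + int t) - (x + 1 + int t')"
        by (intro dvd_diff) auto
      then have "int t mod int D = int t' mod int D"
        by (simp add: mod_eq_dvd_iff)
      then show "t = t'" using t by simp
    qed
    moreover have "finite {t \<in> {..<D}. (x + 1 + int t) mod int D = 0}"
      by simp
    ultimately show ?thesis
      using card_mono order_trans unfolding One_nat_def by blast
  qed
  have up: "card {t \<in> {..<D}. (x + int n + int t) div int D \<noteq> (x + int t) div int D} \<le> n" for x n
  proof (induction n)
    case (Suc n)
    let ?A = "\<lambda>y z. {t \<in> {..<D}. (y + int t) div int D \<noteq> (z + int t) div int D}"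
    have "?A (x + int (Suc n)) x \<subseteq> ?A (x + int n) x \<union> ?A (x + int n) (x + int n + 1)"
      by (auto simp: algebra_simps)
    then have "card (?A (x + int (Suc n)) x) \<le> card (?A (x + int n) x \<union> ?A (x + int n) (x + int n + 1))"
      by (intro card_mono) auto
    also have "\<dots> \<le> card (?A (x + int n) x) + card (?A (x + int n) (x + int n + 1))"
      by (rule card_Un_le)
    finally show ?case
      using Suc step[of "x + int n"] by linarith
  qed simp
  show ?thesis
  proof (cases "l \<le> m")
    case True
    then show ?thesis using up[of l "nat (m - l)"] by simp
  next
    case False
    then have "card {t \<in> {..<D}. (l + int t) div int D \<noteq> (m + int t) div int D} \<le> nat (l - m)"
      using up[of m "nat (l - m)"] by simp
    then show ?thesis
      using False by (simp add: eq_commute) (simp add: abs_if eq_commute)?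
  qed
qed

section \<open>Pinching by spectral projections\<close>

context cstar
begin

text \<open>The conditional expectation onto the commutant of the projections
  \<open>E k\<close>.\<close>

definition pinch :: "'k set \<Rightarrow> ('k \<Rightarrow> 'r) \<Rightarrow> 'r \<Rightarrow> 'r" where
  "pinch I E x = (\<Sum>k\<in>I. E k * x * E k)"

lemma nrm_pinch:
  assumes E: "pou I E"
  shows "nrm (pinch I E x) \<le> nrm x"
  unfolding pinch_def
proof (rule nrm_block_sum[OF E])
  fix k assume k: "k \<in> I"
  show "E k * (E k * x * E k) = E k * x * E k" "E k * x * E k * E k = E k * x * E k"
    by (simp_all add: pouD(5)[OF E k] mult.assoc) (simp_all add: pouD(5)[OF E k] flip: mult.assoc)
  show "nrm (E k * x * E k) \<le> nrm x"
    using nrm_mult_le[OF nrm_mult_le[OF nrm_proj[OF E k] order_refl] nrm_proj[OF E k], of x] by simp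
qed

lemma pinch_in_commutant:
  assumes E: "pou I E" and x: "x \<in> K"
  shows "pinch I E x \<in> commutant (E ` I)"
proof -
  have "E k * pinch I E x = pinch I E x * E k" if k: "k \<in> I" for k
  proof -
    have "E k * pinch I E x = E k * x * E k"
      unfolding pinch_def
      by (rule pou_mult_sum_left[OF E k]) (simp add: pouD(5)[OF E] flip: mult.assoc)
    moreover have "pinch I E x * E k = (\<Sum>l\<in>I. if l = k then E k * x * E k else 0)"
      unfolding pinch_def sum_distrib_right
      by (rule sum.cong) (auto simp: mult.assoc pouD(7)[OF E _ k])
    ultimately show ?thesis
      using k pouD(1)[OF E] by (simp add: sum.delta)
  qed
  then show ?thesis
    using x pouD(3)[OF E] by (auto simp: commutant_def pinch_def)
qed

lemma adj_pinch: "pou I E \<Longrightarrow> adj (pinch I E x) = pinch I E (adj x)"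
  unfolding pinch_def adj_sum by (rule sum.cong) (auto simp: adj_mult mult.assoc pouD(4))

lemma real_rank_zero_commutant_pou:
  assumes "real_rank_zero" and E: "pou I E"
  shows "cstar.real_rank_zero (commutant (E ` I)) nrm"
  using pouD[OF E] by (intro real_rank_zero_commutant assms) auto

lemma comb_in_commutant:
  assumes E: "pou I E"
  shows "comb I E f \<in> commutant (E ` I)"
proof -
  have "E k * comb I E f = comb I E f * E k" if "k \<in> I" for k
    by (rule comb_commute) (auto simp: pouD(7)[OF E] that)
  then show ?thesis
    using E by (auto simp: commutant_def)
qed

end

context tracial_cstar
begin

lemma tracial_commutant:
  assumes "X \<subseteq> K" "\<And>p. p \<in> X \<Longrightarrow> adj p = p"
  shows "tracial_cstar (commutant X) nrm \<tau>"
proof -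
  interpret C: cstar "commutant X" nrm
    using assms by (rule cstar_commutant)
  show ?thesis
    by unfold_locales (fact \<tau>_add \<tau>_csc \<tau>_pos \<tau>_one \<tau>_commute)+
qed

text \<open>
  The spectral values are rounded to integers (times \<open>\<theta>\<close>) and collected into bins of length
  \<open>D\<close>. Over the \<open>D\<close> possible offsets of the bins, two values \<open>m, l\<close> are separated at most
  \<open>\<bar>m - l\<bar> \<le> \<bar>m - l\<bar>\<^sup>2\<close> times, and the sum of the squares is the 2-norm of a commutator.
\<close>

lemma pinching:
  fixes C :: real
  assumes rr: real_rank_zero and a: "a \<in> K" "adj a = a"
    and Y: "finite J" "\<And>j. j \<in> J \<Longrightarrow> Y j \<in> K" "\<And>j. j \<in> J \<Longrightarrow> nrm (Y j) \<le> C"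
    and \<theta>: "\<theta> > 0" and D: "D > (0::nat)"
    and comm: "\<And>j. j \<in> J \<Longrightarrow> n2 (a * Y j - Y j * a) \<le> \<theta>"
  obtains I :: "int set" and E g where "pou I E"
    "nrm (a - comb I E (\<lambda>k. complex_of_real (g k))) \<le> (real D + 2) * \<theta>"
    "\<And>j. j \<in> J \<Longrightarrow> (n2 (Y j - pinch I E (Y j)))\<^sup>2 \<le> real (card J) * (4 * C + 1)\<^sup>2 / real D"
proof -
  obtain S :: "complex set" and P f where P: "pou S P"
      and near: "nrm (a - comb S P (\<lambda>k. complex_of_real (f k))) < \<theta>"
    using rr a \<theta> by (rule real_rank_zeroE)
  note finS = pouD(1)[OF P]
  define m where "m k = \<lfloor>f k / \<theta>\<rfloor>" for k
  define a' where "a' = comb S P (\<lambda>k. complex_of_real (\<theta> * m k))"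
  have "nrm (comb S P (\<lambda>k. complex_of_real (f k)) - a') \<le> \<theta>"
    unfolding a'_def comb_diff
  proof (rule nrm_comb[OF P])
    fix k
    have "\<bar>f k / \<theta> - m k\<bar> \<le> 1"
      unfolding m_def by linarith
    then have "\<bar>f k / \<theta> - m k\<bar> * \<theta> \<le> \<theta>"
      using \<theta> by simp
    also have "\<bar>f k / \<theta> - m k\<bar> * \<theta> = \<bar>(f k / \<theta> - m k) * \<theta>\<bar>"
      using \<theta> by (simp add: abs_mult)
    also have "(f k / \<theta> - m k) * \<theta> = f k - \<theta> * m k"
      using \<theta> by (simp add: field_simps)
    finally show "cmod (complex_of_real (f k) - complex_of_real (\<theta> * m k)) \<le> \<theta>"
      by (simp only: of_real_diff[symmetric] norm_of_real)
  qed
  then have aa': "nrm (a - a') \<le> 2 * \<theta>"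
    using near nrm_triangle[of "a - comb S P (\<lambda>k. complex_of_real (f k))" "comb S P (\<lambda>k. complex_of_real (f k)) - a'"]
    by simp
  have a'_mem: "a' \<in> K"
    using P by (simp add: a'_def)
  define w where "w j k l = (n2 (P k * Y j * P l))\<^sup>2" for j k l
  \<comment> \<open>The corners of the commutator \<open>Z\<close> of \<open>a'\<close> and
    \<open>Y j\<close> are those of \<open>Y j\<close> times \<open>\<theta> * (m k - m l)\<close>,
    so by orthogonality the sum is the square of \<open>n2 Z / \<theta>\<close>. The bound for
    \<open>n2 Z\<close> is \<open>\<theta>\<close> from \<open>a\<close>, plus
    \<open>2 * \<theta> * C\<close> twice for replacing \<open>a\<close> by
    \<open>a'\<close>.\<close>
  have w_sum: "(\<Sum>(k, l)\<in>S \<times> S. w j k l * (real_of_int (m k - m l))\<^sup>2) \<le> (4 * C + 1)\<^sup>2" if j: "j \<in> J" for j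
  proof -
    define Z where "Z = a' * Y j - Y j * a'"
    have "Z = (a * Y j - Y j * a) - ((a - a') * Y j - Y j * (a - a'))"
      by (simp add: Z_def algebra_simps)
    then have "n2 Z \<le> n2 (a * Y j - Y j * a) + (n2 ((a - a') * Y j) + n2 (Y j * (a - a')))"
      using n2_diff[of "a * Y j - Y j * a" "(a - a') * Y j - Y j * (a - a')"]
        n2_diff[of "(a - a') * Y j" "Y j * (a - a')"] by simp
    also have "n2 ((a - a') * Y j) \<le> nrm ((a - a') * Y j)"
      using a a'_mem Y(2)[OF j] by (intro n2_le_nrm) auto
    also have "nrm ((a - a') * Y j) \<le> 2 * \<theta> * C"
      using aa' Y(3)[OF j] by (rule nrm_mult_le)
    also have "n2 (Y j * (a - a')) \<le> nrm (Y j * (a - a'))"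
      using a a'_mem Y(2)[OF j] by (intro n2_le_nrm) auto
    also have "nrm (Y j * (a - a')) \<le> C * (2 * \<theta>)"
      using Y(3)[OF j] aa' by (rule nrm_mult_le)
    also have "n2 (a * Y j - Y j * a) \<le> \<theta>"
      by (rule comm[OF j])
    finally have "n2 Z \<le> \<theta> * (4 * C + 1)"
      by (simp add: algebra_simps)
    then have "(n2 Z)\<^sup>2 \<le> (\<theta> * (4 * C + 1))\<^sup>2"
      by (intro power_mono) auto
    moreover have "(n2 Z)\<^sup>2 = \<theta>\<^sup>2 * (\<Sum>(k, l)\<in>S \<times> S. w j k l * (real_of_int (m k - m l))\<^sup>2)"
    proof -
      have "(n2 (P k * Z * P l))\<^sup>2 = \<theta>\<^sup>2 * (w j k l * (real_of_int (m k - m l))\<^sup>2)" if "k \<in> S" "l \<in> S" for k l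
      proof -
        have 1: "P k * a' = complex_of_real (\<theta> * m k) *\<^sub>c P k"
          unfolding a'_def using P that by (rule_tac comb_mult_proj)
        have 2: "a' * P l = complex_of_real (\<theta> * m l) *\<^sub>c P l"
          using comb_mult_proj[OF P that(2), of "\<lambda>k. complex_of_real (\<theta> * m k)"]
            comb_commute[of S "P l" P "\<lambda>k. complex_of_real (\<theta> * m k)"] pouD(7)[OF P] that
          by (auto simp: a'_def)
        have "P k * Z * P l = (P k * a') * Y j * P l - P k * Y j * (a' * P l)"
          by (simp only: Z_def right_diff_distrib left_diff_distrib mult.assoc)
        also have "\<dots> = complex_of_real (\<theta> * (m k - m l)) *\<^sub>c (P k * Y j * P l)"
          unfolding 1 2 by (simp add: csc.scale_left_diff_distrib right_diff_distrib)
        finally have "n2 (P k * Z * P l) = \<bar>\<theta> * (m k - m l)\<bar> * n2 (P k * Y j * P l)"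
          by (simp only: n2_csc norm_of_real)
        then show ?thesis
          by (simp add: w_def power_mult_distrib)
      qed
      then show ?thesis
        using n2_sum_corners[OF P, of "S \<times> S" Z] sum_corners[OF P, of Z]
        by (auto simp add: sum_distrib_left case_prod_beta intro!: sum.cong)
    qed
    ultimately show ?thesis
      using \<theta> by (simp add: power_mult_distrib)
  qed
  define W where "W k l = (\<Sum>j\<in>J. w j k l)" for k l
  have w_nonneg: "0 \<le> w j k l" and W_nonneg: "0 \<le> W k l" for j k l
    by (auto simp: w_def W_def intro: sum_nonneg)
  define bin where "bin t k = (m k + int t) div int D" for t k
  define X where "X t = {(k, l) \<in> S \<times> S. bin t k \<noteq> bin t l}" for t
  have "(\<Sum>t<D. \<Sum>(k, l)\<in>X t. W k l) = (\<Sum>t<D. \<Sum>(k, l)\<in>S \<times> S. if bin t k \<noteq> bin t l then W k l else 0)"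
    using finS by (intro sum.cong[OF HOL.refl] sum.mono_neutral_cong_left) (auto simp: X_def)
  also have "\<dots> = (\<Sum>(k, l)\<in>S \<times> S. \<Sum>t<D. if bin t k \<noteq> bin t l then W k l else 0)"
    by (subst sum.swap) (simp add: case_prod_beta)
  also have "\<dots> = (\<Sum>(k, l)\<in>S \<times> S. real (card {t \<in> {..<D}. bin t k \<noteq> bin t l}) * W k l)"
    by (intro sum.cong HOL.refl) (auto simp: sum.If_cases Int_def)
  also have "\<dots> \<le> (\<Sum>(k, l)\<in>S \<times> S. W k l * (real_of_int (m k - m l))\<^sup>2)"
  proof -
    have "real (card {t \<in> {..<D}. bin t k \<noteq> bin t l}) * W k l \<le> W k l * (real_of_int (m k - m l))\<^sup>2" for k l
    proof -
      have "real (card {t \<in> {..<D}. bin t k \<noteq> bin t l}) \<le> real (nat \<bar>m k - m l\<bar>)"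
        using card_bin_boundaries[OF D, of "m k" "m l"] by (simp add: bin_def)
      also have "\<dots> = real_of_int \<bar>m k - m l\<bar>"
        by simp
      also have "\<dots> \<le> real_of_int (\<bar>m k - m l\<bar> * \<bar>m k - m l\<bar>)"
      proof -
        have "\<bar>m k - m l\<bar> = 0 \<or> \<bar>m k - m l\<bar> \<ge> 1"
          by linarith
        then have "\<bar>m k - m l\<bar> \<le> \<bar>m k - m l\<bar> * \<bar>m k - m l\<bar>"
          using mult_right_mono[of 1 "\<bar>m k - m l\<bar>" "\<bar>m k - m l\<bar>"] by auto
        then show ?thesis by (simp only: of_int_le_iff)
      qed
      also have "\<dots> = (real_of_int (m k - m l))\<^sup>2"
        by (simp add: power2_eq_square flip: abs_mult)
      finally show ?thesis
        using mult_left_mono[OF _ W_nonneg[of k l]] by (simp only: mult.commute[of _ "W k l"])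
    qed
    then show ?thesis
      unfolding case_prod_beta by (intro sum_mono)
  qed
  also have "\<dots> = (\<Sum>j\<in>J. \<Sum>(k, l)\<in>S \<times> S. w j k l * (real_of_int (m k - m l))\<^sup>2)"
    by (subst sum.swap) (simp add: W_def sum_distrib_right case_prod_beta)
  also have "\<dots> \<le> (\<Sum>j\<in>J. (4 * C + 1)\<^sup>2)"
    by (rule sum_mono[OF w_sum])
  finally have total: "(\<Sum>t<D. \<Sum>(k, l)\<in>X t. W k l) \<le> real (card J) * (4 * C + 1)\<^sup>2"
    by simp
  \<comment> \<open>Some offset is no worse than the average. Since \<open>W\<close> sums over all
    \<open>j\<close>, one offset serves all the \<open>Y j\<close> simultaneously.\<close>
  have "\<exists>t<D. (\<Sum>(k, l)\<in>X t. W k l) \<le> real (card J) * (4 * C + 1)\<^sup>2 / real D"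
  proof (rule ccontr)
    assume "\<not> ?thesis"
    then have "(\<Sum>t<D. real (card J) * (4 * C + 1)\<^sup>2 / real D) < (\<Sum>t<D. \<Sum>(k, l)\<in>X t. W k l)"
      using D by (intro sum_strict_mono) (auto simp: not_le)
    then show False
      using total D by simp
  qed
  then obtain t where t: "t < D" "(\<Sum>(k, l)\<in>X t. W k l) \<le> real (card J) * (4 * C + 1)\<^sup>2 / real D"
    by blast
  define E where "E i = (\<Sum>k | k \<in> S \<and> bin t k = i. P k)" for i
  \<comment> \<open>The left end of bin \<open>i\<close> on the original scale. Its distance to the
    values in the bin is at most \<open>D * \<theta>\<close>; the rounding before added
    \<open>2 * \<theta>\<close>.\<close>
  define g where "g i = \<theta> * (int D * i - int t)" for i
  have E: "pou (bin t ` S) E" and E_comb: "comb (bin t ` S) E h = comb S P (\<lambda>k. h (bin t k))" for h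
    using pou_image[OF P, of "bin t"] by (simp_all add: E_def[abs_def])
  show thesis
  proof (rule that[OF E])
    have "nrm (a' - comb (bin t ` S) E (\<lambda>k. complex_of_real (g k))) \<le> D * \<theta>"
      unfolding E_comb a'_def comb_diff
    proof (rule nrm_comb[OF P])
      fix k
      have "m k + int t = int D * bin t k + (m k + int t) mod int D"
        by (simp add: bin_def)
      moreover have "(m k + int t) mod int D < int D" "(m k + int t) mod int D \<ge> 0"
        using D by simp_all
      ultimately have "\<bar>m k - (int D * bin t k - int t)\<bar> \<le> int D"
        by linarith
      then have "\<bar>real_of_int (m k - (int D * bin t k - int t))\<bar> \<le> real D"
        by linarith
      then have "\<theta> * \<bar>real_of_int (m k - (int D * bin t k - int t))\<bar> \<le> D * \<theta>"
        using \<theta> by (simp add: mult.commute)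
      then have "\<bar>\<theta> * m k - g (bin t k)\<bar> \<le> D * \<theta>"
        using \<theta> by (simp add: g_def abs_mult flip: right_diff_distrib)
      then show "cmod (complex_of_real (\<theta> * m k) - complex_of_real (g (bin t k))) \<le> D * \<theta>"
        by (simp only: of_real_diff[symmetric] norm_of_real)
    qed
    then show "nrm (a - comb (bin t ` S) E (\<lambda>k. complex_of_real (g k))) \<le> (real D + 2) * \<theta>"
      using aa' nrm_triangle[of "a - a'" "a' - comb (bin t ` S) E (\<lambda>k. complex_of_real (g k))"]
      by (simp add: algebra_simps)
  next
    fix j assume j: "j \<in> J"
    \<comment> \<open>Pinching by the merged projections retains exactly the corners whose two
      indices share a bin, so the error consists of the corners in \<open>X t\<close>.\<close>
    have "pinch (bin t ` S) E (Y j) = (\<Sum>i\<in>bin t ` S. \<Sum>k | k \<in> S \<and> bin t k = i. \<Sum>l | l \<in> S \<and> bin t l = i. P k * Y j * P l)"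
      by (simp add: pinch_def E_def sum_distrib_left sum_distrib_right) (subst (2) sum.swap, simp)
    also have "\<dots> = (\<Sum>i\<in>bin t ` S. \<Sum>k | k \<in> S \<and> bin t k = i. \<Sum>l | l \<in> S \<and> bin t k = bin t l. P k * Y j * P l)"
      by (intro sum.cong HOL.refl) auto
    also have "\<dots> = (\<Sum>k\<in>S. \<Sum>l | l \<in> S \<and> bin t k = bin t l. P k * Y j * P l)"
      by (rule sum.image_gen[OF finS, symmetric])
    also have "\<dots> = (\<Sum>k\<in>S. \<Sum>l\<in>S. if bin t k = bin t l then P k * Y j * P l else 0)"
      using finS by (intro sum.cong[OF HOL.refl] sum.mono_neutral_cong_left) auto
    also have "\<dots> = (\<Sum>(k, l)\<in>S \<times> S. if bin t k = bin t l then P k * Y j * P l else 0)"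
      by (rule sum.cartesian_product)
    finally have "Y j - pinch (bin t ` S) E (Y j)
        = (\<Sum>(k, l)\<in>S \<times> S. if bin t k \<noteq> bin t l then P k * Y j * P l else 0)"
      by (subst (1) sum_corners[OF P, of "Y j", symmetric])
        (auto simp: sum_subtractf[symmetric] case_prod_beta intro!: sum.cong)
    also have "\<dots> = (\<Sum>(k, l)\<in>X t. P k * Y j * P l)"
      using finS by (intro sum.mono_neutral_cong_right) (auto simp: X_def)
    finally have "(n2 (Y j - pinch (bin t ` S) E (Y j)))\<^sup>2 = (\<Sum>(k, l)\<in>X t. w j k l)"
      using n2_sum_corners[OF P, of "X t" "Y j"] by (auto simp: w_def X_def)
    also have "\<dots> \<le> (\<Sum>(k, l)\<in>X t. W k l)"
      unfolding W_def using Y(1) j w_nonneg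
      by (intro sum_mono) (auto simp: case_prod_beta intro!: member_le_sum)
    finally show "(n2 (Y j - pinch (bin t ` S) E (Y j)))\<^sup>2 \<le> real (card J) * (4 * C + 1)\<^sup>2 / real D"
      using t(2) by simp
  qed
qed

end

section \<open>Sequences modulo 2-norm null sequences\<close>

definition null_seq :: "(nat \<Rightarrow> 'r::star_algebra \<Rightarrow> complex) \<Rightarrow> nat filter \<Rightarrow> (nat \<Rightarrow> 'r) \<Rightarrow> bool" where
  "null_seq \<tau> F x \<longleftrightarrow> ((\<lambda>i. tracial_cstar.n2 (\<tau> i) (x i)) \<longlongrightarrow> 0) F"

text \<open>Only the functionals and the filter are parameters, so \<open>\<asymp>\<close> is
  literally the same relation when \<open>tracial_sequence\<close> is interpreted for
  commutants.\<close>

locale seq_rel =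
  fixes \<tau> :: "nat \<Rightarrow> 'r::star_algebra \<Rightarrow> complex" and F :: "nat filter"
begin

abbreviation null :: "(nat \<Rightarrow> 'r) \<Rightarrow> bool" where
  "null \<equiv> null_seq \<tau> F"

definition aeq :: "(nat \<Rightarrow> 'r) \<Rightarrow> (nat \<Rightarrow> 'r) \<Rightarrow> bool"  (infix "\<asymp>" 50) where
  "x \<asymp> y \<longleftrightarrow> null (x - y)"

end

text \<open>The auxiliary null sequence \<open>\<delta>\<close> exists because the ultrafilter is countably incomplete.\<close>

locale tracial_sequence = seq_rel \<tau> F
  for \<tau> :: "nat \<Rightarrow> 'r::star_algebra \<Rightarrow> complex" and F :: "nat filter" +
  fixes K :: "nat \<Rightarrow> 'r set" and nrm :: "nat \<Rightarrow> 'r \<Rightarrow> real" and \<delta> :: "nat \<Rightarrow> real"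
  assumes tracial: "tracial_cstar (K i) (nrm i) (\<tau> i)"
    and rr0: "cstar.real_rank_zero (K i) (nrm i)"
    and \<delta>: "0 < \<delta> i" "\<delta> i \<le> 1" "(\<delta> \<longlongrightarrow> 0) F"
begin

sublocale T: tracial_cstar "K i" "nrm i" "\<tau> i" for i
  by (rule tracial)

definition Bd :: "(nat \<Rightarrow> 'r) set" where
  "Bd = {x. (\<forall>i. x i \<in> K i) \<and> (\<exists>C. \<forall>i. nrm i (x i) \<le> C)}"

lemma BdI: "(\<And>i. x i \<in> K i) \<Longrightarrow> (\<And>i. nrm i (x i) \<le> C) \<Longrightarrow> x \<in> Bd"
  by (auto simp: Bd_def)

lemma BdE:
  assumes "x \<in> Bd"
  obtains C where "\<And>i. x i \<in> K i" "\<And>i. nrm i (x i) \<le> C" "C \<ge> 0"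
proof -
  obtain C where "\<And>i. x i \<in> K i" "\<And>i. nrm i (x i) \<le> C"
    using assms by (auto simp: Bd_def)
  moreover from this have "C \<ge> 0"
    using T.nrm_nonneg order_trans by blast
  ultimately show thesis by (rule that)
qed

lemma Bd_one [simp, intro]: "1 \<in> Bd"
  by (rule BdI[where C = 1]) auto

lemma Bd_add [simp, intro]: "x \<in> Bd \<Longrightarrow> y \<in> Bd \<Longrightarrow> x + y \<in> Bd"
proof -
  assume "x \<in> Bd" "y \<in> Bd"
  then obtain C C' where "\<And>i. x i \<in> K i" "\<And>i. nrm i (x i) \<le> C" "\<And>i. y i \<in> K i" "\<And>i. nrm i (y i) \<le> C'"
    by (metis BdE)
  then show ?thesis
    by (intro BdI[where C = "C + C'"]) (auto intro!: order_trans[OF T.nrm_triangle add_mono])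
qed

lemma Bd_mult [simp, intro]: "x \<in> Bd \<Longrightarrow> y \<in> Bd \<Longrightarrow> x * y \<in> Bd"
proof -
  assume "x \<in> Bd" "y \<in> Bd"
  then obtain C C' where "\<And>i. x i \<in> K i" "\<And>i. nrm i (x i) \<le> C" "\<And>i. y i \<in> K i" "\<And>i. nrm i (y i) \<le> C'"
    by (metis BdE)
  then show ?thesis
    by (intro BdI[where C = "C * C'"]) (auto intro: T.nrm_mult_le)
qed

lemma Bd_csc [simp, intro]: "x \<in> Bd \<Longrightarrow> c *\<^sub>c x \<in> Bd"
  by (erule BdE, rule_tac C = "cmod c * C" in BdI) (auto intro: mult_left_mono)

lemma Bd_adj [simp, intro]: "x \<in> Bd \<Longrightarrow> adj x \<in> Bd"
  by (erule BdE, rule_tac C = C in BdI) auto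

lemma Bd_minus [simp, intro]: "x \<in> Bd \<Longrightarrow> - x \<in> Bd"
  using Bd_csc[of x "-1"] by (simp add: csc.scale_minus_left)

lemma Bd_diff [simp, intro]: "x \<in> Bd \<Longrightarrow> y \<in> Bd \<Longrightarrow> x - y \<in> Bd"
  using Bd_add[of x "- y"] by simp

lemma Bd_zero [simp, intro]: "0 \<in> Bd"
  using Bd_diff[OF Bd_one Bd_one] by simp

lemma Bd_power [simp, intro]: "x \<in> Bd \<Longrightarrow> x ^ (n::nat) \<in> Bd"
  by (induction n) auto

lemma Bd_sum [simp, intro]: "(\<And>i. i \<in> I \<Longrightarrow> f i \<in> Bd) \<Longrightarrow> sum f I \<in> Bd"
  by (induction I rule: infinite_finite_induct) auto

lemma Bd_unitary: "(\<And>i. x i \<in> K i) \<Longrightarrow> adj x * x = 1 \<Longrightarrow> x \<in> Bd"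
proof (rule BdI[where C = 1])
  fix i
  assume "adj x * x = 1"
  then have "adj (x i) * x i = 1"
    by (metis adj_fun_apply one_fun_apply times_fun_apply)
  then show "nrm i (x i) \<le> 1"
    using T.nrm_unitary by simp
qed

lemma null_bound:
  assumes "\<And>i. T.n2 i (x i) \<le> g i" "(g \<longlongrightarrow> 0) F"
  shows "null x"
  unfolding null_seq_def
  by (rule tendsto_sandwich[OF _ _ tendsto_const assms(2)]) (auto simp: assms(1))

lemma null_zero [simp]: "null 0"
  by (simp add: null_seq_def)

lemma null_add: "null x \<Longrightarrow> null y \<Longrightarrow> null (x + y)"
  by (rule null_bound[where g = "\<lambda>i. T.n2 i (x i) + T.n2 i (y i)"])
    (auto simp: null_seq_def T.n2_triangle intro: tendsto_add_zero)

lemma null_csc: "null x \<Longrightarrow> null (c *\<^sub>c x)"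
  unfolding null_seq_def using tendsto_mult_right_zero[of _ F "cmod c"] by simp

lemma null_minus: "null x \<Longrightarrow> null (- x)"
  using null_csc[of x "-1"] by (simp add: csc.scale_minus_left)

lemma null_adj: "null x \<Longrightarrow> null (adj x)"
  by (simp add: null_seq_def)

lemma null_mult_left: "x \<in> Bd \<Longrightarrow> null y \<Longrightarrow> null (x * y)"
proof (erule BdE)
  fix C assume "null y" "\<And>i. x i \<in> K i" "\<And>i. nrm i (x i) \<le> C"
  then show ?thesis
    by (intro null_bound[OF _ tendsto_mult_right_zero[of "\<lambda>i. T.n2 i (y i)" F C]])
      (auto simp: null_seq_def intro!: order_trans[OF T.n2_mult_left mult_right_mono])
qed

lemma null_mult_right: "x \<in> Bd \<Longrightarrow> null y \<Longrightarrow> null (y * x)"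
  using null_mult_left[of "adj x" "adj y"] null_adj[of "adj x * adj y"] null_adj[of y]
  by (simp add: adj_mult)

lemma aeq_refl [simp, intro]: "x \<asymp> x"
  by (simp add: aeq_def)

lemma aeq_sym: "x \<asymp> y \<Longrightarrow> y \<asymp> x"
  unfolding aeq_def
  using null_minus[of "x - y"] by simp

lemma aeq_trans [trans]: "x \<asymp> y \<Longrightarrow> y \<asymp> z \<Longrightarrow> x \<asymp> z"
  unfolding aeq_def
  using null_add[of "x - y" "y - z"] by simp

lemma aeq_eq_trans [trans]: "x \<asymp> y \<Longrightarrow> y = z \<Longrightarrow> x \<asymp> z" "x = y \<Longrightarrow> y \<asymp> z \<Longrightarrow> x \<asymp> z"
  by auto

lemma aeq_add: "x \<asymp> x' \<Longrightarrow> y \<asymp> y' \<Longrightarrow> x + y \<asymp> x' + y'"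
  unfolding aeq_def
  using null_add[of "x - x'" "y - y'"] by (simp add: algebra_simps)

lemma aeq_csc: "x \<asymp> y \<Longrightarrow> c *\<^sub>c x \<asymp> c *\<^sub>c y"
  unfolding aeq_def
  using null_csc[of "x - y" c] by (simp add: csc.scale_right_diff_distrib)

lemma aeq_diff: "x \<asymp> x' \<Longrightarrow> y \<asymp> y' \<Longrightarrow> x - y \<asymp> x' - y'"
  using aeq_add[of x x' "- y" "- y'"] null_minus[of "y - y'"] by (simp add: aeq_def)

lemma aeq_adj: "x \<asymp> y \<Longrightarrow> adj x \<asymp> adj y"
  unfolding aeq_def
  using null_adj[of "x - y"] by (simp add: adj_diff)

lemma aeq_sum: "(\<And>i. i \<in> I \<Longrightarrow> f i \<asymp> g i) \<Longrightarrow> sum f I \<asymp> sum g I"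
  by (induction I rule: infinite_finite_induct) (auto intro: aeq_add)

lemma aeq_mult_left: "x \<in> Bd \<Longrightarrow> y \<asymp> y' \<Longrightarrow> x * y \<asymp> x * y'"
  unfolding aeq_def
  using null_mult_left[of x "y - y'"] by (simp add: right_diff_distrib)

lemma aeq_mult_right: "x \<in> Bd \<Longrightarrow> y \<asymp> y' \<Longrightarrow> y * x \<asymp> y' * x"
  unfolding aeq_def
  using null_mult_right[of x "y - y'"] by (simp add: left_diff_distrib)

lemma aeq_mult: "x \<asymp> x' \<Longrightarrow> y \<asymp> y' \<Longrightarrow> x' \<in> Bd \<Longrightarrow> y \<in> Bd \<Longrightarrow> x * y \<asymp> x' * y'"
  using aeq_trans[OF aeq_mult_right aeq_mult_left] by blast

lemma aeq_power: "x \<asymp> y \<Longrightarrow> x \<in> Bd \<Longrightarrow> y \<in> Bd \<Longrightarrow> x ^ (n::nat) \<asymp> y ^ n"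
  by (induction n) (auto intro: aeq_mult)

lemma aeq_nrm_bound:
  assumes "\<And>i. x i \<in> K i" "\<And>i. y i \<in> K i" "\<And>i. nrm i (x i - y i) \<le> g i" "(g \<longlongrightarrow> 0) F"
  shows "x \<asymp> y"
  unfolding aeq_def using assms by (intro null_bound[OF _ assms(4)]) (auto intro: order_trans[OF T.n2_le_nrm])

lemma Bd_uniform:
  assumes "finite J" "\<And>j. j \<in> J \<Longrightarrow> Y j \<in> Bd"
  obtains C where "\<And>j i. j \<in> J \<Longrightarrow> nrm i (Y j i) \<le> C"
proof -
  have "\<exists>C. \<forall>j\<in>J. \<forall>i. nrm i (Y j i) \<le> C"
    using assms
  proof (induction J)
    case (insert j J)
    then obtain C where C: "\<And>j' i. j' \<in> J \<Longrightarrow> nrm i (Y j' i) \<le> C" by auto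
    obtain C' where "\<And>i. nrm i (Y j i) \<le> C'"
      using insert.prems BdE by (metis insertI1)
    then show ?case
      using C by (intro exI[of _ "max C C'"]) (auto simp: le_max_iff_disj)
  qed simp
  then show thesis using that by auto
qed

lemma Bd_comb:
  assumes "\<And>i. T.pou i (I i) (P i)" "\<And>i k. k \<in> I i \<Longrightarrow> cmod (f i k) \<le> C"
  shows "(\<lambda>i. T.comb (I i) (P i) (f i)) \<in> Bd"
  using assms by (intro BdI[where C = C] T.nrm_comb) auto

end

section \<open>Lifting unitaries of finite order\<close>

lemma sum_roots_of_unity:
  assumes "b > 0" "z ^ b = (1::complex)"
  shows "(\<Sum>k<b. z ^ k) = (if z = 1 then of_nat b else 0)"
  using assms by (simp add: geometric_sum)

lemma geometric_sum_mult:
  fixes x :: "'a::ring_1"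
  shows "x * (\<Sum>k<b. x ^ k) = (\<Sum>k<b. x ^ k) + (x ^ b - 1)"
  by (induction b) (simp_all add: distrib_left)

text \<open>For \<open>y\<^sup>b = 1\<close> this is the projection onto the eigenspace of \<open>y\<close> at \<open>cis (2 pi s / b)\<close>.\<close>

definition root_proj :: "nat \<Rightarrow> 'r::star_algebra \<Rightarrow> nat \<Rightarrow> 'r" where
  "root_proj b y s = (1 / of_nat b) *\<^sub>c (\<Sum>k<b. cis (- (2 * pi * s / b)) ^ k *\<^sub>c y ^ k)"

lemma cis_root: "b > 0 \<Longrightarrow> cis (2 * pi * s / b) ^ b = 1" "b > 0 \<Longrightarrow> cis (- (2 * pi * s / b)) ^ b = 1"
  for b s :: nat
proof -
  assume "b > 0"
  then have "cis (2 * pi * s / b) ^ b = cis (2 * pi * real s)"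
    by (simp add: DeMoivre)
  also have "\<dots> = 1"
    using cis_multiple_2pi[of "real s"] by simp
  finally show 1: "cis (2 * pi * s / b) ^ b = 1" .
  have "cis (- (2 * pi * s / b)) ^ b = cnj (cis (2 * pi * s / b) ^ b)"
    by (simp add: cis_cnj)
  then show "cis (- (2 * pi * s / b)) ^ b = 1"
    by (simp add: 1)
qed

text \<open>Orthogonality of the characters of the cyclic group of order \<open>b\<close>.\<close>

lemma cis_root_orthogonal:
  fixes b r s :: nat
  assumes "b > 0" "r < b" "s < b"
  shows "(\<Sum>k<b. (cis (- (2 * pi * r / b)) * cis (2 * pi * s / b)) ^ k) = (if r = s then of_nat b else 0)"
proof -
  let ?z = "cis (- (2 * pi * r / b)) * cis (2 * pi * s / b)"
  have "?z = 1 \<longleftrightarrow> r = s"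
  proof
    assume "?z = 1"
    then have "cis (2 * pi * (real s - real r) / b) = 1"
      by (simp add: cis_mult right_diff_distrib diff_divide_distrib)
    then have "cos (2 * pi * (real s - real r) / b) = 1"
      by (metis Re_complex_of_real cis.sel(1) of_real_1)
    then obtain n :: int where "2 * pi * (real s - real r) / b = real_of_int n * 2 * pi"
      by (auto simp: cos_one_2pi_int)
    then have "pi * ((real s - real r) - n * b) = 0"
      using assms(1) by (simp add: field_simps)
    then have "real s - real r = n * b"
      by simp
    then have *: "int s - int r = n * int b"
      by (metis of_int_diff of_int_eq_iff of_int_mult of_int_of_nat_eq)
    then have "\<bar>n * int b\<bar> < int b"
      using assms by linarith
    then have "n = 0"
      using assms(1) by (simp add: abs_mult)
    then show "r = s" using * by simp
  qed (simp add: cis_mult)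
  then show ?thesis
    using assms(1) cis_root[OF assms(1)] by (subst sum_roots_of_unity) (auto simp: power_mult_distrib)
qed

text \<open>The defect \<open>y ^ b - 1\<close> is kept explicit, so the identity serves both the
  exact case and the case modulo null sequences.\<close>

lemma root_proj_eigen:
  assumes "b > 0"
  shows "y * root_proj b y s = cis (2 * pi * s / b) *\<^sub>c root_proj b y s
    + (cis (2 * pi * s / b) / of_nat b) *\<^sub>c (y ^ b - 1)"
proof -
  let ?z = "cis (- (2 * pi * s / b))" and ?w = "cis (2 * pi * s / b)"
  let ?S = "\<Sum>k<b. (?z *\<^sub>c y) ^ k"
  have wz: "?w * ?z = 1"
    by (simp add: cis_mult)
  have "y * ?S = ?w *\<^sub>c ((?z *\<^sub>c y) * ?S)"
    by (simp add: wz)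
  also have "(?z *\<^sub>c y) * ?S = ?S + (y ^ b - 1)"
    by (subst geometric_sum_mult) (simp add: csc_power cis_root[OF assms])
  finally have "y * ((1 / of_nat b) *\<^sub>c ?S) = (1 / of_nat b) *\<^sub>c (?w *\<^sub>c (?S + (y ^ b - 1)))"
    by simp
  then show ?thesis
    by (simp add: root_proj_def csc_power csc.scale_right_distrib mult.commute)
qed

lemma sum_root_proj:
  assumes "b > 0"
  shows "(\<Sum>s<b. root_proj b y s) = 1"
proof -
  have "(\<Sum>s<b. root_proj b y s) = (\<Sum>k<b. ((1 / of_nat b) * (\<Sum>s<b. cis (- (2 * pi * s / b)) ^ k)) *\<^sub>c y ^ k)"
    unfolding root_proj_def csc.scale_sum_right csc.scale_sum_left sum_distrib_left
    by (subst sum.swap) simp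
  also have "\<dots> = (\<Sum>k<b. if k = 0 then 1 else 0)"
  proof (rule sum.cong)
    fix k assume k: "k \<in> {..<b}"
    have "(\<Sum>s<b. cis (- (2 * pi * s / b)) ^ k) = (\<Sum>s<b. (cis (- (2 * pi * k / b)) * cis (2 * pi * real 0 / b)) ^ s)"
      by (simp add: DeMoivre mult_ac)
    also have "\<dots> = (if k = 0 then of_nat b else 0)"
      using k assms by (intro cis_root_orthogonal) auto
    finally show "((1 / of_nat b) * (\<Sum>s<b. cis (- (2 * pi * s / b)) ^ k)) *\<^sub>c y ^ k = (if k = 0 then 1 else 0)"
      using assms by simp
  qed simp
  also have "\<dots> = 1"
    using assms by simp
  finally show ?thesis .
qed

lemma adj_root_proj: "adj (root_proj b y s) = (1 / of_nat b) *\<^sub>c (\<Sum>k<b. cis (2 * pi * s / b) ^ k *\<^sub>c adj y ^ k)"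
  by (simp add: root_proj_def adj_simps cis_cnj)

text \<open>Rounds a spectral value to an index; all other indices are at least 1/2 away, which will
  keep the reciprocals of the differences bounded by 2.\<close>

lemma nearest_index:
  fixes x :: real
  assumes "b > (0::nat)"
  shows "\<exists>r<b. \<forall>s<b. s \<noteq> r \<longrightarrow> \<bar>x - real s\<bar> \<ge> 1/2"
proof -
  have "\<exists>r\<in>{..<b}. \<forall>s\<in>{..<b}. \<bar>x - real r\<bar> \<le> \<bar>x - real s\<bar>"
    using arg_min_if_finite[of "{..<b}" "\<lambda>s. \<bar>x - real s\<bar>"] assms
    by (intro bexI[of _ "arg_min_on (\<lambda>s. \<bar>x - real s\<bar>) {..<b}"]) (auto simp: not_less dest: leI)
  then obtain r where r: "r < b" "\<And>s. s < b \<Longrightarrow> \<bar>x - real r\<bar> \<le> \<bar>x - real s\<bar>"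
    by auto
  have "\<bar>x - real s\<bar> \<ge> 1/2" if "s < b" "s \<noteq> r" for s
  proof -
    have "\<bar>real s - real r\<bar> \<ge> 1"
      using \<open>s \<noteq> r\<close> by linarith
    then show ?thesis
      using r(2)[OF \<open>s < b\<close>] by linarith
  qed
  then show ?thesis using r(1) by blast
qed

context tracial_sequence
begin

lemma Bd_root_proj [simp, intro]: "y \<in> Bd \<Longrightarrow> root_proj b y s \<in> Bd"
  by (auto simp: root_proj_def)

lemma root_proj_eigen_aeq:
  assumes y: "y \<in> Bd" "y ^ b \<asymp> 1" and b: "b > 0"
  shows "y ^ k * root_proj b y s \<asymp> cis (2 * pi * s / b) ^ k *\<^sub>c root_proj b y s"
proof (induction k)
  case (Suc k)
  let ?f = "root_proj b y s" and ?w = "cis (2 * pi * s / b)"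
  have "(?w / of_nat b) *\<^sub>c (y ^ b - 1) \<asymp> (?w / of_nat b) *\<^sub>c (1 - 1)"
    by (intro aeq_csc aeq_diff y aeq_refl)
  then have 1: "y * ?f \<asymp> ?w *\<^sub>c ?f"
    unfolding root_proj_eigen[OF b, of y s] using aeq_add[OF aeq_refl, of "(?w / of_nat b) *\<^sub>c (y ^ b - 1)" 0]
    by simp
  have "y ^ Suc k * ?f = y * (y ^ k * ?f)"
    by (simp add: mult.assoc)
  also have "\<dots> \<asymp> y * (?w ^ k *\<^sub>c ?f)"
    by (intro aeq_mult_left y Suc)
  also have "y * (?w ^ k *\<^sub>c ?f) = ?w ^ k *\<^sub>c (y * ?f)"
    by simp
  also have "\<dots> \<asymp> ?w ^ k *\<^sub>c (?w *\<^sub>c ?f)"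
    by (intro aeq_csc 1)
  also have "\<dots> = ?w ^ Suc k *\<^sub>c ?f"
    by (simp add: mult.commute)
  finally show ?case .
qed simp

lemma root_proj_eigen_adj_aeq:
  assumes y: "y \<in> Bd" "y ^ b \<asymp> 1" "adj y * y \<asymp> 1" and b: "b > 0"
  shows "adj y ^ k * root_proj b y s \<asymp> cis (- (2 * pi * s / b)) ^ k *\<^sub>c root_proj b y s"
proof (induction k)
  case (Suc k)
  let ?f = "root_proj b y s" and ?w = "cis (2 * pi * s / b)" and ?z = "cis (- (2 * pi * s / b))"
  have "adj y * ?f = ?z *\<^sub>c (adj y * (?w *\<^sub>c ?f))"
    by (simp add: cis_mult)
  also have "\<dots> \<asymp> ?z *\<^sub>c (adj y * (y * ?f))"
    using root_proj_eigen_aeq[OF y(1,2) b, of 1 s] y(1) by (intro aeq_csc aeq_mult_left) (auto intro: aeq_sym)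
  also have "\<dots> = ?z *\<^sub>c (adj y * y * ?f)"
    by (simp add: mult.assoc)
  also have "\<dots> \<asymp> ?z *\<^sub>c (1 * ?f)"
    using y by (intro aeq_csc aeq_mult_right) auto
  finally have 1: "adj y * ?f \<asymp> ?z *\<^sub>c ?f" by simp
  have "adj y ^ Suc k * ?f = adj y * (adj y ^ k * ?f)"
    by (simp add: mult.assoc)
  also have "\<dots> \<asymp> adj y * (?z ^ k *\<^sub>c ?f)"
    using y by (intro aeq_mult_left Suc) auto
  also have "adj y * (?z ^ k *\<^sub>c ?f) = ?z ^ k *\<^sub>c (adj y * ?f)"
    by simp
  also have "\<dots> \<asymp> ?z ^ k *\<^sub>c (?z *\<^sub>c ?f)"
    by (intro aeq_csc 1)
  also have "\<dots> = ?z ^ Suc k *\<^sub>c ?f"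
    by (simp add: mult.commute)
  finally show ?case .
qed simp

text \<open>The second relation stands in for self-adjointness, which the elements
  \<open>root_proj b y r\<close> have only up to null sequences.\<close>

lemma root_proj_orthogonal_aeq:
  assumes y: "y \<in> Bd" "y ^ b \<asymp> 1" "adj y * y \<asymp> 1" and b: "r < b" "s < b"
  shows "root_proj b y r * root_proj b y s \<asymp> (if r = s then root_proj b y s else 0)"
    and "adj (root_proj b y r) * root_proj b y s \<asymp> (if r = s then root_proj b y s else 0)"
proof -
  have b0: "b > 0" using b by simp
  let ?f = "root_proj b y s" and ?z = "\<lambda>s. cis (- (2 * pi * real s / b))" and ?w = "\<lambda>s. cis (2 * pi * real s / b)"
  have "root_proj b y r * ?f = (1 / of_nat b) *\<^sub>c (\<Sum>k<b. ?z r ^ k *\<^sub>c (y ^ k * ?f))"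
    by (simp add: root_proj_def[of b y r] sum_distrib_right)
  also have "\<dots> \<asymp> (1 / of_nat b) *\<^sub>c (\<Sum>k<b. ?z r ^ k *\<^sub>c (?w s ^ k *\<^sub>c ?f))"
    by (intro aeq_csc aeq_sum root_proj_eigen_aeq y b0)
  also have "\<dots> = ((1 / of_nat b) * (\<Sum>k<b. (?z r * ?w s) ^ k)) *\<^sub>c ?f"
    by (simp only: csc_csc csc.scale_sum_left[symmetric] power_mult_distrib)
  also have "\<dots> = (if r = s then ?f else 0)"
    using cis_root_orthogonal[OF b0 b] b0 by simp
  finally show "root_proj b y r * ?f \<asymp> (if r = s then ?f else 0)" .
  have "adj (root_proj b y r) * ?f = (1 / of_nat b) *\<^sub>c (\<Sum>k<b. ?w r ^ k *\<^sub>c (adj y ^ k * ?f))"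
    by (simp add: adj_root_proj sum_distrib_right)
  also have "\<dots> \<asymp> (1 / of_nat b) *\<^sub>c (\<Sum>k<b. ?w r ^ k *\<^sub>c (?z s ^ k *\<^sub>c ?f))"
    by (intro aeq_csc aeq_sum root_proj_eigen_adj_aeq y b0)
  also have "\<dots> = ((1 / of_nat b) * (\<Sum>k<b. (?z s * ?w r) ^ k)) *\<^sub>c ?f"
    by (simp only: csc_csc csc.scale_sum_left[symmetric] power_mult_distrib mult.commute)
  also have "\<dots> = (if r = s then ?f else 0)"
    using cis_root_orthogonal[OF b0 b(2,1)] b0 by simp
  finally show "adj (root_proj b y r) * ?f \<asymp> (if r = s then ?f else 0)" .
qed

text \<open>The self-adjoint \<open>h\<close>, close to the sum of \<open>s\<close> times the
  approximate eigenprojection \<open>f s\<close>, plays the role of a logarithm of \<open>y\<close>.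
  Real rank zero applies to \<open>h\<close>; rounding the spectral values of its approximant to the
  nearest index yields exact projections \<open>e s\<close> equivalent to \<open>f s\<close>, and
  exact roots of unity are placed on them.\<close>

lemma finite_order_lift:
  assumes y: "y \<in> Bd" "y ^ b \<asymp> 1" "adj y * y \<asymp> 1" and b: "b > 0"
  obtains u where "\<And>i. u i \<in> K i" "adj u * u = 1" "u * adj u = 1" "u ^ b = 1" "u \<asymp> y"
proof -
  define f where "f = root_proj b y"
  have f_Bd [simp]: "f s \<in> Bd" for s
    using y by (simp add: f_def)
  define a where "a = (\<Sum>s<b. of_nat s *\<^sub>c f s)"
  define h where "h = (1/2) *\<^sub>c (a + adj a)"
  have a_Bd: "a \<in> Bd"
    by (auto simp: a_def)
  then have h_Bd: "h \<in> Bd"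
    by (auto simp: h_def)
  have h_adj: "adj h = h"
    by (simp add: h_def adj_add add.commute)
  have hf: "h * f s \<asymp> of_nat s *\<^sub>c f s" if s: "s < b" for s
  proof -
    have "(\<Sum>r<b. of_nat r *\<^sub>c (f r * f s)) \<asymp> (\<Sum>r<b. of_nat r *\<^sub>c (if r = s then f s else 0))"
      unfolding f_def by (intro aeq_sum aeq_csc root_proj_orthogonal_aeq y) (use s in auto)
    moreover have "(\<Sum>r<b. of_nat r *\<^sub>c (adj (f r) * f s)) \<asymp> (\<Sum>r<b. of_nat r *\<^sub>c (if r = s then f s else 0))"
      unfolding f_def by (intro aeq_sum aeq_csc root_proj_orthogonal_aeq y) (use s in auto)
    moreover have "(\<Sum>r<b. of_nat r *\<^sub>c (if r = s then f s else 0)) = of_nat s *\<^sub>c f s"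
    proof -
      have "(\<Sum>r<b. of_nat r *\<^sub>c (if r = s then f s else 0)) = (\<Sum>r<b. if r = s then of_nat s *\<^sub>c f s else 0)"
        by (intro sum.cong) auto
      then show ?thesis using s by simp
    qed
    ultimately have "a * f s \<asymp> of_nat s *\<^sub>c f s" "adj a * f s \<asymp> of_nat s *\<^sub>c f s"
      by (simp_all add: a_def adj_simps sum_distrib_right)
    then have "(1/2) *\<^sub>c (a * f s + adj a * f s) \<asymp> (1/2) *\<^sub>c (of_nat s *\<^sub>c f s + of_nat s *\<^sub>c f s)"
      by (intro aeq_csc aeq_add)
    then show ?thesis
      by (simp only: h_def csc_mult_left distrib_right csc.scale_right_distrib csc_half)
  qed
  have "\<exists>(I :: complex set) P g. T.pou i I P \<and> nrm i (h i - T.comb I P (\<lambda>k. complex_of_real (g k))) < \<delta> i" for i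
  proof (rule T.real_rank_zeroE[OF rr0, where x = "h i" and e = "\<delta> i"])
    show "h i \<in> K i"
      using h_Bd by (auto elim: BdE)
    show "adj (h i) = h i"
      using h_adj by (metis adj_fun_apply)
  qed (use \<delta> in auto)
  then obtain I :: "nat \<Rightarrow> complex set" and P g where P: "\<And>i. T.pou i (I i) (P i)"
    and near: "\<And>i. nrm i (h i - T.comb (I i) (P i) (\<lambda>k. complex_of_real (g i k))) < \<delta> i"
    by metis
  define h' where "h' = (\<lambda>i. T.comb (I i) (P i) (\<lambda>k. complex_of_real (g i k)))"
  have h'K: "h' i \<in> K i" for i
    using P by (simp add: h'_def)
  have h'h: "h' \<asymp> h"
  proof (rule aeq_sym, rule aeq_nrm_bound[OF _ h'K _ \<delta>(3)])
    show "h i \<in> K i" for i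
      using h_Bd by (auto elim: BdE)
    show "nrm i (h i - h' i) \<le> \<delta> i" for i
      using near[of i] by (simp add: h'_def)
  qed
  have h'_Bd: "h' \<in> Bd"
  proof -
    obtain C where C: "\<And>i. nrm i (h i) \<le> C"
      using BdE[OF h_Bd] by metis
    have "nrm i (h' i) \<le> C + 1" for i
      using T.nrm_diff[of i "h i" "h i - h' i"] near[of i] C[of i] \<delta>(2)[of i] by (simp add: h'_def)
    then show ?thesis
      using h'K by (intro BdI)
  qed
  obtain rb :: "real \<Rightarrow> nat" where rb: "\<And>x. rb x < b" "\<And>x s. s < b \<Longrightarrow> s \<noteq> rb x \<Longrightarrow> \<bar>x - real s\<bar> \<ge> 1/2"
    using nearest_index[OF b] by metis
  define e where "e r = (\<lambda>i. T.comb (I i) (P i) (\<lambda>k. if rb (g i k) = r then 1 else 0))" for r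
  have e_Bd: "e r \<in> Bd" for r
    unfolding e_def by (rule Bd_comb[OF P, where C = 1]) auto
  have sum_e: "(\<Sum>r<b. e r) = 1"
  proof
    fix i
    have "(\<Sum>r<b. if rb x = r then 1 else 0 :: complex) = 1" for x
      using rb(1)[of x] by simp
    then have "(\<Sum>r<b. T.comb (I i) (P i) (\<lambda>k. if rb (g i k) = r then 1 else 0)) = T.comb (I i) (P i) (\<lambda>k. 1)"
      unfolding T.comb_def by (subst sum.swap) (simp add: csc.scale_sum_left[symmetric])
    then show "(\<Sum>r<b. e r) i = 1 i"
      using T.comb_one[OF P] by (simp add: e_def)
  qed
  have ef: "e r * f s \<asymp> 0" if "s < b" "r \<noteq> s" for r s
  proof -
    \<comment> \<open>\<open>q\<close> is \<open>1 / (h' - s)\<close> cut down to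
      \<open>e r\<close>; it is bounded because values rounded to \<open>r\<close> are at least 1/2
      away from \<open>s\<close>. Thus \<open>e r\<close> factors through \<open>h' - s\<close>,
      which annihilates \<open>f s\<close> up to a null sequence.\<close>
    define q where "q = (\<lambda>i. T.comb (I i) (P i) (\<lambda>k. if rb (g i k) = r then 1 / complex_of_real (g i k - real s) else 0))"
    have q_Bd: "q \<in> Bd"
      unfolding q_def
    proof (rule Bd_comb[OF P, where C = 2])
      fix i k
      have "cmod (1 / complex_of_real (g i k - real s)) \<le> 2" if "rb (g i k) = r"
      proof -
        have "\<bar>g i k - real s\<bar> \<ge> 1/2"
          using rb(2)[of s "g i k"] that \<open>s < b\<close> \<open>r \<noteq> s\<close> by auto
        moreover have "cmod (1 / complex_of_real (g i k - real s)) = 1 / \<bar>g i k - real s\<bar>"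
          by (simp only: norm_divide norm_of_real norm_one)
        ultimately show ?thesis
          by (simp add: divide_le_eq)
      qed
      then show "cmod (if rb (g i k) = r then 1 / complex_of_real (g i k - real s) else 0) \<le> 2"
        by simp
    qed
    have "e r = q * (h' - of_nat s *\<^sub>c 1)"
    proof
      fix i
      have "(q * (h' - of_nat s *\<^sub>c 1)) i = T.comb (I i) (P i) (\<lambda>k. if rb (g i k) = r then 1 / complex_of_real (g i k - real s) else 0)
          * T.comb (I i) (P i) (\<lambda>k. complex_of_real (g i k - real s))"
      proof -
        have "h' i - of_nat s *\<^sub>c 1 = T.comb (I i) (P i) (\<lambda>k. complex_of_real (g i k - real s))"
          unfolding h'_def T.comb_one[OF P, of i, symmetric] T.comb_csc T.comb_diff by simp
        then show ?thesis
          by (simp add: q_def)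
      qed
      also have "\<dots> = T.comb (I i) (P i) (\<lambda>k. if rb (g i k) = r then 1 else 0)"
        unfolding T.comb_mult[OF P]
      proof (rule T.comb_cong)
        fix k
        show "(if rb (g i k) = r then 1 / complex_of_real (g i k - real s) else 0) * complex_of_real (g i k - real s)
          = (if rb (g i k) = r then 1 else 0)"
          using rb(2)[of s "g i k"] that by (auto simp del: of_real_diff)
      qed
      finally show "e r i = (q * (h' - of_nat s *\<^sub>c 1)) i"
        by (simp add: e_def)
    qed
    then have "e r * f s = q * (h' * f s - of_nat s *\<^sub>c f s)"
      by (simp add: mult.assoc left_diff_distrib)
    also have "\<dots> \<asymp> q * (h * f s - of_nat s *\<^sub>c f s)"
      by (intro aeq_mult_left q_Bd aeq_diff aeq_mult_right h'h aeq_refl) simp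
    also have "\<dots> \<asymp> q * (of_nat s *\<^sub>c f s - of_nat s *\<^sub>c f s)"
      by (intro aeq_mult_left q_Bd aeq_diff hf that aeq_refl)
    finally show ?thesis by simp
  qed
  \<comment> \<open>Expanding \<open>e r\<close> by the sum of the \<open>f s\<close>, and
    \<open>f r\<close> by the sum of the \<open>e s\<close>, leaves \<open>e r * f r\<close> both
    times.\<close>
  have e_f: "e r \<asymp> f r" if r: "r < b" for r
  proof -
    have "e r = (\<Sum>s<b. e r * f s)"
      by (simp add: f_def sum_root_proj[OF b] flip: sum_distrib_left)
    also have "\<dots> \<asymp> (\<Sum>s<b. if s = r then e r * f r else 0)"
      by (intro aeq_sum) (use ef[of _ r] in auto)
    also have "\<dots> = e r * f r"
      using r by simp
    finally have 1: "e r \<asymp> e r * f r" .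
    have "f r = (\<Sum>s<b. e s * f r)"
      by (simp add: sum_e flip: sum_distrib_right)
    also have "\<dots> \<asymp> (\<Sum>s<b. if s = r then e r * f r else 0)"
      by (intro aeq_sum) (use ef[OF r] in auto)
    also have "\<dots> = e r * f r"
      using r by simp
    finally show ?thesis
      using 1 aeq_sym aeq_trans by blast
  qed
  define w where "w r = cis (2 * pi * real r / b)" for r
  define u where "u = (\<lambda>i. T.comb (I i) (P i) (\<lambda>k. w (rb (g i k))))"
  have ww: "cnj (w r) * w r = 1" "w r * cnj (w r) = 1" "w r ^ b = 1" for r
    using cis_root(1)[OF b] by (simp_all add: w_def cis_cnj cis_mult)
  have u_sum: "u = (\<Sum>r<b. w r *\<^sub>c e r)"
  proof
    fix i
    have "(\<Sum>r<b. w r * (if rb x = r then 1 else 0)) = (\<Sum>r<b. if r = rb x then w (rb x) else 0)" for x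
      by (intro sum.cong) auto
    then have "(\<Sum>r<b. w r * (if rb x = r then 1 else 0)) = w (rb x)" for x
      using rb(1)[of x] by simp
    then have "(\<Sum>r<b. w r *\<^sub>c T.comb (I i) (P i) (\<lambda>k. if rb (g i k) = r then 1 else 0)) = T.comb (I i) (P i) (\<lambda>k. w (rb (g i k)))"
      unfolding T.comb_csc unfolding T.comb_def by (subst sum.swap) (simp only: csc.scale_sum_left[symmetric])
    then show "u i = (\<Sum>r<b. w r *\<^sub>c e r) i"
      by (simp add: u_def e_def)
  qed
  show thesis
  proof (rule that)
    show "u i \<in> K i" for i
      using P by (simp add: u_def)
    show "adj u * u = 1" "u * adj u = 1" "u ^ b = 1"
      by (auto simp: fun_eq_iff u_def T.adj_comb[OF P] T.comb_mult[OF P] T.comb_power[OF P] ww T.comb_one[OF P])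
    have "u \<asymp> (\<Sum>r<b. w r *\<^sub>c f r)"
      unfolding u_sum by (intro aeq_sum aeq_csc e_f) simp
    also have "\<dots> \<asymp> (\<Sum>r<b. y * f r)"
      using root_proj_eigen_aeq[OF y(1,2) b, of 1]
      by (intro aeq_sum) (auto simp: f_def w_def intro: aeq_sym)
    also have "\<dots> = y"
      by (simp add: f_def sum_root_proj[OF b] flip: sum_distrib_left)
    finally show "u \<asymp> y" .
  qed
qed

end

section \<open>Lifting roots and chains of roots\<close>

context cstar
begin

text \<open>Self-adjointness follows by multiplying \<open>adj (root_proj m v r)\<close> with the
  sum of all the \<open>root_proj m v s\<close>, which is 1: only the term \<open>s = r\<close>
  survives.\<close>

lemma pou_root_proj:
  assumes v: "v \<in> K" "adj v * v = 1" "v ^ m = 1" and m: "m > 0"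
  shows "pou {..<m} (root_proj m v)" and "s < m \<Longrightarrow> v * root_proj m v s = cis (2 * pi * s / m) *\<^sub>c root_proj m v s"
proof -
  let ?f = "root_proj m v" and ?z = "\<lambda>s. cis (- (2 * pi * real s / m))" and ?w = "\<lambda>s. cis (2 * pi * real s / m)"
  have eigen: "v * ?f s = ?w s *\<^sub>c ?f s" for s
    by (simp add: root_proj_eigen[OF m] v)
  then show "v * ?f s = ?w s *\<^sub>c ?f s" .
  have eigen_power: "v ^ k * ?f s = ?w s ^ k *\<^sub>c ?f s" for k s
    by (induction k) (simp_all add: mult.assoc eigen mult.commute)
  have "adj v * ?f s = ?z s *\<^sub>c (adj v * (v * ?f s))" for s
    by (simp add: eigen cis_mult)
  then have eigen_adj: "adj v * ?f s = ?z s *\<^sub>c ?f s" for s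
    using v(2) by (simp flip: mult.assoc)
  have eigen_adj_power: "adj v ^ k * ?f s = ?z s ^ k *\<^sub>c ?f s" for k s
    by (induction k) (simp_all add: mult.assoc eigen_adj mult.commute)
  have orth: "?f r * ?f s = (if r = s then ?f s else 0)" if "r < m" "s < m" for r s
  proof -
    have "?f r * ?f s = ((1 / of_nat m) * (\<Sum>k<m. (?z r * ?w s) ^ k)) *\<^sub>c ?f s"
      unfolding root_proj_def[of m v r] csc_mult_left sum_distrib_right eigen_power
      by (simp only: csc_csc csc.scale_sum_left[symmetric] power_mult_distrib)
    then show ?thesis
      using cis_root_orthogonal[OF m that] m by simp
  qed
  have orth_adj: "adj (?f r) * ?f s = (if r = s then ?f s else 0)" if "r < m" "s < m" for r s
  proof -
    have "adj (?f r) * ?f s = ((1 / of_nat m) * (\<Sum>k<m. (?z s * ?w r) ^ k)) *\<^sub>c ?f s"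
      unfolding adj_root_proj csc_mult_left sum_distrib_right eigen_adj_power
      by (simp only: csc_csc csc.scale_sum_left[symmetric] power_mult_distrib mult.commute)
    then show ?thesis
      using cis_root_orthogonal[OF m that(2,1)] m by simp
  qed
  have "adj (?f r) = ?f r" if "r < m" for r
  proof -
    have "adj (?f r) = adj (?f r) * (\<Sum>s<m. ?f s)"
      by (simp add: sum_root_proj[OF m])
    also have "\<dots> = (\<Sum>s<m. if r = s then ?f s else 0)"
      unfolding sum_distrib_left using orth_adj that by (intro sum.cong) auto
    also have "\<dots> = ?f r"
      using that by simp
    finally show ?thesis .
  qed
  moreover have "?f s \<in> K" for s
    using v by (auto simp: root_proj_def)
  ultimately show "pou {..<m} ?f"
    using orth sum_root_proj[OF m, of v] by (auto simp: pou_def)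
qed

text \<open>The common refinement of two commuting partitions; it joins the spectral data of a real
  and an imaginary part.\<close>

lemma pou_product:
  assumes P: "pou I P" and Q: "pou J Q" and comm: "\<And>k l. k \<in> I \<Longrightarrow> l \<in> J \<Longrightarrow> P k * Q l = Q l * P k"
  shows "pou (I \<times> J) (\<lambda>(k, l). P k * Q l)"
    and "comb (I \<times> J) (\<lambda>(k, l). P k * Q l) (\<lambda>(k, l). f k) = comb I P f"
    and "comb (I \<times> J) (\<lambda>(k, l). P k * Q l) (\<lambda>(k, l). g l) = comb J Q g"
proof -
  have 1: "(\<Sum>(k, l)\<in>I \<times> J. f k *\<^sub>c (P k * Q l)) = comb I P f * sum Q J" for f
    by (simp add: comb_def sum.cartesian_product[symmetric] sum_product)
  then show "comb (I \<times> J) (\<lambda>(k, l). P k * Q l) (\<lambda>(k, l). f k) = comb I P f"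
    by (simp add: comb_def case_prod_beta pouD(2)[OF Q])
  have 2: "(\<Sum>(k, l)\<in>I \<times> J. g l *\<^sub>c (P k * Q l)) = sum P I * comb J Q g"
    by (simp add: comb_def sum.cartesian_product[symmetric] sum_product)
  then show "comb (I \<times> J) (\<lambda>(k, l). P k * Q l) (\<lambda>(k, l). g l) = comb J Q g"
    by (simp add: comb_def case_prod_beta pouD(2)[OF P])
  have mult: "(P k * Q l) * (P k' * Q l') = (P k * P k') * (Q l * Q l')"
    if "k \<in> I" "k' \<in> I" "l \<in> J" "l' \<in> J" for k k' l l'
    using comm[of k' l] that by (metis mult.assoc)
  have "(\<Sum>(k, l)\<in>I \<times> J. P k * Q l) = 1"
    using 1[of "\<lambda>_. 1"] P Q by (simp add: comb_one pouD(2))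
  then show "pou (I \<times> J) (\<lambda>(k, l). P k * Q l)"
    using pouD[OF P] pouD[OF Q] unfolding pou_def
    by (auto simp: mult adj_mult comm[symmetric] case_prod_beta)
qed

end

context tracial_sequence
begin

text \<open>The fibrewise pinching with bin size tied to the size \<open>\<theta> i\<close> of the
  commutators, so that all errors vanish along the filter.\<close>

lemma pinch_sequence:
  assumes a: "a \<in> Bd" "adj a = a" and Y: "finite J" "\<And>j. j \<in> J \<Longrightarrow> Y j \<in> Bd"
    and comm: "\<And>j. j \<in> J \<Longrightarrow> a * Y j \<asymp> Y j * a"
  obtains I :: "nat \<Rightarrow> int set" and E g where "\<And>i. T.pou i (I i) (E i)"
    "(\<lambda>i. T.comb (I i) (E i) (\<lambda>k. complex_of_real (g i k))) \<in> Bd"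
    "a \<asymp> (\<lambda>i. T.comb (I i) (E i) (\<lambda>k. complex_of_real (g i k)))"
    "\<And>j. j \<in> J \<Longrightarrow> Y j \<asymp> (\<lambda>i. T.pinch (I i) (E i) (Y j i))"
proof -
  obtain C where C: "\<And>j i. j \<in> J \<Longrightarrow> nrm i (Y j i) \<le> C"
    using Bd_uniform[of J Y] Y by blast
  \<comment> \<open>\<open>\<delta>\<close> keeps \<open>\<theta> i\<close> positive in fibres where
    all commutators have 2-norm zero.\<close>
  define \<theta> where "\<theta> i = \<delta> i + (\<Sum>j\<in>J. T.n2 i ((a * Y j - Y j * a) i))" for i
  have \<theta>_pos: "\<theta> i > 0" for i
    unfolding \<theta>_def by (intro add_pos_nonneg \<delta> sum_nonneg) auto
  have "((\<lambda>i. \<delta> i + (\<Sum>j\<in>J. T.n2 i ((a * Y j - Y j * a) i))) \<longlongrightarrow> 0 + (\<Sum>j\<in>J. 0)) F"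
    using comm unfolding aeq_def null_seq_def by (intro tendsto_add \<delta>(3) tendsto_sum) auto
  then have \<theta>_lim: "(\<theta> \<longlongrightarrow> 0) F"
    by (simp add: \<theta>_def[abs_def])
  \<comment> \<open>The norm error \<open>D * \<theta>\<close> and the squared 2-norm error, a
    multiple of \<open>1 / D\<close>, are then both of order
    \<open>sqrt (\<theta> i)\<close>.\<close>
  define D where "D i = nat \<lceil>1 / sqrt (\<theta> i)\<rceil>" for i
  have D: "real (D i) \<ge> 1 / sqrt (\<theta> i)" "real (D i) \<le> 1 / sqrt (\<theta> i) + 1" "D i > 0" for i
  proof -
    have pos: "1 / sqrt (\<theta> i) > 0"
      using \<theta>_pos by simp
    then show "real (D i) \<ge> 1 / sqrt (\<theta> i)" "real (D i) \<le> 1 / sqrt (\<theta> i) + 1"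
      unfolding D_def by linarith+
    with pos show "D i > 0"
      by (metis less_le_trans of_nat_0_less_iff)
  qed
  have D\<theta>: "(real (D i) + 2) * \<theta> i \<le> sqrt (\<theta> i) + 3 * \<theta> i" for i
  proof -
    have "(real (D i) + 2) * \<theta> i \<le> (1 / sqrt (\<theta> i) + 3) * \<theta> i"
      using D(2)[of i] \<theta>_pos[of i] by (intro mult_right_mono) auto
    also have "\<dots> = sqrt (\<theta> i) + 3 * \<theta> i"
      using \<theta>_pos[of i] by (simp add: distrib_right real_div_sqrt)
    finally show ?thesis .
  qed
  have "\<exists>(I :: int set) E g. T.pou i I E \<and>
      nrm i (a i - T.comb I E (\<lambda>k. complex_of_real (g k))) \<le> (real (D i) + 2) * \<theta> i \<and>
      (\<forall>j\<in>J. (T.n2 i (Y j i - T.pinch I E (Y j i)))\<^sup>2 \<le> real (card J) * (4 * C + 1)\<^sup>2 / real (D i))" for i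
  proof (rule T.pinching[OF rr0, where a = "a i" and J = J and Y = "\<lambda>j. Y j i" and C = C and \<theta> = "\<theta> i" and D = "D i"])
    show "Y j i \<in> K i" if "j \<in> J" for j
      using a Y(2)[OF that] by (auto elim: BdE)
    show "a i \<in> K i"
      using a by (auto elim: BdE)
    show "adj (a i) = a i"
      using a(2) by (metis adj_fun_apply)
    show "T.n2 i (a i * Y j i - Y j i * a i) \<le> \<theta> i" if "j \<in> J" for j
    proof -
      have "T.n2 i ((a * Y j - Y j * a) i) \<le> (\<Sum>j\<in>J. T.n2 i ((a * Y j - Y j * a) i))"
        using Y(1) that by (intro member_le_sum) auto
      then show ?thesis
        using \<delta>(1)[of i] by (simp add: \<theta>_def)
    qed
  qed (use Y(1) C \<theta>_pos D(3) in auto)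
  then obtain I :: "nat \<Rightarrow> int set" and E g where E: "\<And>i. T.pou i (I i) (E i)"
    and near: "\<And>i. nrm i (a i - T.comb (I i) (E i) (\<lambda>k. complex_of_real (g i k))) \<le> (real (D i) + 2) * \<theta> i"
    and pinch: "\<And>i j. j \<in> J \<Longrightarrow> (T.n2 i (Y j i - T.pinch (I i) (E i) (Y j i)))\<^sup>2 \<le> real (card J) * (4 * C + 1)\<^sup>2 / real (D i)"
    by metis
  define c where "c = (\<lambda>i. T.comb (I i) (E i) (\<lambda>k. complex_of_real (g i k)))"
  have sqrt_lim: "((\<lambda>i. sqrt (\<theta> i)) \<longlongrightarrow> 0) F"
    using tendsto_real_sqrt[OF \<theta>_lim] by simp
  have lim: "((\<lambda>i. sqrt (\<theta> i) + 3 * \<theta> i) \<longlongrightarrow> 0) F"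
    using tendsto_add[OF sqrt_lim tendsto_mult[OF tendsto_const \<theta>_lim]] by simp
  have c_K: "c i \<in> K i" for i
    using E by (simp add: c_def)
  have ac: "a \<asymp> c"
  proof (rule aeq_nrm_bound[OF _ c_K _ lim])
    show "a i \<in> K i" for i
      using a by (auto elim: BdE)
    show "nrm i (a i - c i) \<le> sqrt (\<theta> i) + 3 * \<theta> i" for i
      using near[of i] D\<theta>[of i] by (simp add: c_def)
  qed
  have Y_pinch: "Y j \<asymp> (\<lambda>i. T.pinch (I i) (E i) (Y j i))" if j: "j \<in> J" for j
    unfolding aeq_def
  proof (rule null_bound)
    define B where "B = real (card J) * (4 * C + 1)\<^sup>2"
    have "B \<ge> 0"
      by (simp add: B_def)
    show "((\<lambda>i. sqrt (B * sqrt (\<theta> i))) \<longlongrightarrow> 0) F"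
      using tendsto_real_sqrt[OF tendsto_mult[OF tendsto_const sqrt_lim]] by simp
    fix i
    have "1 / real (D i) \<le> 1 / (1 / sqrt (\<theta> i))"
      using D[of i] \<theta>_pos[of i] by (intro divide_left_mono) auto
    then have "B * (1 / real (D i)) \<le> B * sqrt (\<theta> i)"
      using \<open>B \<ge> 0\<close> by (intro mult_left_mono) auto
    then have "(T.n2 i (Y j i - T.pinch (I i) (E i) (Y j i)))\<^sup>2 \<le> B * sqrt (\<theta> i)"
      using pinch[OF j, of i] by (simp add: B_def)
    then show "T.n2 i ((Y j - (\<lambda>i. T.pinch (I i) (E i) (Y j i))) i) \<le> sqrt (B * sqrt (\<theta> i))"
      by (simp add: real_le_rsqrt)
  qed
  \<comment> \<open>Boundedness is required in every fibre and not merely along the filter; it holds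
    because the commutators and \<open>\<delta>\<close> are bounded, hence so is
    \<open>\<theta>\<close>.\<close>
  have c_Bd: "c \<in> Bd"
  proof -
    have comm_Bd: "a * Y j - Y j * a \<in> Bd" if "j \<in> J" for j
      using a Y(2)[OF that] by auto
    obtain C' where C': "\<And>j i. j \<in> J \<Longrightarrow> nrm i ((a * Y j - Y j * a) i) \<le> C'"
      using Bd_uniform[of J "\<lambda>j. a * Y j - Y j * a"] comm_Bd Y(1) by blast
    obtain A where A: "\<And>i. nrm i (a i) \<le> A"
      using BdE[OF a(1)] by metis
    define B where "B = 1 + real (card J) * C'"
    have "nrm i (c i) \<le> A + ((B + 1) + 3 * B)" for i
    proof -
      have "T.n2 i ((a * Y j - Y j * a) i) \<le> C'" if "j \<in> J" for j
        using comm_Bd[OF that] C'[OF that, of i]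
        by (intro order_trans[OF T.n2_le_nrm]) (auto elim: BdE simp del: minus_fun_apply')
      then have "(\<Sum>j\<in>J. T.n2 i ((a * Y j - Y j * a) i)) \<le> (\<Sum>j\<in>J. C')"
        by (rule sum_mono)
      then have "\<theta> i \<le> B"
        using \<delta>(2)[of i] unfolding \<theta>_def B_def by simp
      have "sqrt (\<theta> i) \<le> \<theta> i + 1"
        using \<theta>_pos[of i] by (intro real_le_lsqrt) (auto simp: power2_eq_square algebra_simps)
      then have "nrm i (a i - c i) \<le> (B + 1) + 3 * B"
        using near[of i] D\<theta>[of i] \<open>\<theta> i \<le> B\<close> by (simp add: c_def)
      then show ?thesis
        using T.nrm_diff[of i "a i" "a i - c i"] A[of i] by simp
    qed
    then show ?thesis
      using c_K by (intro BdI)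
  qed
  show thesis
  proof (rule that[OF E _ _ Y_pinch])
    show "a \<asymp> (\<lambda>i. T.comb (I i) (E i) (\<lambda>k. complex_of_real (g i k)))"
      using ac by (simp add: c_def)
    show "(\<lambda>i. T.comb (I i) (E i) (\<lambda>k. complex_of_real (g i k))) \<in> Bd"
      using c_Bd by (simp add: c_def)
  qed
qed

lemma tracial_sequence_commutant:
  assumes E: "\<And>i. T.pou i (I i) (E i)"
  shows "tracial_sequence \<tau> F (\<lambda>i. T.commutant i (E i ` I i)) nrm \<delta>"
proof (rule tracial_sequence.intro)
  fix i
  show "tracial_cstar (T.commutant i (E i ` I i)) (nrm i) (\<tau> i)"
    using T.pouD[OF E] by (intro T.tracial_commutant) auto
  show "cstar.real_rank_zero (T.commutant i (E i ` I i)) (nrm i)"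
    using rr0 E by (intro T.real_rank_zero_commutant_pou)
qed (use \<delta> in auto)

lemma pinch_Bd:
  assumes E: "\<And>i. T.pou i (I i) (E i)" and x: "x \<in> Bd"
  shows "(\<lambda>i. T.pinch (I i) (E i) (x i)) \<in> tracial_sequence.Bd (\<lambda>i. T.commutant i (E i ` I i)) nrm"
proof -
  obtain C where "\<And>i. x i \<in> K i" "\<And>i. nrm i (x i) \<le> C"
    using BdE[OF x] by metis
  then show ?thesis
    unfolding tracial_sequence.Bd_def[OF tracial_sequence_commutant[OF E]]
    using T.pinch_in_commutant[OF E] T.nrm_pinch[OF E] order_trans by blast
qed

lemma Bd_commutant: "tracial_sequence.Bd (\<lambda>i. T.commutant i (X i)) nrm \<subseteq> Bd"
  if "tracial_sequence \<tau> F (\<lambda>i. T.commutant i (X i)) nrm \<delta>"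
  unfolding tracial_sequence.Bd_def[OF that] Bd_def by (auto simp: T.commutant_def)

text \<open>\<open>y\<close> commutes with its own power, hence up to null sequences with
  \<open>v\<close> and with the spectral projections of \<open>v\<close>, which are polynomials in
  \<open>v\<close>. In their commutant \<open>v\<close> has an exact central root \<open>t\<close>
  of order \<open>b\<close>; the pinched \<open>y\<close> times \<open>adj t\<close> has order
  \<open>b\<close> up to null sequences, is lifted there, and is multiplied back by
  \<open>t\<close>.\<close>

lemma root_lift:
  assumes v: "\<And>i. v i \<in> K i" "adj v * v = 1" "v * adj v = 1" "v ^ m = 1" and m: "m > 0" and b: "b > 0"
    and y: "y \<in> Bd" "adj y * y \<asymp> 1" "y ^ b \<asymp> v"
  obtains u where "\<And>i. u i \<in> K i" "adj u * u = 1" "u * adj u = 1" "u ^ b = v" "u \<asymp> y"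
proof -
  have v_Bd: "v \<in> Bd"
    using v by (intro Bd_unitary)
  have vi: "adj (v i) * v i = 1" "v i ^ m = 1" for i
    using v(2,4) by (metis adj_fun_apply one_fun_apply times_fun_apply, metis one_fun_apply power_fun_apply)
  define f where "f = root_proj m v"
  have f_apply: "f r i = root_proj m (v i) r" for r i
    by (simp add: f_def root_proj_def)
  have P: "T.pou i {..<m} (root_proj m (v i))" for i
    by (rule T.pou_root_proj[OF v(1) vi m])
  define P' where "P' i = root_proj m (v i)" for i
  have P': "T.pou i {..<m} (P' i)" for i
    unfolding P'_def by (rule P)
  interpret L: tracial_sequence \<tau> F "\<lambda>i. T.commutant i (P' i ` {..<m})" nrm \<delta>
    by (rule tracial_sequence_commutant[OF P'])
  have LBd: "x \<in> Bd" if "x \<in> L.Bd" for x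
    using Bd_commutant[OF L.tracial_sequence_axioms] that by auto
  have f_Bd: "f r \<in> Bd" for r
    using v_Bd by (auto simp: f_def)
  have "v * y \<asymp> y ^ b * y"
    using y by (intro aeq_mult_right) (auto intro: aeq_sym)
  also have "\<dots> = y * y ^ b"
    by (rule power_commutes)
  also have "\<dots> \<asymp> y * v"
    using y by (intro aeq_mult_left)
  finally have vy: "v * y \<asymp> y * v" .
  have vky: "v ^ k * y \<asymp> y * v ^ k" for k
  proof (induction k)
    case (Suc k)
    have "v ^ Suc k * y = v * (v ^ k * y)"
      by (simp add: mult.assoc)
    also have "\<dots> \<asymp> v * (y * v ^ k)"
      using v_Bd Suc by (intro aeq_mult_left)
    also have "\<dots> = (v * y) * v ^ k"
      by (simp add: mult.assoc)
    also have "\<dots> \<asymp> (y * v) * v ^ k"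
      using v_Bd vy by (intro aeq_mult_right) auto
    also have "\<dots> = y * v ^ Suc k"
      by (simp add: mult.assoc)
    finally show ?case .
  qed simp
  have fy: "f r * y \<asymp> y * f r" for r
    unfolding f_def root_proj_def csc_mult_left csc_mult_right sum_distrib_left sum_distrib_right
    by (intro aeq_csc aeq_sum vky)
  define y' where "y' = (\<lambda>i. T.pinch {..<m} (P' i) (y i))"
  have y'_sum: "y' = (\<Sum>r<m. f r * y * f r)"
    by (simp add: fun_eq_iff y'_def T.pinch_def f_apply P'_def)
  have ff: "f r * f r = f r" if "r < m" for r
    using T.pouD(5)[OF P] that by (simp add: fun_eq_iff f_apply)
  have "y' \<asymp> (\<Sum>r<m. f r * (f r * y))"
    unfolding y'_sum mult.assoc by (intro aeq_sum aeq_mult_left f_Bd) (rule aeq_sym[OF fy])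
  also have "\<dots> = (\<Sum>r<m. f r) * y"
    unfolding sum_distrib_right by (intro sum.cong) (auto simp: ff simp flip: mult.assoc)
  also have "\<dots> = y"
    by (simp add: f_def sum_root_proj[OF m])
  finally have y'y: "y' \<asymp> y" .
  have y'_LBd: "y' \<in> L.Bd"
    unfolding y'_def by (rule pinch_Bd[OF P' y(1)])
  then have y'_Bd: "y' \<in> Bd"
    by (rule LBd)
  \<comment> \<open>On the eigenspace of \<open>v\<close> at angle \<open>2 * pi * r / m\<close> the
    root of order \<open>b\<close> is taken by dividing the angle by \<open>b\<close>.\<close>
  define t where "t = (\<lambda>i. T.comb {..<m} (P' i) (\<lambda>r. cis (2 * pi * r / m / b)))"
  have t_mem: "t i \<in> T.commutant i (P' i ` {..<m})" for i
    unfolding t_def by (rule T.comb_in_commutant[OF P'])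
  have tt: "adj t * t = 1" "t * adj t = 1"
    by (auto simp: fun_eq_iff t_def T.adj_comb[OF P'] T.comb_mult[OF P'] cis_cnj cis_mult T.comb_one[OF P'])
  have tb: "t ^ b = v"
  proof
    fix i
    have "v i = v i * (\<Sum>r<m. P' i r)"
      using T.pouD(2)[OF P'] by simp
    also have "\<dots> = (\<Sum>r<m. cis (2 * pi * r / m) *\<^sub>c P' i r)"
      unfolding sum_distrib_left P'_def
      by (intro sum.cong T.pou_root_proj(2)[OF v(1) vi m]) auto
    also have "\<dots> = (t ^ b) i"
      using b by (simp add: t_def T.comb_power[OF P'] DeMoivre) (simp add: T.comb_def)
    finally show "(t ^ b) i = v i" by simp
  qed
  have t_comm: "x * t = t * x" "x * adj t = adj t * x" if "\<And>i. x i \<in> T.commutant i (P' i ` {..<m})" for x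
  proof -
    have "x i * T.comb {..<m} (P' i) h = T.comb {..<m} (P' i) h * x i" for i h
      using that[of i] by (intro T.comb_commute) (auto simp: T.commutant_def)
    then show "x * t = t * x" "x * adj t = adj t * x"
      by (auto simp: fun_eq_iff t_def T.adj_comb[OF P'])
  qed
  have t_LBd: "t \<in> L.Bd"
    using t_mem tt by (intro L.Bd_unitary)
  have y'_mem: "y' i \<in> T.commutant i (P' i ` {..<m})" for i
    using y'_LBd by (rule L.BdE)
  note y't = t_comm[OF y'_mem]
  define w where "w = y' * adj t"
  have w_LBd: "w \<in> L.Bd"
    using y'_LBd t_LBd by (auto simp: w_def)
  have "w ^ b = y' ^ b * adj t ^ b"
    unfolding w_def by (rule power_mult_commuting) (rule y't)
  also have "\<dots> \<asymp> y ^ b * adj t ^ b"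
    using y y'_Bd y'y LBd[OF t_LBd] by (intro aeq_mult_right aeq_power) auto
  also have "\<dots> \<asymp> v * adj t ^ b"
    using y LBd[OF t_LBd] by (intro aeq_mult_right) auto
  also have "\<dots> = 1"
    by (simp add: v tb flip: adj_power)
  finally have wb: "w ^ b \<asymp> 1" .
  have "adj w * w = t * (adj y' * y') * adj t"
    by (simp add: w_def adj_mult mult.assoc)
  also have "\<dots> \<asymp> t * 1 * adj t"
  proof -
    have "adj y' * y' \<asymp> adj y * y"
      using y y'y y'_Bd by (intro aeq_mult aeq_adj) auto
    also have "\<dots> \<asymp> 1"
      by (rule y)
    finally show ?thesis
      using LBd[OF t_LBd] by (intro aeq_mult_right aeq_mult_left) auto
  qed
  also have "\<dots> = 1"
    by (simp add: tt)
  finally have ww: "adj w * w \<asymp> 1" .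
  obtain u where u: "\<And>i. u i \<in> T.commutant i (P' i ` {..<m})" "adj u * u = 1" "u * adj u = 1" "u ^ b = 1" "u \<asymp> w"
    using L.finite_order_lift[OF w_LBd wb ww b] by blast
  have ut: "u * t = t * u"
    by (rule t_comm[OF u(1)])
  show thesis
  proof (rule that)
    show "(u * t) i \<in> K i" for i
      using u(1)[of i] t_mem[of i] by (simp add: T.commutant_def)
    have "adj (u * t) * (u * t) = adj t * (adj u * u) * t"
      by (simp add: adj_mult mult.assoc)
    then show "adj (u * t) * (u * t) = 1"
      by (simp add: u tt)
    have "(u * t) * adj (u * t) = u * (t * adj t) * adj u"
      by (simp add: adj_mult mult.assoc)
    then show "(u * t) * adj (u * t) = 1"
      by (simp add: u tt)
    show "(u * t) ^ b = v"
      by (simp add: power_mult_commuting[OF ut] u tb)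
    have "u * t \<asymp> w * t"
      using u LBd[OF t_LBd] by (intro aeq_mult_right)
    also have "\<dots> = y'"
      by (simp add: w_def mult.assoc tt)
    also have "\<dots> \<asymp> y"
      by (rule y'y)
    finally show "u * t \<asymp> y" .
  qed
qed

definition unitary_seq :: "(nat \<Rightarrow> 'r) \<Rightarrow> bool" where
  "unitary_seq u \<longleftrightarrow> (\<forall>i. u i \<in> K i) \<and> adj u * u = 1 \<and> u * adj u = 1"

lemma unitary_seq_Bd: "unitary_seq u \<Longrightarrow> u \<in> Bd"
  unfolding unitary_seq_def by (intro Bd_unitary) auto

lemma unitary_seq_mult:
  assumes "unitary_seq u" "unitary_seq v"
  shows "unitary_seq (u * v)"
proof -
  have "adj (u * v) * (u * v) = adj v * (adj u * u) * v" "u * v * adj (u * v) = u * (v * adj v) * adj u"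
    by (simp_all add: adj_mult mult.assoc)
  then show ?thesis
    using assms by (simp add: unitary_seq_def)
qed

lemma unitary_seq_power: "unitary_seq u \<Longrightarrow> unitary_seq (u ^ (n::nat))"
proof (induction n)
  case 0
  have "unitary_seq 1"
    by (simp add: unitary_seq_def)
  then show ?case by (simp only: power_0)
next
  case (Suc n)
  then show ?case by (simp only: power_Suc unitary_seq_mult)
qed

text \<open>The induction also carries the exact relation \<open>u j ^ N j = 1\<close>. As
  \<open>N j = a j * M j\<close>, the element \<open>v = u j ^ a j\<close> has order dividing
  \<open>M j\<close>, so \<open>root_lift\<close> finds an exact root \<open>w\<close> of it near
  \<open>x (Suc j)\<close>; then \<open>w ^ N (Suc j) = v ^ M j = 1\<close>. Generators already
  lifted stay unchanged.\<close>

lemma torsion_chain_lift: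
  assumes x: "\<And>j. j \<in> {1..n} \<Longrightarrow> x j \<in> Bd" "\<And>j. j \<in> {1..n} \<Longrightarrow> adj (x j) * x j \<asymp> 1"
    and rel: "\<And>j. j \<in> {1..<n} \<Longrightarrow> x j ^ a j \<asymp> x (Suc j) ^ b j"
    and x1: "x 1 ^ N 1 \<asymp> 1" "N 1 > 0"
    and N: "\<And>j. j \<in> {1..<n} \<Longrightarrow> N j = a j * M j \<and> N (Suc j) = b j * M j \<and> M j > 0 \<and> b j > 0"
    and n: "n > 0"
  obtains u where "\<And>j. j \<in> {1..n} \<Longrightarrow> unitary_seq (u j) \<and> u j \<asymp> x j"
    "\<And>j. j \<in> {1..<n} \<Longrightarrow> u j ^ a j = u (Suc j) ^ b j"
proof -
  have "\<exists>u. (\<forall>j\<in>{1..m}. unitary_seq (u j) \<and> u j \<asymp> x j \<and> u j ^ N j = 1) \<and>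
      (\<forall>j\<in>{1..<m}. u j ^ a j = u (Suc j) ^ b j)" if "1 \<le> m" "m \<le> n" for m
    using that
  proof (induction m rule: dec_induct)
    case base
    obtain u where "\<And>i. u i \<in> K i" "adj u * u = 1" "u * adj u = 1" "u ^ N 1 = 1" "u \<asymp> x 1"
      using finite_order_lift[OF x(1) x1(1) x(2) x1(2)] n by auto
    then show ?case
      by (intro exI[of _ "\<lambda>_. u"]) (auto simp: unitary_seq_def)
  next
    case (step m)
    have "\<exists>u. (\<forall>j\<in>{1..m}. unitary_seq (u j) \<and> u j \<asymp> x j \<and> u j ^ N j = 1) \<and>
      (\<forall>j\<in>{1..<m}. u j ^ a j = u (Suc j) ^ b j)"
      by (rule step.IH) (use step in auto)
    then obtain u where u: "\<And>j. j \<in> {1..m} \<Longrightarrow> unitary_seq (u j) \<and> u j \<asymp> x j \<and> u j ^ N j = 1"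
      and u_rel: "\<And>j. j \<in> {1..<m} \<Longrightarrow> u j ^ a j = u (Suc j) ^ b j"
      by blast
    have m: "m \<in> {1..<n}" "m \<in> {1..m}" "m \<in> {1..n}" "Suc m \<in> {1..n}"
      using step by auto
    define v where "v = u m ^ a m"
    have v: "unitary_seq v"
      using u[OF m(2)] by (auto simp: v_def intro: unitary_seq_power)
    have vM: "v ^ M m = 1"
      using u[OF m(2)] N[OF m(1)] by (simp add: v_def flip: power_mult)
    have "x (Suc m) ^ b m \<asymp> x m ^ a m"
      by (rule aeq_sym[OF rel[OF m(1)]])
    also have "\<dots> \<asymp> v"
      unfolding v_def using u[OF m(2)] x(1)[OF m(3)] by (intro aeq_power) (auto intro: aeq_sym unitary_seq_Bd)
    finally have xv: "x (Suc m) ^ b m \<asymp> v" .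
    obtain w where w: "\<And>i. w i \<in> K i" "adj w * w = 1" "w * adj w = 1" "w ^ b m = v" "w \<asymp> x (Suc m)"
      using root_lift[OF _ _ _ vM _ _ x(1)[OF m(4)] x(2)[OF m(4)] xv] v N[OF m(1)]
      unfolding unitary_seq_def by blast
    have "w ^ N (Suc m) = 1"
      using N[OF m(1)] w(4) vM by (simp add: power_mult)
    define u' where "u' = u(Suc m := w)"
    have "unitary_seq (u' j) \<and> u' j \<asymp> x j \<and> u' j ^ N j = 1" if "j \<in> {1..Suc m}" for j
    proof (cases "j = Suc m")
      case True
      then have "u' j = w"
        by (simp add: u'_def)
      then show ?thesis
        unfolding unitary_seq_def using w \<open>w ^ N (Suc m) = 1\<close> True by (simp only: simp_thms)
    next
      case False
      then have "u' j = u j" "j \<in> {1..m}"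
        using that by (auto simp: u'_def)
      then show ?thesis
        using u[of j] by (simp only:)
    qed
    moreover have "u' j ^ a j = u' (Suc j) ^ b j" if "j \<in> {1..<Suc m}" for j
    proof (cases "j = m")
      case True
      moreover have "u' m = u m" "u' (Suc m) = w"
        by (simp_all add: u'_def)
      ultimately show ?thesis
        using w(4) by (simp only: v_def)
    next
      case False
      then show ?thesis
        using u_rel[of j] that unfolding u'_def by auto
    qed
    ultimately show ?case by blast
  qed
  note ex = this
  have "1 \<le> n"
    using n by simp
  from ex[OF this order_refl] that show thesis
    by blast
qed

section \<open>Lifting chains of unitaries\<close>

lemma aeq_adj_power_mult:
  fixes n :: nat
  assumes x: "x \<in> Bd" "adj x * x \<asymp> 1"
  shows "adj (x ^ n) * x ^ n \<asymp> 1"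
proof (induction n)
  case 0
  have "adj (1 :: nat \<Rightarrow> 'r) * 1 = 1"
    by simp
  then show ?case
    by (simp only: power_0 aeq_refl)
next
  case (Suc n)
  have "adj (x ^ Suc n) * x ^ Suc n = adj (x ^ n) * (adj x * x) * x ^ n"
    by (simp add: adj_mult mult.assoc)
  also have "\<dots> \<asymp> adj (x ^ n) * 1 * x ^ n"
    using x by (intro aeq_mult_right aeq_mult_left) auto
  also have "adj (x ^ n) * 1 * x ^ n = adj (x ^ n) * x ^ n"
    by simp
  also note Suc
  finally show ?case .
qed

lemma commute_power_aeq:
  fixes n :: nat
  assumes x: "x \<in> Bd" "y \<in> Bd" "x * y \<asymp> y * x"
  shows "x * y ^ n \<asymp> y ^ n * x"
proof (induction n)
  case 0
  show ?case by (simp only: power_0 mult_1_left mult_1_right aeq_refl)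
next
  case (Suc n)
  have "x * y ^ Suc n = (x * y) * y ^ n"
    by (simp add: mult.assoc)
  also have "\<dots> \<asymp> (y * x) * y ^ n"
    using x by (intro aeq_mult_right) auto
  also have "\<dots> = y * (x * y ^ n)"
    by (simp add: mult.assoc)
  also have "\<dots> \<asymp> y * (y ^ n * x)"
    using x Suc by (intro aeq_mult_left)
  also have "\<dots> = y ^ Suc n * x"
    by (simp add: mult.assoc)
  finally show ?case .
qed

text \<open>Moves the values of an almost unitary combination radially onto the unit circle. The
  displacement of a value \<open>l\<close> is \<open>\<bar>l\<bar>^2 - 1\<close> times a factor of
  modulus at most 1, so it is a bounded multiple of the null sequence
  \<open>adj z' * z' - 1\<close>.\<close>

lemma unitary_comb_aeq:
  assumes P: "\<And>i. T.pou i (I i) (P i)" and z: "(\<lambda>i. T.comb (I i) (P i) (f i)) \<in> Bd"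
    and zz: "adj (\<lambda>i. T.comb (I i) (P i) (f i)) * (\<lambda>i. T.comb (I i) (P i) (f i)) \<asymp> 1"
  shows "(\<lambda>i. T.comb (I i) (P i) (f i)) \<asymp> (\<lambda>i. T.comb (I i) (P i) (\<lambda>k. cis (Arg (f i k))))"
proof -
  define z' where "z' = (\<lambda>i. T.comb (I i) (P i) (f i))"
  define u where "u = (\<lambda>i. T.comb (I i) (P i) (\<lambda>k. cis (Arg (f i k))))"
  \<comment> \<open>Off the circle this equals \<open>cis (Arg l) / (cmod l + 1)\<close>; on the
    circle both the displacement and the defect vanish and 0 will do.\<close>
  define h where "h l = (if cmod l = 1 then 0 else (l - cis (Arg l)) / complex_of_real ((cmod l)\<^sup>2 - 1))" for l
  have eq: "l - cis (Arg l) = complex_of_real (cmod l - 1) * cis (Arg l)" for l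
    using rcis_cmod_Arg[of l] by (simp add: rcis_def algebra_simps)
  have h: "h l * (cnj l * l - 1) = l - cis (Arg l)" for l
  proof (cases "cmod l = 1")
    case True
    then show ?thesis by (simp add: h_def eq)
  next
    case False
    then have "(cmod l)\<^sup>2 - 1 \<noteq> 0"
      by (simp add: power2_eq_1_iff) (metis neg_equal_0_iff_equal norm_ge_zero not_one_le_zero le_minus_one_simps(3))
    moreover have "cnj l * l - 1 = complex_of_real ((cmod l)\<^sup>2 - 1)"
      by (simp add: complex_norm_square mult.commute del: of_real_power)
    ultimately show ?thesis
      using False by (simp add: h_def del: of_real_diff of_real_power)
  qed
  have h_bound: "cmod (h l) \<le> 1" for l
  proof (cases "cmod l = 1")
    case False
    have "(cmod l)\<^sup>2 - 1 = (cmod l - 1) * (cmod l + 1)"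
      by (simp add: power2_eq_square algebra_simps)
    then have "cmod (h l) = \<bar>cmod l - 1\<bar> / (\<bar>cmod l - 1\<bar> * \<bar>cmod l + 1\<bar>)"
      using False by (simp only: h_def if_False eq norm_mult norm_divide norm_of_real norm_cis abs_mult mult_1_right)
    also have "\<dots> = 1 / (cmod l + 1)"
      using False by simp
    also have "\<dots> \<le> 1 / 1"
      by (intro divide_left_mono) (auto intro: add_nonneg_pos)
    finally show ?thesis
      by simp
  qed (simp add: h_def)
  define q where "q = (\<lambda>i. T.comb (I i) (P i) (\<lambda>k. h (f i k)))"
  have q: "q \<in> Bd"
    unfolding q_def using h_bound by (intro Bd_comb[OF P])
  have "z' - u = q * (adj z' * z' - 1)"
  proof
    fix i
    have "adj (z' i) * z' i - 1 = T.comb (I i) (P i) (\<lambda>k. cnj (f i k) * f i k - 1)"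
      unfolding z'_def T.adj_comb[OF P] T.comb_mult[OF P] T.comb_one[OF P, of i, symmetric] T.comb_diff ..
    then show "(z' - u) i = (q * (adj z' * z' - 1)) i"
      by (simp add: z'_def u_def q_def T.comb_diff T.comb_mult[OF P] h)
  qed
  moreover have "q * (adj z' * z' - 1) \<asymp> q * (1 - 1)"
    using zz unfolding z'_def[symmetric] by (intro aeq_mult_left q aeq_diff aeq_refl)
  ultimately have "z' - u \<asymp> 0"
    by simp
  then show ?thesis
    by (simp add: aeq_def z'_def u_def)
qed

text \<open>
  The two pinchings are for the real and the imaginary part of \<open>z\<close>; the \<open>w j\<close> are the central
  roots, and the elements of finite order are \<open>y j * adj (w j)\<close>.
\<close>

lemma chain_lift:
  assumes x: "\<And>j. j \<in> {1..n} \<Longrightarrow> x j \<in> Bd" "\<And>j. j \<in> {1..n} \<Longrightarrow> adj (x j) * x j \<asymp> 1"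
      "\<And>j. j \<in> {1..n} \<Longrightarrow> x j * adj (x j) \<asymp> 1"
    and rel: "\<And>j. j \<in> {1..<n} \<Longrightarrow> x j ^ a j \<asymp> x (Suc j) ^ b j"
    and N: "\<And>j. j \<in> {1..<n} \<Longrightarrow> N j = a j * M j \<and> N (Suc j) = b j * M j \<and> M j > 0 \<and> a j > 0 \<and> b j > 0"
    and n: "n > 0" and N1: "N 1 > 0"
  obtains u where "\<And>j. j \<in> {1..n} \<Longrightarrow> unitary_seq (u j) \<and> u j \<asymp> x j"
    "\<And>j. j \<in> {1..<n} \<Longrightarrow> u j ^ a j = u (Suc j) ^ b j"
proof -
  have one: "1 \<in> {1..n}"
    using n by simp
  define z where "z = x 1 ^ N 1"
  have z_Bd: "z \<in> Bd"
    unfolding z_def by (intro Bd_power x one)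
  have xz: "x j ^ N j \<asymp> z" if "j \<in> {1..n}" for j
  proof -
    have "1 \<le> j \<Longrightarrow> j \<le> n \<Longrightarrow> x j ^ N j \<asymp> z" for j
    proof (induction j rule: dec_induct)
      case base
      show ?case by (simp only: z_def aeq_refl)
    next
      case (step j)
      then have j: "j \<in> {1..<n}" "j \<in> {1..n}" "Suc j \<in> {1..n}"
        by auto
      have "x (Suc j) ^ N (Suc j) = (x (Suc j) ^ b j) ^ M j"
        using N[OF j(1)] by (simp only: power_mult)
      also have "\<dots> \<asymp> (x j ^ a j) ^ M j"
        using x(1)[OF j(2)] x(1)[OF j(3)] by (intro aeq_power aeq_sym[OF rel[OF j(1)]]) auto
      also have "\<dots> = x j ^ N j"
        using N[OF j(1)] by (simp only: power_mult)
      also have "x j ^ N j \<asymp> z"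
        by (rule step.IH) (use step in auto)
      finally show ?case .
    qed
    then show ?thesis using that by auto
  qed
  have zz: "adj z * z \<asymp> 1"
    unfolding z_def by (rule aeq_adj_power_mult) (use x one in auto)
  have xzc: "x j * z \<asymp> z * x j" if j: "j \<in> {1..n}" for j
  proof -
    have "x j * z \<asymp> x j * x j ^ N j"
      using x(1)[OF j] xz[OF j] by (intro aeq_mult_left) (auto intro: aeq_sym)
    also have "\<dots> = x j ^ N j * x j"
      by (simp only: power_commutes)
    also have "\<dots> \<asymp> z * x j"
      using x(1)[OF j] xz[OF j] by (intro aeq_mult_right) auto
    finally show ?thesis .
  qed
  \<comment> \<open>Commutation with \<open>adj z\<close> does not follow from commutation with
    \<open>z\<close>; it uses that \<open>x j\<close> commutes with its own adjoint up to null
    sequences, and that \<open>adj z\<close> is equivalent to a power of this adjoint.\<close>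
  have xzc': "x j * adj z \<asymp> adj z * x j" if j: "j \<in> {1..n}" for j
  proof -
    have "x j * adj (x j) \<asymp> adj (x j) * x j"
      using x(2)[OF j] x(3)[OF j] by (blast intro: aeq_trans aeq_sym)
    then have *: "x j * adj (x j) ^ N j \<asymp> adj (x j) ^ N j * x j"
      using x(1)[OF j] by (intro commute_power_aeq) auto
    have adj_z: "adj z \<asymp> adj (x j) ^ N j"
      using aeq_adj[OF aeq_sym[OF xz[OF j]]] by (simp only: adj_power)
    have "x j * adj z \<asymp> x j * adj (x j) ^ N j"
      using x(1)[OF j] adj_z by (intro aeq_mult_left)
    also note *
    also have "adj (x j) ^ N j * x j \<asymp> adj z * x j"
      using x(1)[OF j] aeq_sym[OF adj_z] by (intro aeq_mult_right)
    finally show ?thesis .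
  qed
  have zzc: "z * adj z \<asymp> adj z * z"
  proof -
    have "adj z * x 1 ^ N 1 \<asymp> x 1 ^ N 1 * adj z"
      using z_Bd x(1)[OF one] aeq_sym[OF xzc'[OF one]] by (intro commute_power_aeq) auto
    then show ?thesis
      by (simp only: z_def aeq_sym)
  qed
  define c where "c = (1/2) *\<^sub>c (z + adj z)"
  define s where "s = (1/2) *\<^sub>c (\<i> *\<^sub>c (adj z - z))"
  have cs_Bd: "c \<in> Bd" "s \<in> Bd"
    using z_Bd by (auto simp: c_def s_def)
  have cs_adj: "adj c = c" "adj s = s"
    by (simp_all add: c_def s_def adj_simps add.commute csc.scale_right_diff_distrib)
  have z_cs: "z = c + \<i> *\<^sub>c s"
  proof -
    have "c + \<i> *\<^sub>c s = (1/2) *\<^sub>c (z + z)"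
      by (simp add: c_def s_def csc.scale_right_distrib csc.scale_right_diff_distrib csc.scale_minus_left)
    then show ?thesis
      by (simp add: csc.scale_right_distrib csc_half)
  qed
  have xc: "x j * c \<asymp> c * x j" and xs: "x j * s \<asymp> s * x j" if j: "j \<in> {1..n}" for j
    using xzc[OF j] xzc'[OF j]
    by (simp_all only: c_def s_def csc_mult_left csc_mult_right distrib_left distrib_right
        left_diff_distrib right_diff_distrib aeq_csc aeq_add aeq_diff)
  have cs: "c * s \<asymp> s * c"
  proof -
    have "c * (adj z - z) \<asymp> (adj z - z) * c"
    proof -
      have "c * adj z \<asymp> adj z * c"
        using zzc by (simp only: c_def csc_mult_left csc_mult_right distrib_left distrib_right aeq_csc aeq_add aeq_refl)
      moreover have "c * z \<asymp> z * c"
        using aeq_sym[OF zzc] by (simp only: c_def csc_mult_left csc_mult_right distrib_left distrib_right aeq_csc aeq_add aeq_refl)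
      ultimately show ?thesis
        by (simp only: left_diff_distrib right_diff_distrib aeq_diff)
    qed
    then show ?thesis
      by (simp only: s_def csc_mult_left csc_mult_right aeq_csc)
  qed
  define Y where "Y j = (if j = 0 then s else x j)" for j :: nat
  have Y_Bd: "Y j \<in> Bd" if "j \<in> {0..n}" for j
    using that cs_Bd x(1) by (auto simp: Y_def)
  have cY: "c * Y j \<asymp> Y j * c" if "j \<in> {0..n}" for j
    using that cs xc by (auto simp: Y_def intro: aeq_sym)
  obtain I :: "nat \<Rightarrow> int set" and E g where E: "\<And>i. T.pou i (I i) (E i)"
    and c': "(\<lambda>i. T.comb (I i) (E i) (\<lambda>k. complex_of_real (g i k))) \<in> Bd"
      "c \<asymp> (\<lambda>i. T.comb (I i) (E i) (\<lambda>k. complex_of_real (g i k)))"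
    and Y: "\<And>j. j \<in> {0..n} \<Longrightarrow> Y j \<asymp> (\<lambda>i. T.pinch (I i) (E i) (Y j i))"
    using pinch_sequence[where a = c and J = "{0..n}" and Y = Y, OF cs_Bd(1) cs_adj(1) finite_atLeastAtMost Y_Bd cY]
    by blast
  define x' where "x' j = (\<lambda>i. T.pinch (I i) (E i) (x j i))" for j
  define s' where "s' = (\<lambda>i. T.pinch (I i) (E i) (s i))"
  have xx': "x j \<asymp> x' j" if "j \<in> {1..n}" for j
    using Y[of j] that by (simp add: Y_def x'_def)
  have ss': "s \<asymp> s'"
    using Y[of 0] by (simp add: Y_def s'_def)
  interpret L: tracial_sequence \<tau> F "\<lambda>i. T.commutant i (E i ` I i)" nrm \<delta>
    by (rule tracial_sequence_commutant[OF E])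
  have L_Bd: "y \<in> Bd" if "y \<in> L.Bd" for y
    using Bd_commutant[OF L.tracial_sequence_axioms] that by auto
  have x'_LBd: "x' j \<in> L.Bd" if "j \<in> {1..n}" for j
    unfolding x'_def by (rule pinch_Bd[OF E x(1)[OF that]])
  have s'_LBd: "s' \<in> L.Bd"
    unfolding s'_def by (rule pinch_Bd[OF E cs_Bd(2)])
  have s'_adj: "adj s' = s'"
    using cs_adj(2) by (auto simp: fun_eq_iff s'_def T.adj_pinch[OF E])
  have x's': "s' * x' j \<asymp> x' j * s'" if j: "j \<in> {1..n}" for j
  proof -
    have "s' * x' j \<asymp> s * x j"
      using x(1)[OF j] cs_Bd xx'[OF j] ss' L_Bd[OF x'_LBd[OF j]] by (intro aeq_mult) (auto intro: aeq_sym)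
    also have "\<dots> \<asymp> x j * s"
      by (rule aeq_sym[OF xs[OF j]])
    also have "\<dots> \<asymp> x' j * s'"
      using cs_Bd xx'[OF j] ss' L_Bd[OF x'_LBd[OF j]] by (intro aeq_mult)
    finally show ?thesis .
  qed
  obtain J :: "nat \<Rightarrow> int set" and G h where G: "\<And>i. L.T.pou i (J i) (G i)"
    and s'': "(\<lambda>i. T.comb (J i) (G i) (\<lambda>k. complex_of_real (h i k))) \<in> L.Bd"
      "s' \<asymp> (\<lambda>i. T.comb (J i) (G i) (\<lambda>k. complex_of_real (h i k)))"
    and x'': "\<And>j. j \<in> {1..n} \<Longrightarrow> x' j \<asymp> (\<lambda>i. T.pinch (J i) (G i) (x' j i))"
    using L.pinch_sequence[where a = s' and J = "{1..n}" and Y = x', OF s'_LBd s'_adj finite_atLeastAtMost x'_LBd x's']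
    by blast
  interpret R: tracial_sequence \<tau> F "\<lambda>i. L.T.commutant i (G i ` J i)" nrm \<delta>
    by (rule L.tracial_sequence_commutant[OF G])
  have R_Bd: "y \<in> Bd" if "y \<in> R.Bd" for y
    using L.Bd_commutant[OF R.tracial_sequence_axioms] that L_Bd by auto
  define y where "y j = (\<lambda>i. T.pinch (J i) (G i) (x' j i))" for j
  have y_RBd: "y j \<in> R.Bd" if "j \<in> {1..n}" for j
    unfolding y_def by (rule L.pinch_Bd[OF G x'_LBd[OF that]])
  have yx: "y j \<asymp> x j" if "j \<in> {1..n}" for j
    using x''[OF that] xx'[OF that] unfolding y_def[symmetric] by (blast intro: aeq_trans aeq_sym)
  have EL: "E i k \<in> T.commutant i (E i ` I i)" if "k \<in> I i" for i k
    using that T.pouD[OF E] by (auto simp: T.commutant_def)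
  have GL: "G i l \<in> T.commutant i (E i ` I i)" if "l \<in> J i" for i l
    using that L.T.pouD(3)[OF G] by auto
  have EG: "E i k * G i l = G i l * E i k" if "k \<in> I i" "l \<in> J i" for i k l
    using GL[OF that(2)] that(1) by (auto simp: T.commutant_def)
  \<comment> \<open>The \<open>G i l\<close> come from the commutant of the \<open>E i k\<close>, so
    the two families commute and both lie in the second commutant, where they are central.\<close>
  have E_R: "R.T.pou i (I i) (E i)" for i
    using T.pouD[OF E] EL EG unfolding R.T.pou_def
    by (auto simp: L.T.commutant_def T.pouD(7)[OF E])
  have G_R: "R.T.pou i (J i) (G i)" for i
  proof -
    have "G i l \<in> L.T.commutant i (G i ` J i)" if "l \<in> J i" for l
      using that GL L.T.pouD(7)[OF G] by (auto simp: L.T.commutant_def)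
    then show ?thesis
      using L.T.pouD[OF G] unfolding R.T.pou_def by auto
  qed
  define I' where "I' i = I i \<times> J i" for i
  define Q where "Q i = (\<lambda>(k, l). E i k * G i l)" for i
  have Q: "R.T.pou i (I' i) (Q i)" for i
    unfolding I'_def Q_def by (rule R.T.pou_product(1)[OF E_R G_R EG])
  define f where "f i = (\<lambda>(k, l). complex_of_real (g i k) + \<i> * complex_of_real (h i l))" for i
  define z' where "z' = (\<lambda>i. T.comb (I' i) (Q i) (f i))"
  have z'_cs: "z' = (\<lambda>i. T.comb (I i) (E i) (\<lambda>k. complex_of_real (g i k)))
      + \<i> *\<^sub>c (\<lambda>i. T.comb (J i) (G i) (\<lambda>k. complex_of_real (h i k)))"
  proof
    fix i
    have 1: "T.comb (I i) (E i) (\<lambda>k. complex_of_real (g i k)) = T.comb (I' i) (Q i) (\<lambda>(k, l). complex_of_real (g i k))"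
      unfolding I'_def Q_def by (rule R.T.pou_product(2)[OF E_R G_R EG, symmetric])
    have 2: "T.comb (J i) (G i) (\<lambda>k. complex_of_real (h i k)) = T.comb (I' i) (Q i) (\<lambda>(k, l). complex_of_real (h i l))"
      unfolding I'_def Q_def by (rule R.T.pou_product(3)[OF E_R G_R EG, symmetric])
    show "z' i = ((\<lambda>i. T.comb (I i) (E i) (\<lambda>k. complex_of_real (g i k)))
      + \<i> *\<^sub>c (\<lambda>i. T.comb (J i) (G i) (\<lambda>k. complex_of_real (h i k)))) i"
      by (simp add: z'_def 1 2 T.comb_csc T.comb_add f_def case_prod_unfold)
  qed
  have zz': "z \<asymp> z'"
  proof -
    have "s \<asymp> (\<lambda>i. T.comb (J i) (G i) (\<lambda>k. complex_of_real (h i k)))"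
      using ss' s''(2) by (rule aeq_trans)
    then show ?thesis
      unfolding z'_cs by (subst z_cs) (intro aeq_add aeq_csc c'(2))
  qed
  have z'_Bd: "z' \<in> Bd"
    unfolding z'_cs using c'(1) L_Bd[OF s''(1)] by auto
  have R_comb_Bd: "(\<lambda>i. T.comb (I' i) (Q i) (h' i)) \<in> R.Bd" if "\<And>i k. cmod (h' i k) \<le> 1" for h'
    using that by (intro R.Bd_comb[OF Q])
  have z'_RBd: "z' \<in> R.Bd"
  proof -
    obtain C where "\<And>i. nrm i (z' i) \<le> C"
      using BdE[OF z'_Bd] by metis
    then show ?thesis
      using Q by (intro R.BdI) (auto simp: z'_def)
  qed
  have z'z': "adj z' * z' \<asymp> 1"
  proof -
    have "adj z' * z' \<asymp> adj z * z"
      using z_Bd z'_Bd zz' by (intro aeq_mult aeq_adj) (auto intro: aeq_sym)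
    then show ?thesis
      using zz by (rule aeq_trans)
  qed
  define \<theta> where "\<theta> i k = Arg (f i k)" for i k
  define v where "v = (\<lambda>i. T.comb (I' i) (Q i) (\<lambda>k. cis (\<theta> i k)))"
  have zv: "z \<asymp> v"
  proof -
    have "z' \<asymp> v"
      unfolding z'_def v_def \<theta>_def
      by (rule R.unitary_comb_aeq[OF Q]) (use z'_RBd z'z' in \<open>simp_all add: z'_def\<close>)
    then show ?thesis
      by (rule aeq_trans[OF zz'])
  qed
  \<comment> \<open>All these roots use the same argument \<open>\<theta>\<close>; with
    \<open>N j = a j * M j\<close> and \<open>N (Suc j) = b j * M j\<close>, both sides of the chain
    relation have angle \<open>\<theta> / M j\<close>.\<close>
  define w where "w j = (\<lambda>i. T.comb (I' i) (Q i) (\<lambda>k. cis (\<theta> i k / N j)))" for j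
  have w_unitary: "R.unitary_seq (w j)" for j
    using Q by (auto simp: R.unitary_seq_def w_def fun_eq_iff R.T.adj_comb[OF Q] R.T.comb_mult[OF Q]
        R.T.comb_one[OF Q] cis_cnj cis_mult)
  have w_power: "w j ^ k = (\<lambda>i. T.comb (I' i) (Q i) (\<lambda>l. cis (k * (\<theta> i l / N j))))" for j and k :: nat
    by (simp add: fun_eq_iff w_def R.T.comb_power[OF Q] DeMoivre)
  have w_N: "w 1 ^ N 1 = v"
    unfolding w_power v_def using N1 by simp
  have w_rel: "w j ^ a j = w (Suc j) ^ b j" if "j \<in> {1..<n}" for j
  proof -
    have "a j * (t / N j) = b j * (t / N (Suc j))" for t :: real
      using N[OF that] by (simp add: field_simps)
    then show ?thesis
      unfolding w_power by simp
  qed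
  have comm: "p * w j = w j * p" "p * adj (w j) = adj (w j) * p" if "\<And>i. p i \<in> L.T.commutant i (G i ` J i)" for p j
  proof -
    have "p i * Q i k = Q i k * p i" if k: "k \<in> I' i" for i k
    proof -
      obtain k1 k2 where k12: "k = (k1, k2)" "k1 \<in> I i" "k2 \<in> J i"
        using k by (auto simp: I'_def)
      have "p i * E i k1 = E i k1 * p i" "p i * G i k2 = G i k2 * p i"
        using k12 L.T.commutantD[OF \<open>\<And>i. p i \<in> L.T.commutant i (G i ` J i)\<close>[of i]]
          T.commutantD(1)[of "p i" i "E i ` I i" "E i k1"] by auto
      then show ?thesis
        by (simp add: Q_def k12) (metis mult.assoc)
    qed
    then have "p i * T.comb (I' i) (Q i) h' = T.comb (I' i) (Q i) h' * p i" for i h'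
      by (rule T.comb_commute)
    then show "p * w j = w j * p" "p * adj (w j) = adj (w j) * p"
      by (auto simp: fun_eq_iff w_def R.T.adj_comb[OF Q])
  qed
  \<comment> \<open>Dividing by the central root keeps the chain relations, since the
    \<open>w j\<close> satisfy them exactly, and turns \<open>z\<close> into 1.\<close>
  define r where "r j = y j * adj (w j)" for j
  have ww: "adj (w j) * w j = 1" "w j * adj (w j) = 1" for j
    using w_unitary by (auto simp: R.unitary_seq_def)
  have w_RBd: "w j \<in> R.Bd" for j
    using w_unitary by (rule R.unitary_seq_Bd)
  have r_RBd: "r j \<in> R.Bd" if "j \<in> {1..n}" for j
    unfolding r_def using y_RBd[OF that] w_RBd by blast
  have y_mem: "y j i \<in> L.T.commutant i (G i ` J i)" if "j \<in> {1..n}" for i j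
    using y_RBd[OF that] by (rule R.BdE)
  have r_power: "r j ^ k = y j ^ k * adj (w j ^ k)" if "j \<in> {1..n}" for j and k :: nat
    unfolding r_def adj_power using comm(2)[OF y_mem[OF that]] by (rule power_mult_commuting)
  have w_power_Bd: "adj (w j ^ k) \<in> Bd" for j and k :: nat
    using R_Bd[OF w_RBd] by auto
  have r1: "r 1 ^ N 1 \<asymp> 1"
  proof -
    have "r 1 ^ N 1 = y 1 ^ N 1 * adj v"
      by (simp only: r_power[OF one] w_N)
    also have "\<dots> \<asymp> x 1 ^ N 1 * adj v"
      using x(1)[OF one] R_Bd[OF y_RBd[OF one]] yx[OF one] w_power_Bd[of 1 "N 1"] unfolding w_N
      by (intro aeq_mult_right aeq_power)
    also have "\<dots> \<asymp> v * adj v"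
      using zv w_power_Bd[of 1 "N 1"] unfolding w_N z_def[symmetric] by (intro aeq_mult_right)
    also have "\<dots> = 1"
      using R.unitary_seq_power[OF w_unitary, of 1 "N 1"] unfolding w_N R.unitary_seq_def by blast
    finally show ?thesis .
  qed
  have r_rel: "r j ^ a j \<asymp> r (Suc j) ^ b j" if j: "j \<in> {1..<n}" for j
  proof -
    have j': "j \<in> {1..n}" "Suc j \<in> {1..n}"
      using j by auto
    have "y j ^ a j \<asymp> x j ^ a j"
      using x(1)[OF j'(1)] R_Bd[OF y_RBd[OF j'(1)]] yx[OF j'(1)] by (intro aeq_power)
    also note rel[OF j]
    also have "x (Suc j) ^ b j \<asymp> y (Suc j) ^ b j"
      using x(1)[OF j'(2)] R_Bd[OF y_RBd[OF j'(2)]] aeq_sym[OF yx[OF j'(2)]] by (intro aeq_power)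
    finally show ?thesis
      unfolding r_power[OF j'(1)] r_power[OF j'(2)] w_rel[OF j]
      by (intro aeq_mult_right w_power_Bd)
  qed
  have rr: "adj (r j) * r j \<asymp> 1" if j: "j \<in> {1..n}" for j
  proof -
    have "adj (y j) * y j \<asymp> adj (x j) * x j"
      using x(1)[OF j] R_Bd[OF y_RBd[OF j]] yx[OF j] by (intro aeq_mult aeq_adj) auto
    also note x(2)[OF j]
    finally have "w j * (adj (y j) * y j) * adj (w j) \<asymp> w j * 1 * adj (w j)"
      using R_Bd[OF w_RBd] by (intro aeq_mult_right aeq_mult_left) auto
    then show ?thesis
      by (simp add: r_def adj_mult mult.assoc ww)
  qed
  obtain u where u: "\<And>j. j \<in> {1..n} \<Longrightarrow> R.unitary_seq (u j) \<and> u j \<asymp> r j"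
    and u_rel: "\<And>j. j \<in> {1..<n} \<Longrightarrow> u j ^ a j = u (Suc j) ^ b j"
    using R.torsion_chain_lift[where x = r and n = n and a = a and b = b and N = N and M = M,
        OF r_RBd rr r_rel r1 N1 _ n] N by blast
  have u_mem: "u j i \<in> L.T.commutant i (G i ` J i)" if "j \<in> {1..n}" for i j
    using u[OF that] by (auto simp: R.unitary_seq_def)
  have uw_power: "(u j * w j) ^ k = u j ^ k * w j ^ k" if "j \<in> {1..n}" for j and k :: nat
    using comm(1)[OF u_mem[OF that]] by (rule power_mult_commuting)
  show thesis
  proof (rule that[of "\<lambda>j. u j * w j"])
    fix j assume j: "j \<in> {1..n}"
    have "R.unitary_seq (u j * w j)"
      using u[OF j] w_unitary by (intro R.unitary_seq_mult) auto
    then have "unitary_seq (u j * w j)"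
      unfolding R.unitary_seq_def unitary_seq_def by (blast dest: L.T.commutantD(2) T.commutantD(2))
    moreover have "u j * w j \<asymp> x j"
    proof -
      have "u j * w j \<asymp> r j * w j"
        using u[OF j] R_Bd[OF w_RBd] by (intro aeq_mult_right) auto
      also have "\<dots> = y j"
        by (simp add: r_def mult.assoc ww)
      also have "\<dots> \<asymp> x j"
        by (rule yx[OF j])
      finally show ?thesis .
    qed
    ultimately show "unitary_seq (u j * w j) \<and> u j * w j \<asymp> x j" ..
  next
    fix j assume j: "j \<in> {1..<n}"
    then have j': "j \<in> {1..n}" "Suc j \<in> {1..n}"
      by auto
    show "(u j * w j) ^ a j = (u (Suc j) * w (Suc j)) ^ b j"
      by (simp only: uw_power[OF j'(1)] uw_power[OF j'(2)] u_rel[OF j] w_rel[OF j])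
  qed
qed

end

section \<open>Embedding carrier-based algebras into a star algebra\<close>

context unital_cstar_algebra
begin

declare scale_closed [simp, intro] star_closed [simp, intro]

lemma star_one [simp]: "star A \<one> = \<one>"
  by (metis one_closed r_one star_closed star_mult star_star)

lemma scale_zero_left [simp]: "x \<in> carrier A \<Longrightarrow> 0 \<odot> x = \<zero>"
  using scale_add_left[of x 0 0] by (metis add.r_cancel_one' add_0 scale_closed)

lemma cnorm_one: "cnorm A \<one> \<le> 1"
  using cstar_identity[of \<one>] cnorm_nonneg[of \<one>] by (auto simp: power2_eq_square)

end

text \<open>
  No type can depend on the algebra, so all unital C*-algebras on the type \<^typ>\<open>'a\<close> are put into
  one product, with an additional factor of complex numbers to ensure \<open>0 \<noteq> 1\<close>. A single algebra
  \<open>A\<close> corresponds to the families whose other components are the scalar in that factor: this is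
  the direct sum of \<open>A\<close> and the complex numbers, with the same unit as the whole product.
\<close>

typedef 'a fam = "{(c :: complex, x :: 'a cstar \<Rightarrow> 'a).
  \<forall>A. if unital_cstar_algebra A then x A \<in> carrier A else x A = undefined}"
proof -
  have "(0, \<lambda>A. if unital_cstar_algebra A then \<zero>\<^bsub>A\<^esub> else undefined) \<in> {(c :: complex, x :: 'a cstar \<Rightarrow> 'a).
    \<forall>A. if unital_cstar_algebra A then x A \<in> carrier A else x A = undefined}"
    by (auto simp: unital_cstar_algebra_def ring.ring_simprules)
  then show ?thesis by (rule exI)
qed

definition sc :: "'a fam \<Rightarrow> complex" where "sc x = fst (Rep_fam x)"

definition ev :: "'a cstar \<Rightarrow> 'a fam \<Rightarrow> 'a" where "ev A x = snd (Rep_fam x) A"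

definition mk :: "complex \<Rightarrow> ('a cstar \<Rightarrow> 'a) \<Rightarrow> 'a fam" where
  "mk c f = Abs_fam (c, \<lambda>A. if unital_cstar_algebra A then f A else undefined)"

lemma ev_closed [simp, intro]: "unital_cstar_algebra A \<Longrightarrow> ev A x \<in> carrier A"
  using Rep_fam[of x] by (auto simp: ev_def case_prod_beta split: if_splits)

lemma fam_eqI:
  assumes "sc x = sc y" "\<And>A. unital_cstar_algebra A \<Longrightarrow> ev A x = ev A y"
  shows "x = y"
proof -
  have "snd (Rep_fam x) A = snd (Rep_fam y) A" for A
    using Rep_fam[of x] Rep_fam[of y] assms(2)[of A]
    by (cases "unital_cstar_algebra A") (auto simp: ev_def case_prod_beta)
  then show ?thesis
    using assms(1) by (simp add: sc_def Rep_fam_inject[symmetric] prod_eq_iff fun_eq_iff)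
qed

lemma mk:
  assumes "\<And>A. unital_cstar_algebra A \<Longrightarrow> f A \<in> carrier A"
  shows "sc (mk c f) = c" "unital_cstar_algebra A \<Longrightarrow> ev A (mk c f) = f A"
  using assms by (simp_all add: sc_def ev_def mk_def Abs_fam_inverse)

instantiation fam :: (type) star_algebra
begin

definition "0 = mk 0 (\<lambda>A. \<zero>\<^bsub>A\<^esub>)"
definition "1 = mk 1 (\<lambda>A. \<one>\<^bsub>A\<^esub>)"
definition "x + y = mk (sc x + sc y) (\<lambda>A. ev A x \<oplus>\<^bsub>A\<^esub> ev A y)"
definition "x - y = mk (sc x - sc y) (\<lambda>A. ev A x \<ominus>\<^bsub>A\<^esub> ev A y)"
definition "- x = mk (- sc x) (\<lambda>A. \<ominus>\<^bsub>A\<^esub> ev A x)"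
definition "x * y = mk (sc x * sc y) (\<lambda>A. ev A x \<otimes>\<^bsub>A\<^esub> ev A y)"
definition "c *\<^sub>c x = mk (c * sc x) (\<lambda>A. c \<odot>\<^bsub>A\<^esub> ev A x)"
definition "adj x = mk (cnj (sc x)) (\<lambda>A. star A (ev A x))"

lemma cstar_ring: "unital_cstar_algebra A \<Longrightarrow> ring A"
  by (simp add: unital_cstar_algebra_def)

lemma sc_simps [simp]:
  fixes x y :: "'a fam"
  shows "sc (0 :: 'a fam) = 0" "sc (1 :: 'a fam) = 1" "sc (x + y) = sc x + sc y" "sc (x - y) = sc x - sc y"
    "sc (- x) = - sc x" "sc (x * y) = sc x * sc y" "sc (c *\<^sub>c x) = c * sc x" "sc (adj x) = cnj (sc x)"
  unfolding zero_fam_def one_fam_def plus_fam_def minus_fam_def uminus_fam_def times_fam_def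
    csc_fam_def adj_fam_def
  by (subst mk(1); auto simp: ring.ring_simprules[OF cstar_ring] unital_cstar_algebra.scale_closed
      unital_cstar_algebra.star_closed)+

lemma ev_simps [simp]:
  fixes x y :: "'a fam"
  assumes "unital_cstar_algebra A"
  shows "ev A 0 = \<zero>\<^bsub>A\<^esub>" "ev A 1 = \<one>\<^bsub>A\<^esub>" "ev A (x + y) = ev A x \<oplus>\<^bsub>A\<^esub> ev A y"
    "ev A (x - y) = ev A x \<ominus>\<^bsub>A\<^esub> ev A y" "ev A (- x) = \<ominus>\<^bsub>A\<^esub> ev A x"
    "ev A (x * y) = ev A x \<otimes>\<^bsub>A\<^esub> ev A y" "ev A (c *\<^sub>c x) = c \<odot>\<^bsub>A\<^esub> ev A x" "ev A (adj x) = star A (ev A x)"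
  unfolding zero_fam_def one_fam_def plus_fam_def minus_fam_def uminus_fam_def times_fam_def
    csc_fam_def adj_fam_def
  by (subst mk(2); auto simp: ring.ring_simprules[OF cstar_ring] unital_cstar_algebra.scale_closed
      unital_cstar_algebra.star_closed assms)+

instance
proof
  fix x y z :: "'a fam" and c d :: complex
  note A = unital_cstar_algebra.scale_closed unital_cstar_algebra.star_closed
    ring.ring_simprules[OF cstar_ring] monoid.r_one[OF ring.is_monoid[OF cstar_ring]]
  show "x + y + z = x + (y + z)" "x + y = y + x" "0 + x = x" "- x + x = 0" "x - y = x + - y"
    "x * y * z = x * (y * z)" "1 * x = x" "x * 1 = x" "(x + y) * z = x * z + y * z" "x * (y + z) = x * y + x * z"
    by (rule fam_eqI; simp add: A algebra_simps)+
  show "(0 :: 'a fam) \<noteq> 1"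
    by (metis sc_simps(1,2) zero_neq_one)
  show "(c + d) *\<^sub>c x = c *\<^sub>c x + d *\<^sub>c x" "c *\<^sub>c (x + y) = c *\<^sub>c x + c *\<^sub>c y" "c *\<^sub>c (d *\<^sub>c x) = (c * d) *\<^sub>c x"
    "1 *\<^sub>c x = x" "(c *\<^sub>c x) * y = c *\<^sub>c (x * y)" "x * (c *\<^sub>c y) = c *\<^sub>c (x * y)"
    "adj (adj x) = x" "adj (x + y) = adj x + adj y" "adj (c *\<^sub>c x) = cnj c *\<^sub>c adj x" "adj (x * y) = adj y * adj x"
    by (rule fam_eqI; simp add: unital_cstar_algebra.scale_add_left unital_cstar_algebra.scale_add_right
        unital_cstar_algebra.scale_scale unital_cstar_algebra.scale_one unital_cstar_algebra.scale_mult_left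
        unital_cstar_algebra.scale_mult_right unital_cstar_algebra.star_star unital_cstar_algebra.star_add
        unital_cstar_algebra.star_scale unital_cstar_algebra.star_mult algebra_simps)+
qed

end

lemma ev_power: "unital_cstar_algebra A \<Longrightarrow> ev A (x ^ n) = ev A x [^]\<^bsub>A\<^esub> n"
  by (induction n) (simp_all add: monoid.nat_pow_0 monoid.nat_pow_Suc ring.is_monoid[OF cstar_ring] power_Suc2
      del: power_Suc)

definition fam_algebra :: "'a cstar \<Rightarrow> 'a fam set" where
  "fam_algebra A = {x. \<forall>B. unital_cstar_algebra B \<and> B \<noteq> A \<longrightarrow> ev B x = sc x \<odot>\<^bsub>B\<^esub> \<one>\<^bsub>B\<^esub>}"

text \<open>The norm of the direct sum with the complex numbers. The scalar factor gives the unit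
  norm 1 even when \<open>A\<close> is the zero algebra.\<close>

definition fam_norm :: "'a cstar \<Rightarrow> 'a fam \<Rightarrow> real" where
  "fam_norm A x = max (cmod (sc x)) (cnorm A (ev A x))"

definition fam_of :: "'a cstar \<Rightarrow> complex \<Rightarrow> 'a \<Rightarrow> 'a fam" where
  "fam_of A c y = mk c (\<lambda>B. if B = A then y else c \<odot>\<^bsub>B\<^esub> \<one>\<^bsub>B\<^esub>)"

lemma fam_of:
  assumes "unital_cstar_algebra A" "y \<in> carrier A"
  shows "fam_of A c y \<in> fam_algebra A" "sc (fam_of A c y) = c" "ev A (fam_of A c y) = y"
proof -
  have *: "(if B = A then y else c \<odot>\<^bsub>B\<^esub> \<one>\<^bsub>B\<^esub>) \<in> carrier B" if "unital_cstar_algebra B" for B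
    using assms that by (auto simp: unital_cstar_algebra.scale_closed ring.ring_simprules[OF cstar_ring])
  show "fam_of A c y \<in> fam_algebra A" "sc (fam_of A c y) = c" "ev A (fam_of A c y) = y"
    by (auto simp: fam_of_def fam_algebra_def mk[OF *] assms)
qed

lemma fam_algebra_eqI:
  assumes "x \<in> fam_algebra A" "y \<in> fam_algebra A" "sc x = sc y" "ev A x = ev A y"
  shows "x = y"
  using assms by (intro fam_eqI) (auto simp: fam_algebra_def, metis)

lemma cstar_fam_algebra:
  assumes "unital_cstar_algebra A"
  shows "cstar (fam_algebra A) (fam_norm A)"
proof -
  interpret A: unital_cstar_algebra A
    by (rule assms)
  show ?thesis
  proof
    fix x y :: "'a fam" and c :: complex
    show "1 \<in> fam_algebra A"
      by (auto simp: fam_algebra_def unital_cstar_algebra.scale_one ring.ring_simprules[OF cstar_ring])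
    show "x + y \<in> fam_algebra A" if "x \<in> fam_algebra A" "y \<in> fam_algebra A"
      using that by (auto simp: fam_algebra_def unital_cstar_algebra.scale_add_left ring.ring_simprules[OF cstar_ring])
    show "x * y \<in> fam_algebra A" if "x \<in> fam_algebra A" "y \<in> fam_algebra A"
      using that by (auto simp: fam_algebra_def unital_cstar_algebra.scale_mult_left unital_cstar_algebra.scale_scale
          unital_cstar_algebra.scale_closed ring.ring_simprules[OF cstar_ring])
    show "c *\<^sub>c x \<in> fam_algebra A" if "x \<in> fam_algebra A"
      using that by (auto simp: fam_algebra_def unital_cstar_algebra.scale_scale ring.ring_simprules[OF cstar_ring])
    show "adj x \<in> fam_algebra A" if "x \<in> fam_algebra A"
      using that by (auto simp: fam_algebra_def unital_cstar_algebra.star_scale unital_cstar_algebra.star_one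
          ring.ring_simprules[OF cstar_ring])
    show "fam_norm A (x + y) \<le> fam_norm A x + fam_norm A y"
      using norm_triangle_ineq[of "sc x" "sc y"] A.cnorm_triangle[of "ev A x" "ev A y"] assms
      by (simp add: fam_norm_def) linarith
    show "fam_norm A (c *\<^sub>c x) = cmod c * fam_norm A x"
      using assms by (simp add: fam_norm_def norm_mult A.cnorm_scale max_mult_distrib_left)
    show "fam_norm A (x * y) \<le> fam_norm A x * fam_norm A y"
    proof -
      have "cmod (sc x * sc y) \<le> fam_norm A x * fam_norm A y"
        unfolding norm_mult fam_norm_def by (intro mult_mono) (auto simp: le_max_iff_disj)
      moreover have "cnorm A (ev A x) * cnorm A (ev A y) \<le> fam_norm A x * fam_norm A y"
        unfolding fam_norm_def using assms by (intro mult_mono) (auto simp: A.cnorm_nonneg le_max_iff_disj)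
      ultimately show ?thesis
        using A.cnorm_mult[of "ev A x" "ev A y"] assms by (simp add: fam_norm_def[of A "x * y"])
    qed
    show "fam_norm A (adj x * x) = (fam_norm A x)\<^sup>2"
    proof -
      have "cmod (cnj (sc x) * sc x) = (cmod (sc x))\<^sup>2"
        by (simp add: norm_mult power2_eq_square)
      moreover have "max (a\<^sup>2) (b\<^sup>2) = (max a b)\<^sup>2" if "a \<ge> 0" "b \<ge> 0" for a b :: real
        using that by (auto simp: max_def power_mono_iff)
      ultimately show ?thesis
        using assms by (simp add: fam_norm_def A.cstar_identity A.cnorm_nonneg)
    qed
    show "fam_norm A 1 = 1"
      using assms A.cnorm_one by (simp add: fam_norm_def)
    show "x = 0" if "x \<in> fam_algebra A" "fam_norm A x = 0"
    proof (rule fam_algebra_eqI[OF that(1)])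
      show "0 \<in> fam_algebra A"
        by (auto simp: fam_algebra_def unital_cstar_algebra.scale_zero_left ring.ring_simprules[OF cstar_ring])
      show "sc x = sc 0" "ev A x = ev A 0"
        using that(2) assms A.cnorm_nonneg[of "ev A x"] A.cnorm_eq_0[of "ev A x"]
        by (auto simp: fam_norm_def max_def split: if_splits)
    qed
  next
    fix s :: "nat \<Rightarrow> 'a fam"
    assume s: "\<And>k. s k \<in> fam_algebra A"
      and Cauchy: "\<And>e. e > 0 \<Longrightarrow> \<exists>N. \<forall>j\<ge>N. \<forall>k\<ge>N. fam_norm A (s j - s k) < e"
    have "Cauchy (\<lambda>k. sc (s k))"
      using Cauchy by (simp add: Cauchy_def dist_norm fam_norm_def assms) meson
    then obtain c where c: "(\<lambda>k. sc (s k)) \<longlonglongrightarrow> c"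
      using Cauchy_convergent convergent_def by blast
    have "\<exists>l\<in>carrier A. (\<lambda>k. cnorm A (ev A (s k) \<ominus>\<^bsub>A\<^esub> l)) \<longlonglongrightarrow> 0"
      using Cauchy assms by (intro A.complete) (auto simp: fam_norm_def, meson)
    then obtain l where l: "l \<in> carrier A" "(\<lambda>k. cnorm A (ev A (s k) \<ominus>\<^bsub>A\<^esub> l)) \<longlonglongrightarrow> 0" ..
    have "(\<lambda>k. cmod (sc (s k) - c)) \<longlonglongrightarrow> 0"
      using c by (simp add: LIM_zero tendsto_norm_zero)
    then have "(\<lambda>k. max (cmod (sc (s k) - c)) (cnorm A (ev A (s k) \<ominus>\<^bsub>A\<^esub> l))) \<longlonglongrightarrow> max 0 0"
      using l(2) by (rule tendsto_max)
    then show "\<exists>l\<in>fam_algebra A. (\<lambda>k. fam_norm A (s k - l)) \<longlonglongrightarrow> 0"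
      using l(1) assms fam_of[OF assms l(1)] by (intro bexI[of _ "fam_of A c l"]) (auto simp: fam_norm_def)
  qed
qed

text \<open>The scalar coordinate \<open>c\<close> of a self-adjoint element is real and is kept;
  the other coordinate is approximated in \<open>A\<close>. The approximant acquires at most the
  additional spectral point \<open>c\<close>.\<close>

lemma real_rank_zero_fam_algebra:
  assumes A: "unital_cstar_algebra A" and rr: "real_rank_zero A"
  shows "cstar.real_rank_zero (fam_algebra A) (fam_norm A)"
proof -
  interpret A: unital_cstar_algebra A by (rule A)
  interpret cstar "fam_algebra A" "fam_norm A" by (rule cstar_fam_algebra[OF A])
  show ?thesis
    unfolding real_rank_zero_def
  proof (intro ballI impI allI)
    fix x :: "'a fam" and e :: real
    assume x: "x \<in> fam_algebra A" "adj x = x" and e: "e > 0"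
    define c where "c = sc x"
    have c: "cnj c = c"
      using arg_cong[OF x(2), of sc] by (simp add: c_def)
    have "self_adjoint A (ev A x)"
      using arg_cong[OF x(2), of "ev A"] A by (simp add: self_adjoint_def)
    then obtain y where y: "self_adjoint A y" "finite (spectrum A y)" "cnorm A (ev A x \<ominus>\<^bsub>A\<^esub> y) < e"
      using rr e unfolding Defs.real_rank_zero_def by blast
    have y_mem: "y \<in> carrier A" "star A y = y"
      using y(1) by (auto simp: self_adjoint_def)
    define y' where "y' = fam_of A c y"
    note y' = fam_of[OF A y_mem(1), of c, folded y'_def]
    have "adj y' = y'"
      using y' y_mem c A by (intro fam_algebra_eqI[of _ A]) auto
    moreover have "finite {d. \<not> invertible (d *\<^sub>c 1 - y')}"
    proof (rule finite_subset)
      show "finite (insert c (spectrum A y))"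
        using y(2) by simp
      show "{d. \<not> invertible (d *\<^sub>c 1 - y')} \<subseteq> insert c (spectrum A y)"
      proof
        fix d assume "d \<in> {d. \<not> invertible (d *\<^sub>c 1 - y')}"
        moreover have "invertible (d *\<^sub>c 1 - y')" if "d \<notin> spectrum A y" "d \<noteq> c"
        proof -
          have "d \<odot>\<^bsub>A\<^esub> \<one>\<^bsub>A\<^esub> \<ominus>\<^bsub>A\<^esub> y \<in> Units A"
            using that(1) by (simp add: spectrum_def)
          then obtain u where u: "u \<in> carrier A" "u \<otimes>\<^bsub>A\<^esub> (d \<odot>\<^bsub>A\<^esub> \<one>\<^bsub>A\<^esub> \<ominus>\<^bsub>A\<^esub> y) = \<one>\<^bsub>A\<^esub>"
            "(d \<odot>\<^bsub>A\<^esub> \<one>\<^bsub>A\<^esub> \<ominus>\<^bsub>A\<^esub> y) \<otimes>\<^bsub>A\<^esub> u = \<one>\<^bsub>A\<^esub>"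
            unfolding Units_def by blast
          \<comment> \<open>The inverse is formed coordinatewise; \<open>d \<noteq> c\<close> is
            what the scalar coordinate demands.\<close>
          note u' = fam_of[OF A u(1), of "1 / (d - c)"]
          have "(d *\<^sub>c 1 - y') * fam_of A (1 / (d - c)) u = 1" "fam_of A (1 / (d - c)) u * (d *\<^sub>c 1 - y') = 1"
            using u u' y' that(2) A by (intro fam_algebra_eqI[of _ A]; auto)+
          then show ?thesis
            using u'(1) by (auto simp: invertible_def)
        qed
        ultimately show "d \<in> insert c (spectrum A y)" by blast
      qed
    qed
    ultimately obtain S :: "complex set" and P where P: "pou S P" "y' = comb S P (\<lambda>l. complex_of_real (Re l))"
      using spectral_decomposition[of y'] y'(1) by blast
    have "fam_norm A (x - y') < e"
      using y(3) y' e A by (simp add: fam_norm_def c_def)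
    then show "\<exists>(I :: complex set) P f. pou I P \<and> fam_norm A (x - comb I P (\<lambda>k. complex_of_real (f k))) < e"
      using P by blast
  qed
qed

text \<open>The state does not see the scalar coordinate, so the extra summand does not affect
  2-norms; faithfulness is not among the axioms of \<open>tracial_cstar\<close>.\<close>

lemma tracial_fam_algebra:
  assumes A: "unital_cstar_algebra A" and \<rho>: "tracial_state A \<rho>"
  shows "tracial_cstar (fam_algebra A) (fam_norm A) (\<lambda>x. \<rho> (ev A x))"
proof -
  interpret cstar "fam_algebra A" "fam_norm A" by (rule cstar_fam_algebra[OF A])
  show ?thesis
    using A \<rho> by unfold_locales (auto simp: tracial_state_def)
qed

lemma n2_fam:
  assumes A: "unital_cstar_algebra A" and \<rho>: "tracial_state A \<rho>"
  shows "tracial_cstar.n2 (\<lambda>x. \<rho> (ev A x)) x = norm2 A \<rho> (ev A x)"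
  using A by (simp add: tracial_cstar.n2_def[OF tracial_fam_algebra[OF A \<rho>]] norm2_def)

section \<open>Elements of the tracial ultraproduct\<close>

locale ultraproduct_setting =
  fixes A :: "nat \<Rightarrow> 'a cstar" and \<rho> :: "nat \<Rightarrow> 'a \<Rightarrow> complex" and \<alpha> :: "nat filter" and \<delta> :: "nat \<Rightarrow> real"
  assumes cstar: "unital_cstar_algebra (A i)" and rr: "real_rank_zero (A i)" and state: "tracial_state (A i) (\<rho> i)"
    and \<delta>: "0 < \<delta> i" "\<delta> i \<le> 1" "(\<delta> \<longlongrightarrow> 0) \<alpha>"
begin

sublocale S: tracial_sequence "\<lambda>i x. \<rho> i (ev (A i) x)" \<alpha> "\<lambda>i. fam_algebra (A i)" "\<lambda>i. fam_norm (A i)" \<delta>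
  by (rule tracial_sequence.intro)
    (use cstar rr state \<delta> in \<open>auto intro: tracial_fam_algebra real_rank_zero_fam_algebra\<close>)

sublocale A: unital_cstar_algebra "A i" for i
  by (rule cstar)

abbreviation "B \<equiv> bounded_product A"

definition proj :: "(nat \<Rightarrow> 'a fam) \<Rightarrow> nat \<Rightarrow> 'a" where "proj x = (\<lambda>i. ev (A i) (x i))"

text \<open>The scalar coordinate is set to 0, so the unit is preserved only up to
  \<open>\<asymp>\<close>; the choice is invisible to 2-norms.\<close>

definition emb :: "(nat \<Rightarrow> 'a) \<Rightarrow> nat \<Rightarrow> 'a fam" where "emb a = (\<lambda>i. fam_of (A i) 0 (a i))"

definition cls :: "(nat \<Rightarrow> 'a fam) \<Rightarrow> (nat \<Rightarrow> 'a) set" where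
  "cls x = {b \<in> carrier B. S.aeq (emb b) x}"

lemma carrier_B: "a \<in> carrier B \<longleftrightarrow> (\<forall>i. a i \<in> carrier (A i)) \<and> (\<exists>C. \<forall>i. cnorm (A i) (a i) \<le> C)"
  by (auto simp: bounded_product_def bdd_above_def)

lemma emb_Bd: "a \<in> carrier B \<Longrightarrow> emb a \<in> S.Bd"
proof -
  assume "a \<in> carrier B"
  then obtain C where C: "\<And>i. a i \<in> carrier (A i)" "\<And>i. cnorm (A i) (a i) \<le> C"
    by (auto simp: carrier_B)
  then show ?thesis
    using fam_of[OF cstar C(1)] by (intro S.BdI[where C = "max 0 C"]) (simp_all add: emb_def fam_norm_def max.coboundedI2)
qed

lemma proj_Bd: "x \<in> S.Bd \<Longrightarrow> proj x \<in> carrier B"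
  by (erule S.BdE) (auto simp: proj_def carrier_B cstar fam_norm_def)

lemma proj_emb: "a \<in> carrier B \<Longrightarrow> proj (emb a) = a"
  using fam_of(3)[OF cstar] by (auto simp: proj_def emb_def carrier_B)

lemma null_iff: "S.null x \<longleftrightarrow> ((\<lambda>i. norm2 (A i) (\<rho> i) (proj x i)) \<longlongrightarrow> 0) \<alpha>"
  by (simp add: null_seq_def n2_fam[OF cstar state] proj_def)

lemma aeq_proj:
  assumes "proj x = proj x'"
  shows "S.aeq x x'"
proof -
  have "proj (x - x') i = proj 0 i" for i
    using fun_cong[OF assms, of i] by (simp add: proj_def cstar A.minus_eq A.r_neg)
  then show ?thesis
    using S.null_zero unfolding S.aeq_def null_iff by simp
qed

lemma emb_proj: "x \<in> S.Bd \<Longrightarrow> S.aeq (emb (proj x)) x"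
  by (intro aeq_proj proj_emb proj_Bd)

text \<open>Identifies the cosets of the quotient with the classes of \<open>\<asymp>\<close>, so
  that calculations in the ultraproduct become calculations with bounded sequences.\<close>

lemma coset_eq_cls:
  assumes a: "a \<in> carrier B"
  shows "null_ideal \<alpha> A \<rho> +>\<^bsub>B\<^esub> a = cls (emb a)"
proof -
  have a_mem: "a i \<in> carrier (A i)" for i
    using a by (simp add: carrier_B)
  have mem: "b i \<in> carrier (A i)" if "b \<in> carrier B" for b i
    using that by (simp add: carrier_B)
  have ev_emb: "ev (A i) (emb b i) = b i" if "b \<in> carrier B" for b i
    using proj_emb[OF that] by (simp add: proj_def fun_eq_iff)
  have "b \<in> cls (emb a) \<longleftrightarrow> (\<exists>h\<in>null_ideal \<alpha> A \<rho>. b = h \<oplus>\<^bsub>B\<^esub> a)" for b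
  proof
    assume "b \<in> cls (emb a)"
    then have b: "b \<in> carrier B" "S.null (emb b - emb a)"
      by (auto simp: cls_def S.aeq_def)
    have "proj (emb b - emb a) \<in> null_ideal \<alpha> A \<rho>"
      using b(2) proj_Bd[OF S.Bd_diff[OF emb_Bd[OF b(1)] emb_Bd[OF a]]] by (simp add: null_ideal_def null_iff)
    moreover have "b = proj (emb b - emb a) \<oplus>\<^bsub>B\<^esub> a"
      using mem[OF b(1)] a_mem
      by (auto simp: proj_def bounded_product_def cstar ev_emb[OF a] ev_emb[OF b(1)] fun_eq_iff A.minus_eq
          A.a_assoc A.l_neg)
    ultimately show "\<exists>h\<in>null_ideal \<alpha> A \<rho>. b = h \<oplus>\<^bsub>B\<^esub> a" by blast
  next
    assume "\<exists>h\<in>null_ideal \<alpha> A \<rho>. b = h \<oplus>\<^bsub>B\<^esub> a"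
    then obtain h where h: "h \<in> carrier B" "((\<lambda>i. norm2 (A i) (\<rho> i) (h i)) \<longlongrightarrow> 0) \<alpha>" "b = h \<oplus>\<^bsub>B\<^esub> a"
      by (auto simp: null_ideal_def)
    have b: "b = proj (emb h + emb a)"
      by (simp add: h(3) proj_def bounded_product_def cstar ev_emb[OF a] ev_emb[OF h(1)])
    then have "b \<in> carrier B"
      using proj_Bd[OF S.Bd_add[OF emb_Bd[OF h(1)] emb_Bd[OF a]]] by simp
    moreover have "proj (emb b - emb a) = h"
    proof
      fix i
      have "proj (emb b - emb a) i = b i \<ominus>\<^bsub>A i\<^esub> a i"
        by (simp add: proj_def cstar ev_emb[OF a] ev_emb[OF \<open>b \<in> carrier B\<close>])
      also have "b i = h i \<oplus>\<^bsub>A i\<^esub> a i"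
        by (simp add: h(3) bounded_product_def)
      also have "\<dots> \<ominus>\<^bsub>A i\<^esub> a i = h i"
        using mem[OF h(1)] a_mem by (simp add: A.minus_eq A.a_assoc A.r_neg)
      finally show "proj (emb b - emb a) i = h i" .
    qed
    ultimately show "b \<in> cls (emb a)"
      using h(2) by (simp add: cls_def S.aeq_def null_iff)
  qed
  then show ?thesis
    unfolding a_r_coset_def' by blast
qed

lemma ultraproduct_class_proj:
  assumes "x \<in> S.Bd"
  shows "ultraproduct_class \<alpha> A \<rho> (proj x) = cls x"
proof -
  have "S.aeq (emb b) (emb (proj x)) \<longleftrightarrow> S.aeq (emb b) x" for b
    using emb_proj[OF assms] S.aeq_trans S.aeq_sym by blast
  then show ?thesis
    by (simp add: ultraproduct_class_def coset_eq_cls[OF proj_Bd[OF assms]] cls_def)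
qed

lemma proj_in_cls: "x \<in> S.Bd \<Longrightarrow> proj x \<in> cls x"
  by (simp add: cls_def proj_Bd emb_proj)

lemma cls_cong: "S.aeq x y \<Longrightarrow> cls x = cls y"
proof -
  assume "S.aeq x y"
  then have "S.aeq b x \<longleftrightarrow> S.aeq b y" for b
    using S.aeq_trans[of b x y] S.aeq_trans[of b y x] S.aeq_sym[of x y] by blast
  then show ?thesis
    by (simp only: cls_def)
qed

lemma cls_eq_iff: "x \<in> S.Bd \<Longrightarrow> cls x = cls y \<longleftrightarrow> S.aeq x y"
proof
  assume x: "x \<in> S.Bd" and "cls x = cls y"
  then have "proj x \<in> cls y"
    using proj_in_cls by blast
  then show "S.aeq x y"
    using emb_proj[OF x] S.aeq_trans S.aeq_sym unfolding cls_def by blast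
qed (rule cls_cong)

abbreviation "Q \<equiv> tracial_ultraproduct \<alpha> A \<rho>"

lemma carrier_Q: "carrier Q = cls ` S.Bd"
proof -
  have "carrier Q = (\<lambda>a. cls (emb a)) ` carrier B"
    using coset_eq_cls by (auto simp: tracial_ultraproduct_def cstar_quotient_def FactRing_def A_RCOSETS_def' image_iff)
  also have "\<dots> = cls ` S.Bd"
  proof
    show "(\<lambda>a. cls (emb a)) ` carrier B \<subseteq> cls ` S.Bd"
      using emb_Bd by blast
    show "cls ` S.Bd \<subseteq> (\<lambda>a. cls (emb a)) ` carrier B"
    proof
      fix X assume "X \<in> cls ` S.Bd"
      then obtain x where x: "x \<in> S.Bd" "X = cls x" by blast
      then have "X = cls (emb (proj x))"
        by (simp only: cls_cong[OF emb_proj[OF x(1)]])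
      then show "X \<in> (\<lambda>a. cls (emb a)) ` carrier B"
        using proj_Bd[OF x(1)] by blast
    qed
  qed
  finally show ?thesis .
qed

lemma mult_Q:
  assumes x: "x \<in> S.Bd" and y: "y \<in> S.Bd"
  shows "cls x \<otimes>\<^bsub>Q\<^esub> cls y = cls (x * y)"
proof -
  have "null_ideal \<alpha> A \<rho> +>\<^bsub>B\<^esub> (a \<otimes>\<^bsub>B\<^esub> b) = cls (x * y)" if "a \<in> cls x" "b \<in> cls y" for a b
  proof -
    have ab: "a \<in> carrier B" "b \<in> carrier B" "S.aeq (emb a) x" "S.aeq (emb b) y"
      using that by (auto simp: cls_def)
    have Bd: "emb a * emb b \<in> S.Bd"
      using emb_Bd ab by blast
    have prod: "a \<otimes>\<^bsub>B\<^esub> b = proj (emb a * emb b)"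
      using proj_emb[OF ab(1)] proj_emb[OF ab(2)] by (auto simp: proj_def bounded_product_def cstar fun_eq_iff)
    have "S.aeq (emb (a \<otimes>\<^bsub>B\<^esub> b)) (emb a * emb b)"
      unfolding prod by (rule emb_proj[OF Bd])
    also have "S.aeq (emb a * emb b) (x * y)"
      using ab x emb_Bd by (intro S.aeq_mult) auto
    finally show ?thesis
      using proj_Bd[OF Bd] by (simp add: coset_eq_cls prod cls_cong)
  qed
  then show ?thesis
    using proj_in_cls[OF x] proj_in_cls[OF y]
    by (auto simp: tracial_ultraproduct_def cstar_quotient_def FactRing_def rcoset_mult_def)
qed

lemma star_Q:
  assumes x: "x \<in> S.Bd"
  shows "star Q (cls x) = cls (adj x)"
proof -
  have "null_ideal \<alpha> A \<rho> +>\<^bsub>B\<^esub> star B a = cls (adj x)" if "a \<in> cls x" for a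
  proof -
    have a: "a \<in> carrier B" "S.aeq (emb a) x"
      using that by (auto simp: cls_def)
    have Bd: "adj (emb a) \<in> S.Bd"
      using emb_Bd a by blast
    have star: "star B a = proj (adj (emb a))"
      using proj_emb[OF a(1)] by (auto simp: proj_def bounded_product_def cstar fun_eq_iff)
    have "S.aeq (emb (star B a)) (adj (emb a))"
      unfolding star by (rule emb_proj[OF Bd])
    also have "S.aeq (adj (emb a)) (adj x)"
      by (rule S.aeq_adj[OF a(2)])
    finally show ?thesis
      using proj_Bd[OF Bd] by (simp add: coset_eq_cls star cls_cong)
  qed
  then show ?thesis
    using proj_in_cls[OF x] by (auto simp: tracial_ultraproduct_def cstar_quotient_def)
qed

lemma one_Q: "\<one>\<^bsub>Q\<^esub> = cls 1"
proof -
  have "\<one>\<^bsub>B\<^esub> = proj 1"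
    by (simp add: proj_def bounded_product_def cstar)
  then have "\<one>\<^bsub>Q\<^esub> = ultraproduct_class \<alpha> A \<rho> (proj 1)"
    by (simp add: tracial_ultraproduct_def cstar_quotient_def FactRing_def ultraproduct_class_def)
  then show ?thesis
    by (simp add: ultraproduct_class_proj)
qed

lemma unitary_Q:
  assumes "X \<in> carrier (unitary_group Q)"
  obtains x where "x \<in> S.Bd" "X = cls x" "S.aeq (adj x * x) 1" "S.aeq (x * adj x) 1"
proof -
  obtain x where x: "x \<in> S.Bd" "X = cls x"
    using assms by (auto simp: unitary_group_def carrier_Q)
  then have "cls (adj x * x) = cls 1" "cls (x * adj x) = cls 1"
    using assms by (auto simp: unitary_group_def star_Q mult_Q one_Q)
  then show thesis
    using that[OF x] x(1) by (simp add: cls_eq_iff S.Bd_mult S.Bd_adj)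
qed

end

text \<open>Let \<open>m i\<close> be the first index with \<open>i \<notin> E (m i)\<close>, which
  exists as the intersection is empty. On the intersection of \<open>E 0\<close> to
  \<open>E k\<close>, a set of the ultrafilter, \<open>m i\<close> exceeds \<open>k\<close>; hence
  \<open>1 / (m i + 1)\<close> tends to 0.\<close>

lemma nontrivial_ultrafilter_null_sequence:
  assumes "nontrivial_ultrafilter \<alpha>"
  obtains \<delta> :: "nat \<Rightarrow> real" where "\<And>i. 0 < \<delta> i" "\<And>i. \<delta> i \<le> 1" "(\<delta> \<longlongrightarrow> 0) \<alpha>"
proof -
  obtain E :: "nat \<Rightarrow> nat set" where E: "\<And>n. eventually (\<lambda>i. i \<in> E n) \<alpha>" "(\<Inter>n. E n) = {}"
    using assms by (auto simp: nontrivial_ultrafilter_def)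
  define m where "m i = (LEAST n. i \<notin> E n)" for i
  have "((\<lambda>i. 1 / (real (m i) + 1)) \<longlongrightarrow> 0) \<alpha>"
  proof (rule tendstoI)
    fix e :: real assume "e > 0"
    then obtain k where k: "1 / (real k + 1) < e"
      using nat_approx_posE[of e] by (auto simp: add.commute)
    have "eventually (\<lambda>i. \<forall>n\<in>{..k}. i \<in> E n) \<alpha>"
      using E(1) by (simp add: eventually_ball_finite)
    then show "eventually (\<lambda>i. dist (1 / (real (m i) + 1)) 0 < e) \<alpha>"
    proof eventually_elim
      case (elim i)
      obtain n where "i \<notin> E n"
        using E(2) by blast
      then have "i \<notin> E (m i)"
        unfolding m_def by (rule LeastI)
      then have "m i > k"
        using elim by (meson atMost_iff not_le)
      then have "1 / (real (m i) + 1) \<le> 1 / (real k + 1)"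
        by (intro divide_left_mono) auto
      then show ?case
        using k by (simp add: dist_norm)
    qed
  qed
  then show thesis
    by (intro that[of "\<lambda>i. 1 / (real (m i) + 1)"]) auto
qed

section \<open>Homomorphisms from presented groups\<close>

definition word_class :: "'x set \<Rightarrow> ('x word \<times> 'x word) set \<Rightarrow> 'x word \<Rightarrow> 'x word set" where
  "word_class S R w = {v. word_eq S R w v}"

lemma words_append: "u \<in> words S \<Longrightarrow> v \<in> words S \<Longrightarrow> u @ v \<in> words S"
  by (simp add: words_def)

lemma word_eq_words: "word_eq S R u v \<Longrightarrow> u \<in> words S \<and> v \<in> words S"
  by (induction rule: word_eq.induct) (auto simp: words_def)

lemma word_class_eq_iff: "u \<in> words S \<Longrightarrow> word_class S R u = word_class S R v \<longleftrightarrow> word_eq S R u v"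
  unfolding word_class_def by (blast intro: word_eq.refl word_eq.sym word_eq.trans)

lemma carrier_presented_group: "carrier (presented_group S R) = word_class S R ` words S"
  by (auto simp: presented_group_def quotient_def word_class_def)

lemma mult_presented_group:
  assumes "u \<in> words S" "v \<in> words S"
  shows "word_class S R u \<otimes>\<^bsub>presented_group S R\<^esub> word_class S R v = word_class S R (u @ v)"
proof -
  have "word_class S R (u' @ v') = word_class S R (u @ v)" if "word_eq S R u u'" "word_eq S R v v'" for u' v'
    using word_eq.append[OF that] assms by (simp add: word_class_eq_iff[symmetric] words_append)
  then have "(\<Union>u'\<in>word_class S R u. \<Union>v'\<in>word_class S R v. word_class S R (u' @ v'))
      = (\<Union>u'\<in>word_class S R u. \<Union>v'\<in>word_class S R v. word_class S R (u @ v))"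
    by (intro SUP_cong HOL.refl) (auto simp: word_class_def)
  moreover have "u \<in> word_class S R u" "v \<in> word_class S R v"
    using assms by (auto simp: word_class_def intro: word_eq.refl)
  ultimately show ?thesis
    by (auto simp: presented_group_def word_class_def[of S R "_ @ _"])
qed

lemma one_presented_group: "\<one>\<^bsub>presented_group S R\<^esub> = word_class S R []"
  by (simp add: presented_group_def word_class_def)

lemma group_presented_group: "group (presented_group S R)"
proof (rule groupI)
  show "\<one>\<^bsub>presented_group S R\<^esub> \<in> carrier (presented_group S R)"
    by (simp add: carrier_presented_group one_presented_group words_def)
next
  fix x y
  assume "x \<in> carrier (presented_group S R)" "y \<in> carrier (presented_group S R)"
  then show "x \<otimes>\<^bsub>presented_group S R\<^esub> y \<in> carrier (presented_group S R)"
    by (auto simp: carrier_presented_group mult_presented_group words_append)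
next
  fix x y z
  assume "x \<in> carrier (presented_group S R)" "y \<in> carrier (presented_group S R)" "z \<in> carrier (presented_group S R)"
  then show "x \<otimes>\<^bsub>presented_group S R\<^esub> y \<otimes>\<^bsub>presented_group S R\<^esub> z = x \<otimes>\<^bsub>presented_group S R\<^esub> (y \<otimes>\<^bsub>presented_group S R\<^esub> z)"
    by (auto simp: carrier_presented_group mult_presented_group words_append)
next
  fix x assume "x \<in> carrier (presented_group S R)"
  then obtain w where w: "w \<in> words S" "x = word_class S R w"
    by (auto simp: carrier_presented_group)
  have nil: "[] \<in> words S"
    by (simp add: words_def)
  show "\<one>\<^bsub>presented_group S R\<^esub> \<otimes>\<^bsub>presented_group S R\<^esub> x = x"
    using w nil by (simp add: one_presented_group mult_presented_group)
  have "\<exists>v\<in>words S. word_eq S R (v @ w) []"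
    using w(1)
  proof (induction w)
    case Nil
    then show ?case by (intro bexI[of _ "[]"]) (auto simp: words_def intro: word_eq.refl)
  next
    case (Cons a w)
    obtain x e where a: "a = (x, e)" "x \<in> S"
      using Cons.prems by (cases a) (auto simp: words_def)
    have w: "w \<in> words S"
      using Cons.prems by (simp add: words_def)
    then obtain v where v: "v \<in> words S" "word_eq S R (v @ w) []"
      using Cons.IH by blast
    have "word_eq S R [(x, \<not> e), (x, e)] []"
      using word_eq.cancel[OF a(2), of R "\<not> e"] by simp
    then have "word_eq S R (v @ [(x, \<not> e), (x, e)] @ w) (v @ [] @ w)"
      using v w by (intro word_eq.append word_eq.refl)
    then have "word_eq S R ((v @ [(x, \<not> e)]) @ a # w) []"
      using word_eq.trans v(2) by (fastforce simp: a)
    moreover have "v @ [(x, \<not> e)] \<in> words S"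
      using v a by (simp add: words_def)
    ultimately show ?case by blast
  qed
  then obtain v where "v \<in> words S" "word_eq S R (v @ w) []" by blast
  then show "\<exists>y\<in>carrier (presented_group S R). y \<otimes>\<^bsub>presented_group S R\<^esub> x = \<one>\<^bsub>presented_group S R\<^esub>"
    using w by (intro bexI[of _ "word_class S R v"])
      (auto simp: carrier_presented_group mult_presented_group one_presented_group word_class_eq_iff words_append)
qed

primrec word_eval :: "('h, 'm) monoid_scheme \<Rightarrow> ('x \<Rightarrow> 'h) \<Rightarrow> 'x word \<Rightarrow> 'h" where
  "word_eval H g [] = \<one>\<^bsub>H\<^esub>"
| "word_eval H g (a # w) = (if snd a then g (fst a) else inv\<^bsub>H\<^esub> g (fst a)) \<otimes>\<^bsub>H\<^esub> word_eval H g w"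

context group
begin

lemma word_eval_closed:
  assumes "\<And>x. x \<in> S \<Longrightarrow> g x \<in> carrier G" "w \<in> words S"
  shows "word_eval G g w \<in> carrier G"
  using assms(2) by (induction w) (auto simp: words_def assms(1))

lemma word_eval_append:
  assumes "\<And>x. x \<in> S \<Longrightarrow> g x \<in> carrier G" "u \<in> words S" "v \<in> words S"
  shows "word_eval G g (u @ v) = word_eval G g u \<otimes> word_eval G g v"
  using assms(2)
proof (induction u)
  case Nil
  then show ?case using word_eval_closed[of S g v] assms by simp
next
  case (Cons a u)
  then have "fst a \<in> S" "u \<in> words S"
    by (auto simp: words_def)
  then show ?case
    using Cons.IH word_eval_closed[of S g u] word_eval_closed[of S g v] assms by (auto simp: m_assoc)
qed

lemma word_eval_gen_power: "g x \<in> carrier G \<Longrightarrow> word_eval G g (gen_power x k) = g x [^] k"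
proof (induction k)
  case (Suc k)
  then show ?case
    using nat_pow_Suc2[of "g x" k]
    by (simp only: gen_power_def replicate_Suc word_eval.simps fst_conv snd_conv if_True)
qed (simp add: gen_power_def)

text \<open>The universal property of a presentation: evaluation of words respects the generating
  steps of \<open>word_eq\<close>, so it may be read off any representative.\<close>

lemma presented_group_hom:
  assumes g: "\<And>x. x \<in> S \<Longrightarrow> g x \<in> carrier G"
    and R: "\<And>u v. (u, v) \<in> R \<Longrightarrow> u \<in> words S \<Longrightarrow> v \<in> words S \<Longrightarrow> word_eval G g u = word_eval G g v"
  obtains \<phi> where "\<phi> \<in> hom (presented_group S R) G" "\<And>w. w \<in> words S \<Longrightarrow> \<phi> (word_class S R w) = word_eval G g w"
proof -
  have eval_eq: "word_eval G g u = word_eval G g v" if "word_eq S R u v" for u v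
    using that
  proof (induction rule: word_eq.induct)
    case (append u u' v v')
    then have "u \<in> words S" "u' \<in> words S" "v \<in> words S" "v' \<in> words S"
      using word_eq_words by blast+
    then show ?case
      using append.IH word_eval_append[of S g u v] word_eval_append[of S g u' v'] g by simp
  next
    case (cancel x e)
    then show ?case
      using g[of x] by (cases e) auto
  qed (use R in auto)
  define \<phi> where "\<phi> X = word_eval G g (SOME w. w \<in> X)" for X
  have \<phi>: "\<phi> (word_class S R w) = word_eval G g w" if "w \<in> words S" for w
  proof -
    have "(SOME v. v \<in> word_class S R w) \<in> word_class S R w"
      by (rule someI[of _ w]) (simp add: word_class_def word_eq.refl[OF that])
    then show ?thesis
      using eval_eq by (simp add: \<phi>_def word_class_def)
  qed
  have "\<phi> \<in> hom (presented_group S R) G"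
    using word_eval_closed[OF g] word_eval_append[OF g]
    by (auto simp: hom_def carrier_presented_group mult_presented_group \<phi> words_append)
  then show thesis
    using \<phi> by (rule that)
qed

end

context unital_cstar_algebra
begin

lemma group_unitary_group: "group (unitary_group A)"
proof (rule groupI)
  fix x y assume x: "x \<in> carrier (unitary_group A)" and y: "y \<in> carrier (unitary_group A)"
  then have xy: "x \<in> carrier A" "y \<in> carrier A" "star A x \<otimes> x = \<one>" "x \<otimes> star A x = \<one>" "star A y \<otimes> y = \<one>" "y \<otimes> star A y = \<one>"
    by (auto simp: unitary_group_def)
  have "star A (x \<otimes> y) \<otimes> (x \<otimes> y) = star A y \<otimes> ((star A x \<otimes> x) \<otimes> y)"
    using xy(1,2) by (simp add: star_mult m_assoc)
  moreover have "(x \<otimes> y) \<otimes> star A (x \<otimes> y) = x \<otimes> ((y \<otimes> star A y) \<otimes> star A x)"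
    using xy(1,2) by (simp add: star_mult m_assoc)
  ultimately show "x \<otimes>\<^bsub>unitary_group A\<^esub> y \<in> carrier (unitary_group A)"
    using xy by (simp add: unitary_group_def)
next
  fix x assume x: "x \<in> carrier (unitary_group A)"
  then show "\<exists>y\<in>carrier (unitary_group A). y \<otimes>\<^bsub>unitary_group A\<^esub> x = \<one>\<^bsub>unitary_group A\<^esub>"
    by (intro bexI[of _ "star A x"]) (auto simp: unitary_group_def star_star)
qed (auto simp: unitary_group_def m_assoc)

lemma inv_unitary_group:
  assumes "u \<in> carrier (unitary_group A)"
  shows "inv\<^bsub>unitary_group A\<^esub> u = star A u"
  using assms by (intro group.inv_equality[OF group_unitary_group]) (auto simp: unitary_group_def star_star)

lemma unitary_group_nat_pow: "u [^]\<^bsub>unitary_group A\<^esub> (n :: nat) = u [^] n"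
  by (simp add: nat_pow_def unitary_group_def)

end

section \<open>Stability of chain groups\<close>

context ultraproduct_setting
begin

text \<open>Counterpart of \<open>word_eval\<close> for sequences of families, with
  \<open>adj\<close> as the inverse; it is compared with \<open>f\<close> in the ultraproduct and
  with the lifts in each fibre.\<close>

primrec seq_eval :: "('x \<Rightarrow> nat \<Rightarrow> 'a fam) \<Rightarrow> 'x word \<Rightarrow> nat \<Rightarrow> 'a fam" where
  "seq_eval u [] = 1"
| "seq_eval u (a # w) = (if snd a then u (fst a) else adj (u (fst a))) * seq_eval u w"

lemma unitary_seq_ev:
  assumes "S.unitary_seq u"
  shows "ev (A i) (u i) \<in> carrier (unitary_group (A i))"
proof -
  have "adj (u i) * u i = 1" "u i * adj (u i) = 1"
    using assms unfolding S.unitary_seq_def by (metis adj_fun_apply one_fun_apply times_fun_apply)+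
  from this[THEN arg_cong[where f = "ev (A i)"]] show ?thesis
    by (simp add: unitary_group_def cstar)
qed

text \<open>Membership in \<open>hom\<close> gives only closure and multiplicativity, so the images
  of the unit and of inverse letters are determined directly from the unitarity relations.\<close>

lemma hom_presented_group_seq_eval:
  assumes f: "f \<in> hom (presented_group T R) (unitary_group Q)"
    and u: "\<And>x. x \<in> T \<Longrightarrow> S.unitary_seq (u x)" "\<And>x. x \<in> T \<Longrightarrow> f (word_class T R [(x, True)]) = cls (u x)"
    and w: "w \<in> words T"
  shows "seq_eval u w \<in> S.Bd \<and> f (word_class T R w) = cls (seq_eval u w)"
proof -
  have unitary: "f (word_class T R v) \<in> carrier (unitary_group Q)" if "v \<in> words T" for v
    using f that by (auto simp: hom_def carrier_presented_group)
  have mult: "f (word_class T R (v @ v')) = f (word_class T R v) \<otimes>\<^bsub>Q\<^esub> f (word_class T R v')"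
    if "v \<in> words T" "v' \<in> words T" for v v'
  proof -
    have "f (word_class T R v \<otimes>\<^bsub>presented_group T R\<^esub> word_class T R v')
        = f (word_class T R v) \<otimes>\<^bsub>unitary_group Q\<^esub> f (word_class T R v')"
      by (rule hom_mult[OF f]) (auto simp: carrier_presented_group that)
    then show ?thesis
      by (simp add: mult_presented_group that unitary_group_def)
  qed
  have nil: "[] \<in> words T"
    by (simp add: words_def)
  have one: "f (word_class T R []) = cls 1"
  proof -
    obtain x where x: "x \<in> S.Bd" "f (word_class T R []) = cls x" "S.aeq (adj x * x) 1" "S.aeq (x * adj x) 1"
      by (rule unitary_Q[OF unitary[OF nil]])
    then have "cls x = cls (x * x)"
      using mult[OF nil nil] by (simp add: mult_Q)
    then have xx: "S.aeq x (x * x)"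
      using x(1) by (simp add: cls_eq_iff)
    \<comment> \<open>An idempotent unitary is the unit: cancel one factor of
      \<open>x * x \<asymp> x\<close> with \<open>adj x\<close>.\<close>
    have "S.aeq x (1 * x)"
      by simp
    also have "S.aeq (1 * x) (adj x * x * x)"
      using x by (intro S.aeq_mult_right S.aeq_sym[OF x(3)])
    also have "adj x * x * x = adj x * (x * x)"
      by (rule mult.assoc)
    also have "S.aeq (adj x * (x * x)) (adj x * x)"
      using x by (intro S.aeq_mult_left S.aeq_sym[OF xx]) auto
    also note x(3)
    finally show ?thesis
      by (simp add: x(2) cls_cong)
  qed
  have letter: "f (word_class T R [(x, e)]) = cls (if e then u x else adj (u x))" if x: "x \<in> T" for x e
  proof (cases e)
    case True
    then show ?thesis using u(2)[OF x] by simp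
  next
    case False
    have words: "[(x, False)] \<in> words T" "[(x, True)] \<in> words T"
      using x by (auto simp: words_def)
    have u_Bd: "u x \<in> S.Bd"
      by (rule S.unitary_seq_Bd[OF u(1)[OF x]])
    obtain v where v: "v \<in> S.Bd" "f (word_class T R [(x, False)]) = cls v" "S.aeq (adj v * v) 1" "S.aeq (v * adj v) 1"
      by (rule unitary_Q[OF unitary[OF words(1)]])
    have "word_eq T R ([(x, False)] @ [(x, True)]) []"
      using word_eq.cancel[OF x, of R False] by simp
    then have "word_class T R ([(x, False)] @ [(x, True)]) = word_class T R []"
      by (subst word_class_eq_iff) (simp_all add: words_def x)
    then have "cls v \<otimes>\<^bsub>Q\<^esub> cls (u x) = cls 1"
      using mult[OF words] by (simp only: one v(2) u(2)[OF x])
    then have vu: "S.aeq (v * u x) 1"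
      using v(1) u_Bd by (simp add: mult_Q cls_eq_iff S.Bd_mult)
    have "v = v * u x * adj (u x)"
      using u(1)[OF x] by (simp add: S.unitary_seq_def mult.assoc)
    also have "S.aeq (v * u x * adj (u x)) (1 * adj (u x))"
      using u_Bd by (intro S.aeq_mult_right vu) auto
    finally show ?thesis
      using False v(2) by (simp add: cls_cong)
  qed
  show ?thesis
    using w
  proof (induction w)
    case Nil
    show ?case
      using one S.Bd_one by (simp only: seq_eval.simps simp_thms)
  next
    case (Cons a w)
    obtain x e where a: "a = (x, e)" "x \<in> T"
      using Cons.prems by (cases a) (auto simp: words_def)
    have w: "w \<in> words T" "[(x, e)] \<in> words T"
      using Cons.prems a by (auto simp: words_def)
    have u_Bd: "(if e then u x else adj (u x)) \<in> S.Bd"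
      using S.unitary_seq_Bd[OF u(1)[OF a(2)]] by auto
    have eval: "seq_eval u (a # w) = (if e then u x else adj (u x)) * seq_eval u w"
      by (simp only: a seq_eval.simps fst_conv snd_conv)
    have "f (word_class T R ([(x, e)] @ w)) = cls (if e then u x else adj (u x)) \<otimes>\<^bsub>Q\<^esub> cls (seq_eval u w)"
      using Cons.IH[OF w(1)] mult[OF w(2,1)] letter[OF a(2)] by simp
    also have "\<dots> = cls (seq_eval u (a # w))"
      unfolding eval using Cons.IH[OF w(1)] u_Bd by (intro mult_Q) auto
    finally have "f (word_class T R (a # w)) = cls (seq_eval u (a # w))"
      by (simp only: a append.simps)
    then show ?case
      unfolding eval using Cons.IH[OF w(1)] u_Bd by blast
  qed
qed

lemma chain_group_liftable:
  assumes n: "n > 0" and ab: "\<And>i. i \<in> {1..<n} \<Longrightarrow> a i > 0 \<and> b i > 0"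
    and f: "f \<in> hom (chain_group n a b) (unitary_group Q)"
  shows "liftable \<alpha> A \<rho> (chain_group n a b) f"
proof -
  define R where "R = {(gen_power i (a i), gen_power (i + 1) (b i)) | i. i \<in> {1..<n}}"
  have G: "chain_group n a b = presented_group {1..n} R"
    by (simp add: chain_group_def R_def)
  note f = f[unfolded G]
  have gen_words: "gen_power j k \<in> words {1..n}" if "j \<in> {1..n}" for j k
    using that by (auto simp: gen_power_def words_def)
  have "\<forall>j\<in>{1..n}. \<exists>x. x \<in> S.Bd \<and> f (word_class {1..n} R [(j, True)]) = cls x \<and>
      S.aeq (adj x * x) 1 \<and> S.aeq (x * adj x) 1"
  proof
    fix j assume "j \<in> {1..n}"
    then have "f (word_class {1..n} R [(j, True)]) \<in> carrier (unitary_group Q)"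
      using f by (auto simp: hom_def carrier_presented_group words_def)
    then show "\<exists>x. x \<in> S.Bd \<and> f (word_class {1..n} R [(j, True)]) = cls x \<and>
      S.aeq (adj x * x) 1 \<and> S.aeq (x * adj x) 1"
      by (rule unitary_Q) blast
  qed
  from bchoice[OF this] obtain x where "\<forall>j\<in>{1..n}. x j \<in> S.Bd \<and> f (word_class {1..n} R [(j, True)]) = cls (x j) \<and>
      S.aeq (adj (x j) * x j) 1 \<and> S.aeq (x j * adj (x j)) 1" ..
  then have x: "\<And>j. j \<in> {1..n} \<Longrightarrow> x j \<in> S.Bd"
      "\<And>j. j \<in> {1..n} \<Longrightarrow> f (word_class {1..n} R [(j, True)]) = cls (x j)"
      "\<And>j. j \<in> {1..n} \<Longrightarrow> S.aeq (adj (x j) * x j) 1" "\<And>j. j \<in> {1..n} \<Longrightarrow> S.aeq (x j * adj (x j)) 1"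
    by blast+
  \<comment> \<open>Positive powers suffice, as all exponents in the relations are positive, and
    they avoid the image of the empty word.\<close>
  have gen: "f (word_class {1..n} R (gen_power j (Suc k))) = cls (x j ^ Suc k)" if j: "j \<in> {1..n}" for j k
  proof (induction k)
    case 0
    then show ?case
      using x(2)[OF j] by (simp add: gen_power_def)
  next
    case (Suc k)
    have w: "[(j, True)] \<in> words {1..n}"
      using j by (simp add: words_def)
    have "gen_power j (Suc (Suc k)) = [(j, True)] @ gen_power j (Suc k)"
      by (simp add: gen_power_def)
    then have "f (word_class {1..n} R (gen_power j (Suc (Suc k))))
        = f (word_class {1..n} R [(j, True)] \<otimes>\<^bsub>presented_group {1..n} R\<^esub> word_class {1..n} R (gen_power j (Suc k)))"
      by (simp only: mult_presented_group[OF w gen_words[OF j]])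
    also have "\<dots> = f (word_class {1..n} R [(j, True)]) \<otimes>\<^bsub>unitary_group Q\<^esub>
        f (word_class {1..n} R (gen_power j (Suc k)))"
      using w gen_words[OF j] by (intro hom_mult[OF f]) (auto simp: carrier_presented_group)
    also have "\<dots> = cls (x j) \<otimes>\<^bsub>unitary_group Q\<^esub> cls (x j ^ Suc k)"
      by (simp only: Suc x(2)[OF j])
    also have "\<dots> = cls (x j) \<otimes>\<^bsub>Q\<^esub> cls (x j ^ Suc k)"
      by (simp add: unitary_group_def)
    also have "\<dots> = cls (x j ^ Suc (Suc k))"
      using x(1)[OF j] by (subst mult_Q) (simp_all only: S.Bd_power S.Bd_mult power_Suc)
    finally show ?case .
  qed
  have rel: "S.aeq (x j ^ a j) (x (Suc j) ^ b j)" if j: "j \<in> {1..<n}" for j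
  proof -
    have j': "j \<in> {1..n}" "Suc j \<in> {1..n}"
      using j by auto
    obtain k l where kl: "a j = Suc k" "b j = Suc l"
      using ab[OF j] gr0_implies_Suc by blast
    have "(gen_power j (a j), gen_power (Suc j) (b j)) \<in> R"
      using j by (auto simp: R_def)
    then have "word_class {1..n} R (gen_power j (a j)) = word_class {1..n} R (gen_power (Suc j) (b j))"
      using gen_words j' by (subst word_class_eq_iff) (auto intro: word_eq.relation)
    then have "cls (x j ^ a j) = cls (x (Suc j) ^ b j)"
      using gen[OF j'(1), of k] gen[OF j'(2), of l] by (simp only: kl)
    then show ?thesis
      using S.Bd_power[OF x(1)[OF j'(1)]] by (simp only: cls_eq_iff)
  qed
  define N where "N j = (\<Prod>k\<in>{1..<j}. b k) * (\<Prod>k\<in>{j..<n}. a k)" for j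
  \<comment> \<open>The product \<open>N j\<close> without its factor \<open>a j\<close>, which is
    also \<open>N (Suc j)\<close> without its factor \<open>b j\<close>.\<close>
  define M where "M j = (\<Prod>k\<in>{1..<j}. b k) * (\<Prod>k\<in>{Suc j..<n}. a k)" for j
  have N: "N j = a j * M j \<and> N (Suc j) = b j * M j \<and> M j > 0 \<and> a j > 0 \<and> b j > 0" if j: "j \<in> {1..<n}" for j
  proof -
    have "(\<Prod>k\<in>{j..<n}. a k) = a j * (\<Prod>k\<in>{Suc j..<n}. a k)"
      using j by (simp add: prod.atLeast_Suc_lessThan)
    moreover have "(\<Prod>k\<in>{1..<Suc j}. b k) = (\<Prod>k\<in>{1..<j}. b k) * b j"
      using j by (simp add: prod.atLeastLessThan_Suc)
    moreover have "M j > 0"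
      using ab j unfolding M_def by (intro mult_pos_pos prod_pos) auto
    ultimately show ?thesis
      using ab[OF j] by (simp add: N_def M_def)
  qed
  have N1: "N 1 > 0"
    using ab unfolding N_def by (intro mult_pos_pos prod_pos) auto
  obtain u where u: "\<And>j. j \<in> {1..n} \<Longrightarrow> S.unitary_seq (u j) \<and> S.aeq (u j) (x j)"
    and u_rel: "\<And>j. j \<in> {1..<n} \<Longrightarrow> u j ^ a j = u (Suc j) ^ b j"
    using S.chain_lift[where x = x and n = n and a = a and b = b and N = N and M = M,
        OF x(1) x(3) x(4) rel N n N1] by blast
  define g where "g i j = ev (A i) (u j i)" for i j
  have g_mem: "g i j \<in> carrier (unitary_group (A i))" if "j \<in> {1..n}" for i j
    unfolding g_def using u[OF that] by (intro unitary_seq_ev) simp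
  have g_rel: "word_eval (unitary_group (A i)) (g i) v = word_eval (unitary_group (A i)) (g i) w"
    if vw: "(v, w) \<in> R" for i v w
  proof -
    interpret U: group "unitary_group (A i)"
      by (rule A.group_unitary_group)
    obtain j where j: "j \<in> {1..<n}" "v = gen_power j (a j)" "w = gen_power (Suc j) (b j)"
      using vw unfolding R_def Suc_eq_plus1 by blast
    then have j': "j \<in> {1..n}" "Suc j \<in> {1..n}"
      by auto
    have "ev (A i) ((u j ^ a j) i) = ev (A i) ((u (Suc j) ^ b j) i)"
      by (simp only: u_rel[OF j(1)])
    then have "g i j [^]\<^bsub>A i\<^esub> a j = g i (Suc j) [^]\<^bsub>A i\<^esub> b j"
      by (simp add: g_def ev_power[OF cstar])
    then show ?thesis
      using g_mem[OF j'(1)] g_mem[OF j'(2)]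
      by (simp add: j U.word_eval_gen_power A.unitary_group_nat_pow)
  qed
  have "\<exists>\<phi>. \<phi> \<in> hom (presented_group {1..n} R) (unitary_group (A i)) \<and>
      (\<forall>w\<in>words {1..n}. \<phi> (word_class {1..n} R w) = word_eval (unitary_group (A i)) (g i) w)" for i
    by (rule group.presented_group_hom[OF A.group_unitary_group, where S = "{1..n}" and R = R and g = "g i"])
      (use g_mem g_rel in blast)+
  then obtain \<phi> where \<phi>: "\<And>i. \<phi> i \<in> hom (presented_group {1..n} R) (unitary_group (A i))"
    "\<And>i w. w \<in> words {1..n} \<Longrightarrow> \<phi> i (word_class {1..n} R w) = word_eval (unitary_group (A i)) (g i) w"
    by metis
  have eval: "proj (seq_eval u w) = (\<lambda>i. word_eval (unitary_group (A i)) (g i) w)" if "w \<in> words {1..n}" for w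
    using that
  proof (induction w)
    case Nil
    show ?case by (simp add: proj_def cstar unitary_group_def)
  next
    case (Cons c w)
    then have "fst c \<in> {1..n}" "w \<in> words {1..n}"
      by (auto simp: words_def)
    then show ?case
      using Cons.IH g_mem[of "fst c"] A.inv_unitary_group
      by (auto simp: proj_def cstar fun_eq_iff g_def unitary_group_def)
  qed
  have "f X = ultraproduct_class \<alpha> A \<rho> (\<lambda>i. \<phi> i X)" if X: "X \<in> carrier (presented_group {1..n} R)" for X
  proof -
    obtain w where w: "w \<in> words {1..n}" "X = word_class {1..n} R w"
      using X by (auto simp: carrier_presented_group)
    \<comment> \<open>The lifts \<open>u j\<close> represent the same classes as the
      \<open>x j\<close>, so \<open>f\<close> can be evaluated on words through them.\<close>
    have "f (word_class {1..n} R [(j, True)]) = cls (u j)" if "j \<in> {1..n}" for j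
      using x(2)[OF that] cls_cong[of "u j" "x j"] u[OF that] by simp
    then have "seq_eval u w \<in> S.Bd" "f X = cls (seq_eval u w)"
      using hom_presented_group_seq_eval[OF f _ _ w(1), of u] u w(2) by auto
    then show ?thesis
      using ultraproduct_class_proj[of "seq_eval u w"] by (simp only: eval[OF w(1)] w(2) \<phi>(2)[OF w(1)])
  qed
  then show ?thesis
    using \<phi>(1) unfolding liftable_def G by blast
qed

end

theorem theorem8:
  fixes n :: nat and a b :: "nat \<Rightarrow> nat"
  assumes "n > 0"
    and "\<And>i. i \<in> {1..<n} \<Longrightarrow> a i \<ge> 2"
    and "\<And>i. i \<in> {1..<n} \<Longrightarrow> b i \<ge> 2"
    and "\<And>i j. i \<in> {1..<n} \<Longrightarrow> j \<in> {1..<n} \<Longrightarrow> i > j \<Longrightarrow> gcd (a i) (b j) = 1"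
  shows "RR0_stable TYPE('a) (chain_group n a b)"
  unfolding RR0_stable_def
proof (intro conjI allI impI ballI)
  show "group (chain_group n a b)"
    unfolding chain_group_def by (rule group_presented_group)
  fix \<alpha> :: "nat filter" and A :: "nat \<Rightarrow> 'a cstar" and \<rho> f
  assume H: "nontrivial_ultrafilter \<alpha> \<and>
      (\<forall>i. unital_cstar_algebra (A i) \<and> real_rank_zero (A i) \<and> tracial_state (A i) (\<rho> i))"
    and f: "f \<in> hom (chain_group n a b) (unitary_group (tracial_ultraproduct \<alpha> A \<rho>))"
  obtain \<delta> :: "nat \<Rightarrow> real" where "\<And>i. 0 < \<delta> i" "\<And>i. \<delta> i \<le> 1" "(\<delta> \<longlongrightarrow> 0) \<alpha>"
    using H nontrivial_ultrafilter_null_sequence by metis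
  then interpret ultraproduct_setting A \<rho> \<alpha> \<delta>
    using H by (intro ultraproduct_setting.intro) auto
  show "liftable \<alpha> A \<rho> (chain_group n a b) f"
  proof (rule chain_group_liftable[OF assms(1) _ f])
    show "a i > 0 \<and> b i > 0" if "i \<in> {1..<n}" for i
      using assms(2,3)[OF that] by auto
  qed
qed

end
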